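(* Let $\sigma$ be a partition of the set of all primes and let $G$ be a finite group. Then $m_\sigma(G)=2$ if and only if $G$ is a Schmidt group with abelian Sylow subgroups such that $|\sigma(G)|=|\pi(G)|$.
   Context: All groups are finite. $\sigma=\{\sigma_i\mid i\in I\}$, $I\subseteq\mathbb{N}$, is a partition of the set $\mathbb{P}$ of all primes: $\mathbb{P}=\bigcup_{i\in I}\sigma_i$ and $\sigma_i\cap\sigma_j=\emptyset$ for $i\neq j$. $\pi(G)$ is the set of primes dividing $|G|$ and $\sigma(G)=\{\sigma_i\mid\sigma_i\cap\pi(G)\neq\emptyset\}$. A group $G$ is $\sigma$-primary if $|\sigma(G)|\leq 1$. A subgroup $A$ of $G$ is $\sigma$-subnormal in $G$ if there is a subgroup chain $A=A_0\leq A_1\leq\cdots\leq A_t=G$ such that for each $i=1,\ldots,t$ either $A_{i-1}\trianglelefteq A_i$ or $A_i/(A_{i-1})_{A_i}$ is $\sigma$-primary, where $(A_{i-1})_{A_i}$ is the largest normal subgroup of $A_i$ contained in $A_{i-1}$. If $M_n<M_{n-1}<\cdots<M_1<M_0=G$ with $M_i$ a maximal subgroup of $M_{i-1}$ for all $i=1,\ldots,n$ ($n>0$), then $M_n$ is called an $n$-maximal subgroup of $G$. One writes $m_\sigma(G)=n$ if each $n$-maximal subgroup of $G$ is $\sigma$-subnormal in $G$ but, in the case $n>1$, some $(n-1)$-maximal subgroup is not $\sigma$-subnormal in $G$. A Schmidt group is a non-nilpotent group all of whose proper subgroups are nilpotent. *)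

theory Defs
  imports "HOL-Algebra.Sylow" "HOL-Algebra.Generated_Groups" "HOL-Library.Disjoint_Sets"
begin

abbreviation primes :: "nat set"
  where "primes \<equiv> {p. prime p}"

definition prime_set :: "('a, 'b) monoid_scheme \<Rightarrow> nat set"
  where "prime_set G = {p. prime p \<and> p dvd order G}"

definition sigma_set :: "nat set set \<Rightarrow> ('a, 'b) monoid_scheme \<Rightarrow> nat set set"
  where "sigma_set \<sigma> G = {s \<in> \<sigma>. s \<inter> prime_set G \<noteq> {}}"

definition sigma_primary :: "nat set set \<Rightarrow> ('a, 'b) monoid_scheme \<Rightarrow> bool"
  where "sigma_primary \<sigma> G \<longleftrightarrow> card (sigma_set \<sigma> G) \<le> 1"

text \<open>The largest element, with respect to inclusion, among the normal subgroups of \<open>G\<close>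
  contained in \<open>H\<close>; it exists by \<open>normal_core\<close> below.\<close>

definition normal_core :: "('a, 'b) monoid_scheme \<Rightarrow> 'a set \<Rightarrow> 'a set"
  where "normal_core G H = (GREATEST N. N \<lhd> G \<and> N \<subseteq> H)"

lemma normal_core:
  assumes G: "group G" and H: "subgroup H G"
  shows "normal_core G H \<lhd> G" "normal_core G H \<subseteq> H"
    and "\<And>N. N \<lhd> G \<Longrightarrow> N \<subseteq> H \<Longrightarrow> N \<subseteq> normal_core G H"
proof -
  interpret group G by fact
  interpret H: subgroup H G by fact
  define C where
    "C = {g \<in> carrier G. \<forall>x\<in>carrier G. x \<otimes>\<^bsub>G\<^esub> g \<otimes>\<^bsub>G\<^esub> inv\<^bsub>G\<^esub> x \<in> H}"
  have sub: "subgroup C G"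
  proof (rule subgroupI)
    show "C \<subseteq> carrier G" by (auto simp: C_def)
    have "\<one>\<^bsub>G\<^esub> \<in> C" by (auto simp: C_def)
    then show "C \<noteq> {}" by blast
  next
    fix a assume a: "a \<in> C"
    have "x \<otimes>\<^bsub>G\<^esub> inv\<^bsub>G\<^esub> a \<otimes>\<^bsub>G\<^esub> inv\<^bsub>G\<^esub> x \<in> H" if "x \<in> carrier G" for x
    proof -
      have "inv\<^bsub>G\<^esub> (x \<otimes>\<^bsub>G\<^esub> a \<otimes>\<^bsub>G\<^esub> inv\<^bsub>G\<^esub> x) \<in> H"
        using a that by (auto simp: C_def)
      moreover have "inv\<^bsub>G\<^esub> (x \<otimes>\<^bsub>G\<^esub> a \<otimes>\<^bsub>G\<^esub> inv\<^bsub>G\<^esub> x) = x \<otimes>\<^bsub>G\<^esub> inv\<^bsub>G\<^esub> a \<otimes>\<^bsub>G\<^esub> inv\<^bsub>G\<^esub> x"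
        using a that by (auto simp: C_def inv_mult_group m_assoc)
      ultimately show ?thesis by simp
    qed
    then show "inv\<^bsub>G\<^esub> a \<in> C" using a by (auto simp: C_def)
  next
    fix a b assume ab: "a \<in> C" "b \<in> C"
    have cancel: "inv\<^bsub>G\<^esub> x \<otimes>\<^bsub>G\<^esub> (x \<otimes>\<^bsub>G\<^esub> c) = c"
      if "x \<in> carrier G" "c \<in> carrier G" for x c
      using that by (simp flip: m_assoc)
    have "x \<otimes>\<^bsub>G\<^esub> (a \<otimes>\<^bsub>G\<^esub> b) \<otimes>\<^bsub>G\<^esub> inv\<^bsub>G\<^esub> x \<in> H" if x: "x \<in> carrier G" for x
    proof -
      have "(x \<otimes>\<^bsub>G\<^esub> a \<otimes>\<^bsub>G\<^esub> inv\<^bsub>G\<^esub> x) \<otimes>\<^bsub>G\<^esub> (x \<otimes>\<^bsub>G\<^esub> b \<otimes>\<^bsub>G\<^esub> inv\<^bsub>G\<^esub> x) \<in> H"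
        using ab x by (auto simp: C_def)
      moreover have "(x \<otimes>\<^bsub>G\<^esub> a \<otimes>\<^bsub>G\<^esub> inv\<^bsub>G\<^esub> x) \<otimes>\<^bsub>G\<^esub> (x \<otimes>\<^bsub>G\<^esub> b \<otimes>\<^bsub>G\<^esub> inv\<^bsub>G\<^esub> x)
          = x \<otimes>\<^bsub>G\<^esub> (a \<otimes>\<^bsub>G\<^esub> b) \<otimes>\<^bsub>G\<^esub> inv\<^bsub>G\<^esub> x"
        using ab x cancel by (auto simp: C_def m_assoc)
      ultimately show ?thesis by simp
    qed
    then show "a \<otimes>\<^bsub>G\<^esub> b \<in> C" using ab by (auto simp: C_def)
  qed
  have nor: "C \<lhd> G"
  proof (subst normal_inv_iff, intro conjI ballI sub)
    fix x h assume x: "x \<in> carrier G" and h: "h \<in> C"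
    have "y \<otimes>\<^bsub>G\<^esub> (x \<otimes>\<^bsub>G\<^esub> h \<otimes>\<^bsub>G\<^esub> inv\<^bsub>G\<^esub> x) \<otimes>\<^bsub>G\<^esub> inv\<^bsub>G\<^esub> y \<in> H" if y: "y \<in> carrier G" for y
    proof -
      have "(y \<otimes>\<^bsub>G\<^esub> x) \<otimes>\<^bsub>G\<^esub> h \<otimes>\<^bsub>G\<^esub> inv\<^bsub>G\<^esub> (y \<otimes>\<^bsub>G\<^esub> x) \<in> H"
        using h x y by (auto simp: C_def)
      then show ?thesis using h x y by (auto simp: C_def m_assoc inv_mult_group)
    qed
    then show "x \<otimes>\<^bsub>G\<^esub> h \<otimes>\<^bsub>G\<^esub> inv\<^bsub>G\<^esub> x \<in> C" using h x by (auto simp: C_def)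
  qed
  have CH: "C \<subseteq> H"
  proof
    fix g assume g: "g \<in> C"
    then have "\<one>\<^bsub>G\<^esub> \<otimes>\<^bsub>G\<^esub> g \<otimes>\<^bsub>G\<^esub> inv\<^bsub>G\<^esub> \<one>\<^bsub>G\<^esub> \<in> H" unfolding C_def by blast
    then show "g \<in> H" using g by (auto simp: C_def)
  qed
  have greatest: "N \<subseteq> C" if N: "N \<lhd> G" "N \<subseteq> H" for N
    using N normal.inv_op_closed2[OF N(1)] subgroup.subset[OF normal_imp_subgroup[OF N(1)]]
    by (auto simp: C_def)
  have "normal_core G H = C"
    unfolding normal_core_def by (rule Greatest_equality) (use nor CH greatest in auto)
  then show "normal_core G H \<lhd> G" "normal_core G H \<subseteq> H"
    and "\<And>N. N \<lhd> G \<Longrightarrow> N \<subseteq> H \<Longrightarrow> N \<subseteq> normal_core G H"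
    using nor CH greatest by auto
qed

definition sigma_subnormal :: "nat set set \<Rightarrow> ('a, 'b) monoid_scheme \<Rightarrow> 'a set \<Rightarrow> bool"
  where "sigma_subnormal \<sigma> G H \<longleftrightarrow>
    (\<exists>(t::nat) A. A 0 = H \<and> A t = carrier G \<and> (\<forall>i\<le>t. subgroup (A i) G) \<and>
      (\<forall>i\<in>{1..t}. A (i - 1) \<subseteq> A i \<and>
        (A (i - 1) \<lhd> G\<lparr>carrier := A i\<rparr> \<or>
         sigma_primary \<sigma>
           (G\<lparr>carrier := A i\<rparr> Mod normal_core (G\<lparr>carrier := A i\<rparr>) (A (i - 1))))))"

definition maximal_subgroup :: "'a set \<Rightarrow> ('a, 'b) monoid_scheme \<Rightarrow> bool"
  where "maximal_subgroup M G \<longleftrightarrow> subgroup M G \<and> M \<noteq> carrier G \<and>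
    (\<forall>K. subgroup K G \<longrightarrow> M \<subseteq> K \<longrightarrow> K = M \<or> K = carrier G)"

definition n_maximal_subgroup :: "nat \<Rightarrow> 'a set \<Rightarrow> ('a, 'b) monoid_scheme \<Rightarrow> bool"
  where "n_maximal_subgroup n H G \<longleftrightarrow> n > 0 \<and>
    (\<exists>M. M 0 = carrier G \<and> M n = H \<and>
      (\<forall>i\<in>{1..n}. maximal_subgroup (M i) (G\<lparr>carrier := M (i - 1)\<rparr>)))"

text \<open>\<open>m_sigma_eq \<sigma> G n\<close> is the relation written \<open>m\<^sub>\<sigma>(G) = n\<close>. It is a
  predicate since this notation is only introduced through the condition for each \<open>n\<close>.\<close>

definition m_sigma_eq :: "nat set set \<Rightarrow> ('a, 'b) monoid_scheme \<Rightarrow> nat \<Rightarrow> bool"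
  where "m_sigma_eq \<sigma> G n \<longleftrightarrow> n > 0 \<and>
    (\<forall>H. n_maximal_subgroup n H G \<longrightarrow> sigma_subnormal \<sigma> G H) \<and>
    (n > 1 \<longrightarrow> (\<exists>H. n_maximal_subgroup (n - 1) H G \<and> \<not> sigma_subnormal \<sigma> G H))"

fun lower_central :: "('a, 'b) monoid_scheme \<Rightarrow> nat \<Rightarrow> 'a set"
  where
    "lower_central G 0 = carrier G"
  | "lower_central G (Suc n) = generate G
      {x \<otimes>\<^bsub>G\<^esub> y \<otimes>\<^bsub>G\<^esub> inv\<^bsub>G\<^esub> x \<otimes>\<^bsub>G\<^esub> inv\<^bsub>G\<^esub> y | x y. x \<in> lower_central G n \<and> y \<in> carrier G}"

definition nilpotent_group :: "('a, 'b) monoid_scheme \<Rightarrow> bool"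
  where "nilpotent_group G \<longleftrightarrow> group G \<and> (\<exists>n. lower_central G n = {\<one>\<^bsub>G\<^esub>})"

definition schmidt_group :: "('a, 'b) monoid_scheme \<Rightarrow> bool"
  where "schmidt_group G \<longleftrightarrow> group G \<and> \<not> nilpotent_group G \<and>
    (\<forall>H. subgroup H G \<longrightarrow> H \<noteq> carrier G \<longrightarrow> nilpotent_group (G\<lparr>carrier := H\<rparr>))"

definition sylow_subgroup :: "nat \<Rightarrow> 'a set \<Rightarrow> ('a, 'b) monoid_scheme \<Rightarrow> bool"
  where "sylow_subgroup p P G \<longleftrightarrow>
    prime p \<and> subgroup P G \<and> card P = p ^ multiplicity p (order G)"

end

theory Submission
  imports Defs "HOL-Algebra.Multiplicative_Group"
begin

text \<open>
  Suppose that all 2-maximal subgroups are subnormal relative to the partition and that \<open>M\<close> is a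
  maximal subgroup which is not. For a suitable \<open>M\<close> there is a minimal normal supplement \<open>K\<close> of
  \<open>M\<close>, and modulo its intersection with the core of \<open>M\<close> it is an \<open>s\<close>-group for one class \<open>s\<close>.
  Comparing \<open>q\<close>-elements of \<open>K H\<close> and \<open>H\<close>, for \<open>H\<close> maximal in \<open>M\<close> and \<open>q\<close> outside \<open>s\<close>,
  shows that \<open>M\<close> is a cyclic \<open>q\<close>-group whose maximal subgroup \<open>N\<close> is central in \<open>G\<close>. The Frattini
  argument for a Sylow subgroup of \<open>K\<close> then yields a normal abelian \<open>r\<close>-group \<open>R\<close> complementing \<open>M\<close>,
  with \<open>r\<close> in \<open>s\<close>. A proper subgroup lies in \<open>R N\<close> or is a conjugate of \<open>M\<close>; so every
  proper subgroup is abelian.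

  Conversely, in a Schmidt group with abelian Sylow subgroups all proper subgroups are abelian, and
  distinct maximal subgroups meet in the center. Some maximal subgroup is not normal, and the
  maximal subgroups of a non-normal maximal subgroup are central.
\<close>

subsection \<open>Conjugation, elements of prime power order, and Sylow subgroups\<close>

text \<open>Solubility is not known in advance, so Hall subgroups cannot be used. Single elements of
  prime power order take their place: a \<open>\<sigma>\<close>-subnormal subgroup whose index is an
  \<open>s\<close>-number contains every \<open>q\<close>-element for \<open>q\<close> outside
  \<open>s\<close>. Quotient groups are avoided as well; products with a normal subgroup and indices
  inside \<open>G\<close> stand for them. The first obstacle is the supplement \<open>K\<close>: a
  priori every proper normal subgroup could lie in every maximal subgroup that is not
  \<open>\<sigma>\<close>-subnormal, as in a simple group. Only a count of conjugates, which forces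
  some maximal subgroup to be normal, rules this out. The same count yields a normal maximal
  subgroup in the converse. The equality of the numbers of classes and of primes acts in the
  converse. It turns an index that involves one class into a power of one prime \<open>p\<close>. A
  non-normal maximal subgroup that is \<open>\<sigma>\<close>-subnormal would contain a central
  normal subgroup of such an index; then \<open>G\<close> would be the product of this subgroup and
  an abelian Sylow \<open>p\<close>-subgroup, hence abelian.\<close>

locale finite_group = group +
  assumes finite_carrier: "finite (carrier G)"
begin

definition conj_by :: "'a \<Rightarrow> 'a \<Rightarrow> 'a" where "conj_by g x = g \<otimes> x \<otimes> inv g"

abbreviation subgp :: "'a set \<Rightarrow> bool" where "subgp A \<equiv> subgroup A G"

lemma subgp_carrier: "subgp A \<Longrightarrow> x \<in> A \<Longrightarrow> x \<in> carrier G"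
  by (rule subgroup.mem_carrier)

lemma subgp_finite: "subgp A \<Longrightarrow> finite A"
  using finite_carrier finite_subset subgroup.subset by blast

lemma subgp_card_pos: "subgp A \<Longrightarrow> card A > 0"
  using subgp_finite subgroup.one_closed card_gt_0_iff by blast

lemmas sgI = subgroup.one_closed subgroup.m_closed subgroup.m_inv_closed
lemmas sgD = subgp_carrier sgI

lemma inv_cancel [simp]:
  "x \<in> carrier G \<Longrightarrow> y \<in> carrier G \<Longrightarrow> inv x \<otimes> (x \<otimes> y) = y"
  "x \<in> carrier G \<Longrightarrow> y \<in> carrier G \<Longrightarrow> x \<otimes> (inv x \<otimes> y) = y"
  by (simp_all flip: m_assoc)

lemma conj_by_closed [simp]: "g \<in> carrier G \<Longrightarrow> x \<in> carrier G \<Longrightarrow> conj_by g x \<in> carrier G"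
  by (simp add: conj_by_def)

lemma conj_by_mult: "g \<in> carrier G \<Longrightarrow> x \<in> carrier G \<Longrightarrow> y \<in> carrier G \<Longrightarrow> conj_by g (x \<otimes> y) = conj_by g x \<otimes> conj_by g y"
  by (simp add: conj_by_def m_assoc)

lemma conj_by_conj_by: "g \<in> carrier G \<Longrightarrow> h \<in> carrier G \<Longrightarrow> x \<in> carrier G \<Longrightarrow> conj_by g (conj_by h x) = conj_by (g \<otimes> h) x"
  by (simp add: conj_by_def m_assoc inv_mult_group)

lemma conj_by_1 [simp]: "x \<in> carrier G \<Longrightarrow> conj_by \<one> x = x"
  by (simp add: conj_by_def)

lemma conj_by_one [simp]: "g \<in> carrier G \<Longrightarrow> conj_by g \<one> = \<one>"
  by (simp add: conj_by_def)

lemma conj_by_inv_conj_by [simp]: "g \<in> carrier G \<Longrightarrow> x \<in> carrier G \<Longrightarrow> conj_by (inv g) (conj_by g x) = x"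
  "g \<in> carrier G \<Longrightarrow> x \<in> carrier G \<Longrightarrow> conj_by g (conj_by (inv g) x) = x"
  by (simp_all add: conj_by_conj_by)

lemma conj_by_inv: "g \<in> carrier G \<Longrightarrow> x \<in> carrier G \<Longrightarrow> conj_by g (inv x) = inv (conj_by g x)"
  by (simp add: conj_by_def m_assoc inv_mult_group)

lemma conj_by_eq_iff: "g \<in> carrier G \<Longrightarrow> x \<in> carrier G \<Longrightarrow> conj_by g x = x \<longleftrightarrow> g \<otimes> x = x \<otimes> g"
  by (simp add: conj_by_def inv_solve_right')

lemma inj_on_conj_by: "g \<in> carrier G \<Longrightarrow> A \<subseteq> carrier G \<Longrightarrow> inj_on (conj_by g) A"
  by (rule inj_on_inverseI[where g = "conj_by (inv g)"]) auto

lemma card_conj_by: "g \<in> carrier G \<Longrightarrow> A \<subseteq> carrier G \<Longrightarrow> card (conj_by g ` A) = card A"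
  by (simp add: card_image inj_on_conj_by)

lemma subgp_conj_by: assumes "subgp A" "g \<in> carrier G" shows "subgp (conj_by g ` A)"
proof (rule subgroupI)
  show "conj_by g ` A \<subseteq> carrier G" using assms by (auto dest: subgp_carrier simp: sgI)
  show "conj_by g ` A \<noteq> {}" using subgroup.one_closed[OF assms(1)] by blast
next
  fix a assume "a \<in> conj_by g ` A"
  then obtain x where x: "x \<in> A" "a = conj_by g x" by auto
  then have "inv a = conj_by g (inv x)" using assms by (simp add: conj_by_inv sgD)
  then show "inv a \<in> conj_by g ` A" using x assms by (auto dest: subgp_carrier simp: sgI)
next
  fix a b assume "a \<in> conj_by g ` A" "b \<in> conj_by g ` A"
  then obtain x y where x: "x \<in> A" "a = conj_by g x" "y \<in> A" "b = conj_by g y" by auto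
  then have "a \<otimes> b = conj_by g (x \<otimes> y)" using assms by (simp add: conj_by_mult sgD)
  then show "a \<otimes> b \<in> conj_by g ` A" using x assms by (auto dest: subgp_carrier simp: sgI)
qed

lemma conj_by_image_conj_by: "g \<in> carrier G \<Longrightarrow> h \<in> carrier G \<Longrightarrow> A \<subseteq> carrier G \<Longrightarrow> conj_by g ` conj_by h ` A = conj_by (g \<otimes> h) ` A"
  by (force simp: image_image conj_by_conj_by subset_iff)

lemma conj_by_image_1: "A \<subseteq> carrier G \<Longrightarrow> conj_by \<one> ` A = A"
  by (force simp: subset_iff)

lemma subgp_conj_by_self: assumes "subgp A" "g \<in> A" shows "conj_by g ` A = A"
proof (rule card_subset_eq)
  show "finite A" by (rule subgp_finite[OF assms(1)])
  show "conj_by g ` A \<subseteq> A" using assms by (auto simp: conj_by_def sgD)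
  show "card (conj_by g ` A) = card A" using assms by (intro card_conj_by) (auto dest: subgp_carrier simp: sgI)
qed

section \<open>Orders of subgroups and of products\<close>

lemma subgp_Int: "subgp A \<Longrightarrow> subgp B \<Longrightarrow> subgp (A \<inter> B)"
  by (rule subgroups_Inter_pair)

lemma subgp_dvd: assumes "subgp A" "subgp B" "A \<subseteq> B" shows "card A dvd card B"
proof -
  interpret B: group "G\<lparr>carrier := B\<rparr>" using assms(2) by (rule subgroup_imp_group)
  have "card (rcosets\<^bsub>G\<lparr>carrier := B\<rparr>\<^esub> A) * card A = card B"
    using B.lagrange[OF subgroup_incl[OF assms]] by (simp add: order_def)
  then show ?thesis by (metis dvd_triv_right)
qed

text \<open>Choose one factorization \<open>c = a \<otimes> b\<close> for each \<open>c\<close> in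
  the product. All others are \<open>(a \<otimes> d, inv d \<otimes> b)\<close> with
  \<open>d\<close> in the intersection, which gives the bijection. The product need not be a
  subgroup; double cosets are measured with this formula too.\<close>

lemma card_mult:
  assumes A: "subgp A" and B: "subgp B"
  shows "card (A <#> B) * card (A \<inter> B) = card A * card B"
proof -
  have "\<forall>c\<in>A <#> B. \<exists>ab. fst ab \<in> A \<and> snd ab \<in> B \<and> c = fst ab \<otimes> snd ab"
    by (force simp: set_mult_def)
  then obtain f where f: "\<And>c. c \<in> A <#> B \<Longrightarrow> fst (f c) \<in> A \<and> snd (f c) \<in> B \<and> c = fst (f c) \<otimes> snd (f c)"
    by metis
  define h where "h = (\<lambda>(c, d). (fst (f c) \<otimes> d, inv d \<otimes> snd (f c)))"
  have "bij_betw h ((A <#> B) \<times> (A \<inter> B)) (A \<times> B)"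
  proof (rule bij_betwI')
    fix u v assume "u \<in> (A <#> B) \<times> (A \<inter> B)" "v \<in> (A <#> B) \<times> (A \<inter> B)"
    then obtain c d c' d' where u: "u = (c, d)" "c \<in> A <#> B" "d \<in> A" "d \<in> B"
      and v: "v = (c', d')" "c' \<in> A <#> B" "d' \<in> A" "d' \<in> B" by auto
    have cs: "fst (f c) \<in> carrier G" "snd (f c) \<in> carrier G" "fst (f c') \<in> carrier G" "snd (f c') \<in> carrier G"
      "d \<in> carrier G" "d' \<in> carrier G"
      using u v f A B by (auto dest: subgp_carrier simp: sgI)
    show "h u = h v \<longleftrightarrow> u = v"
    proof
      assume eq: "h u = h v"
      then have e: "fst (f c) \<otimes> d = fst (f c') \<otimes> d'" "inv d \<otimes> snd (f c) = inv d' \<otimes> snd (f c')"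
        by (auto simp: h_def u v)
      have "c = (fst (f c) \<otimes> d) \<otimes> (inv d \<otimes> snd (f c))" using f[OF u(2)] cs by (simp add: m_assoc)
      also have "\<dots> = (fst (f c') \<otimes> d') \<otimes> (inv d' \<otimes> snd (f c'))" by (simp add: e)
      also have "\<dots> = c'" using f[OF v(2)] cs by (simp add: m_assoc)
      finally have "c = c'" .
      then show "u = v" using e cs u v by simp
    qed simp
  next
    fix u assume "u \<in> (A <#> B) \<times> (A \<inter> B)"
    then show "h u \<in> A \<times> B" using f A B by (auto simp: h_def sgD)
  next
    fix w assume "w \<in> A \<times> B"
    then obtain a b where w: "w = (a, b)" "a \<in> A" "b \<in> B" by auto
    define c where "c = a \<otimes> b"
    have c: "c \<in> A <#> B" using w by (auto simp: c_def set_mult_def)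
    \<comment> \<open>This expression shows that \<open>d\<close> lies in \<open>A\<close>; the
      second one, \<open>d2\<close>, shows that it lies in \<open>B\<close>.\<close>
    define d where "d = inv (fst (f c)) \<otimes> a"
    note fc = f[OF c]
    have cs: "a \<in> carrier G" "b \<in> carrier G" "fst (f c) \<in> carrier G" "snd (f c) \<in> carrier G"
      using fc w A B by (auto dest: subgp_carrier simp: sgI)
    have "fst (f c) \<otimes> snd (f c) = a \<otimes> b" using fc c_def by simp
    then have "inv (fst (f c)) \<otimes> (fst (f c) \<otimes> snd (f c)) \<otimes> inv b = inv (fst (f c)) \<otimes> (a \<otimes> b) \<otimes> inv b"
      by simp
    then have d2: "d = snd (f c) \<otimes> inv b" using cs by (simp add: d_def m_assoc)
    have "d \<in> A" using fc w A unfolding d_def by (auto simp: sgD)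
    moreover have "d \<in> B" using fc w B unfolding d2 by (auto simp: sgD)
    ultimately have "d \<in> A \<inter> B" by simp
    moreover have "fst (f c) \<otimes> d = a" using cs by (simp add: d_def)
    moreover have "inv d \<otimes> snd (f c) = b" using cs by (simp add: d2 inv_mult_group m_assoc)
    then have "h (c, d) = w" using calculation by (simp add: h_def w)
    ultimately show "\<exists>u\<in>(A <#> B) \<times> (A \<inter> B). w = h u" using c by force
  qed
  then show ?thesis by (metis bij_betw_same_card card_cartesian_product)
qed

section \<open>Normality inside a subgroup\<close>

lemma subgroup_restrict_iff:
  assumes "subgp B" shows "subgroup A (G\<lparr>carrier := B\<rparr>) \<longleftrightarrow> subgp A \<and> A \<subseteq> B"
proof
  assume A: "subgroup A (G\<lparr>carrier := B\<rparr>)"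
  show "subgp A \<and> A \<subseteq> B" using incl_subgroup[OF assms A] subgroup.subset[OF A] by simp
next
  assume "subgp A \<and> A \<subseteq> B"
  then show "subgroup A (G\<lparr>carrier := B\<rparr>)" using subgroup_incl assms by blast
qed

text \<open>Normality of one subgroup in another, phrased with the operations of \<open>G\<close>
  itself, so that chains of subgroups are handled in a single ambient group. The link with
  \<open>\<lhd>\<close> is \<open>normal_in_iff\<close>.\<close>

definition normal_in :: "'a set \<Rightarrow> 'a set \<Rightarrow> bool"
  where "normal_in A B \<longleftrightarrow> subgp A \<and> subgp B \<and> A \<subseteq> B \<and> (\<forall>b\<in>B. \<forall>a\<in>A. conj_by b a \<in> A)"

lemma normal_in_iff: "normal_in A B \<longleftrightarrow> subgp B \<and> A \<lhd> G\<lparr>carrier := B\<rparr>"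
proof (cases "subgp B")
  case True
  interpret B: group "G\<lparr>carrier := B\<rparr>" using True by (rule subgroup_imp_group)
  show ?thesis using True unfolding normal_in_def B.normal_inv_iff subgroup_restrict_iff[OF True]
    by (auto simp: conj_by_def m_inv_consistent)
qed (simp add: normal_in_def)

lemma normal_inD:
  assumes "normal_in A B"
  shows "subgp A" "subgp B" "A \<subseteq> B" "b \<in> B \<Longrightarrow> a \<in> A \<Longrightarrow> conj_by b a \<in> A"
  using assms by (auto simp: normal_in_def)

lemma normal_in_conj_by: assumes "normal_in A B" "b \<in> B" shows "conj_by b ` A = A"
proof (rule card_subset_eq)
  show "finite A" by (rule subgp_finite[OF normal_inD(1)[OF assms(1)]])
  show "conj_by b ` A \<subseteq> A" using assms by (auto simp: normal_in_def)
  show "card (conj_by b ` A) = card A" using assms by (intro card_conj_by) (auto simp: normal_in_def dest: subgp_carrier simp: sgI)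
qed

lemma normal_in_mono: "normal_in A B \<Longrightarrow> subgp C \<Longrightarrow> A \<subseteq> C \<Longrightarrow> C \<subseteq> B \<Longrightarrow> normal_in A C"
  unfolding normal_in_def by blast

lemma normal_in_Int: "normal_in A B \<Longrightarrow> subgp X \<Longrightarrow> normal_in (A \<inter> X) (B \<inter> X)"
  unfolding normal_in_def by (auto simp: subgp_Int conj_by_def sgD)

lemma set_multI: "a \<in> A \<Longrightarrow> b \<in> B \<Longrightarrow> a \<otimes> b \<in> A <#> B"
  by (auto simp: set_mult_def)

lemma set_mult_left: "subgp B \<Longrightarrow> A \<subseteq> carrier G \<Longrightarrow> A \<subseteq> A <#> B"
  using set_multI[of _ A \<one> B] by (force dest: subgp_carrier simp: sgI)

lemma set_mult_right: "subgp A \<Longrightarrow> B \<subseteq> carrier G \<Longrightarrow> B \<subseteq> A <#> B"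
  using set_multI[of \<one> A _ B] by (force dest: subgp_carrier simp: sgI)

lemma subgp_mult:
  assumes K: "subgp K" and X: "subgp X" and n: "\<And>x k. x \<in> X \<Longrightarrow> k \<in> K \<Longrightarrow> conj_by x k \<in> K"
  shows "subgp (K <#> X)"
proof (rule subgroupI)
  show "K <#> X \<subseteq> carrier G" using K X by (auto simp: set_mult_def sgD)
  show "K <#> X \<noteq> {}" using set_multI[of \<one> K \<one> X] K X by (auto simp: sgD)
next
  fix a assume "a \<in> K <#> X"
  then obtain k x where a: "a = k \<otimes> x" "k \<in> K" "x \<in> X" by (auto simp: set_mult_def)
  have cs: "k \<in> carrier G" "x \<in> carrier G" using a K X by (auto dest: subgp_carrier simp: sgI)
  have "inv a = conj_by (inv x) (inv k) \<otimes> inv x" using cs a by (simp add: conj_by_def m_assoc inv_mult_group)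
  then show "inv a \<in> K <#> X" using a K X n by (auto intro!: set_multI simp: sgD)
next
  fix a b assume "a \<in> K <#> X" "b \<in> K <#> X"
  then obtain k x l y where a: "a = k \<otimes> x" "k \<in> K" "x \<in> X" "b = l \<otimes> y" "l \<in> K" "y \<in> X"
    by (auto simp: set_mult_def)
  have cs: "k \<in> carrier G" "x \<in> carrier G" "l \<in> carrier G" "y \<in> carrier G" using a K X by (auto dest: subgp_carrier simp: sgI)
  have "a \<otimes> b = (k \<otimes> conj_by x l) \<otimes> (x \<otimes> y)" using cs a
    by (simp add: conj_by_def m_assoc)
  then show "a \<otimes> b \<in> K <#> X" using a K X n by (auto intro!: set_multI simp: sgD)
qed

lemma set_mult_subset: "subgp B \<Longrightarrow> K \<subseteq> B \<Longrightarrow> X \<subseteq> B \<Longrightarrow> K <#> X \<subseteq> B"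
  by (auto simp: set_mult_def sgD subset_iff)

lemma normal_in_mult_subgp: "normal_in K B \<Longrightarrow> subgp X \<Longrightarrow> X \<subseteq> B \<Longrightarrow> subgp (K <#> X)"
  by (rule subgp_mult) (auto simp: normal_in_def)

text \<open>The exponent 0 is allowed: \<open>\<one>\<close> is a \<open>p\<close>-element for every
  \<open>p\<close>.\<close>

definition p_element :: "nat \<Rightarrow> 'a \<Rightarrow> bool"
  where "p_element p x \<longleftrightarrow> x \<in> carrier G \<and> (\<exists>k. ord x = p ^ k)"

lemma subgp_gen: "x \<in> carrier G \<Longrightarrow> subgp (generate G {x})"
  by (rule generate_is_subgroup) auto

lemma gen_mem: "x \<in> generate G {x}"
  by (rule generate.incl) simp

lemma gen_sub: "subgp A \<Longrightarrow> x \<in> A \<Longrightarrow> generate G {x} \<subseteq> A"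
  by (rule generate_subgroup_incl) auto

lemma card_gen: "x \<in> carrier G \<Longrightarrow> card (generate G {x}) = ord x"
  by (simp add: generate_pow_card)

lemma p_element_of_p_subgroup:
  assumes "subgp P" "card P = p ^ k" "prime p" "x \<in> P" shows "p_element p x"
proof -
  have "x \<in> carrier G" using assms by (auto dest: subgp_carrier simp: sgI)
  moreover from this have "ord x dvd p ^ k"
    using subgp_dvd[OF subgp_gen assms(1) gen_sub[OF assms(1,4)]] assms(2) by (simp add: card_gen)
  ultimately show ?thesis using divides_primepow_nat[OF assms(3)] by (auto simp: p_element_def)
qed

lemma conj_by_pow: "g \<in> carrier G \<Longrightarrow> x \<in> carrier G \<Longrightarrow> conj_by g x [^] (n::nat) = conj_by g (x [^] n)"
  by (induction n) (auto simp: conj_by_mult)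

lemma ord_conj_by: assumes "g \<in> carrier G" "x \<in> carrier G" shows "ord (conj_by g x) = ord x"
proof -
  have "conj_by g x [^] n = \<one> \<longleftrightarrow> x [^] n = \<one>" for n :: nat
  proof -
    have "conj_by g (x [^] n) = conj_by g \<one> \<longleftrightarrow> x [^] n = \<one>"
      using inj_on_conj_by[OF assms(1) subset_refl] assms by (simp add: inj_on_eq_iff del: conj_by_one)
    then show ?thesis using assms by (simp add: conj_by_pow)
  qed
  then show ?thesis using assms by (simp add: ord_unique pow_eq_id)
qed

lemma p_element_conj_by: "g \<in> carrier G \<Longrightarrow> p_element p x \<Longrightarrow> p_element p (conj_by g x)"
  by (auto simp: p_element_def ord_conj_by)

section \<open>Sylow theorems relative to a subgroup\<close>

lemma sylow_ex:
  assumes "subgp B" "prime p" shows "\<exists>P. subgp P \<and> P \<subseteq> B \<and> card P = p ^ multiplicity p (card B)"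
proof -
  interpret B: group "G\<lparr>carrier := B\<rparr>" using assms(1) by (rule subgroup_imp_group)
  obtain m where "card B = p ^ multiplicity p (card B) * m"
    using multiplicity_dvd[of p "card B"] by (auto elim: dvdE)
  then obtain P where "subgroup P (G\<lparr>carrier := B\<rparr>)" "card P = p ^ multiplicity p (card B)"
    using sylow_thm[of p "G\<lparr>carrier := B\<rparr>" "multiplicity p (card B)" m] assms B.is_group subgp_finite
    by (auto simp: order_def)
  then show ?thesis using subgroup_restrict_iff[OF assms(1)] by blast
qed

text \<open>Count \<open>B\<close> as a disjoint union of double cosets \<open>Q b P\<close>: if no conjugate of \<open>P\<close>
  contains \<open>Q\<close>, each of them has size divisible by \<open>p |P|\<close>.\<close>

lemma p_subgroup_conj:
  assumes B: "subgp B" and P: "subgp P" "P \<subseteq> B" and Q: "subgp Q" "Q \<subseteq> B" "card Q = p ^ k"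
    and p: "prime p" and nd: "\<not> p dvd card B div card P"
  shows "\<exists>b\<in>B. Q \<subseteq> conj_by b ` P"
proof (rule ccontr)
  assume neg: "\<not> ?thesis"
  define D where "D = (\<lambda>b. {x \<otimes> b \<otimes> y | x y. x \<in> Q \<and> y \<in> P})"
  have DI: "z \<in> D b" if "x \<in> Q" "y \<in> P" "z = x \<otimes> b \<otimes> y" for x y z b
    using that unfolding D_def by blast
  have cB: "x \<in> carrier G" if "x \<in> B" for x using that B by (auto dest: subgp_carrier simp: sgI)
  have DB: "D b \<subseteq> B" if "b \<in> B" for b
    using that P(2) Q(2) B unfolding D_def by (auto simp: sgD subset_iff)
  have self: "b \<in> D b" if "b \<in> B" for b
  proof -
    have "b = \<one> \<otimes> b \<otimes> \<one>" using cB[OF that] by simp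
    moreover have "\<one> \<in> Q" "\<one> \<in> P" using P Q by (auto dest: subgp_carrier simp: sgI)
    ultimately show ?thesis unfolding D_def by blast
  qed
  have sub: "D b \<subseteq> D c" if bc: "b \<in> D c" "c \<in> B" for b c
  proof
    fix z assume "z \<in> D b"
    then obtain x y where z: "z = x \<otimes> b \<otimes> y" "x \<in> Q" "y \<in> P" by (auto simp: D_def)
    obtain u v where b: "b = u \<otimes> c \<otimes> v" "u \<in> Q" "v \<in> P" using bc by (auto simp: D_def)
    have cs: "x \<in> carrier G" "y \<in> carrier G" "u \<in> carrier G" "v \<in> carrier G" "c \<in> carrier G"
      using z b that P Q by (auto dest: cB subgp_carrier simp: sgI)
    have "z = (x \<otimes> u) \<otimes> c \<otimes> (v \<otimes> y)" using cs z b by (simp add: m_assoc)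
    then show "z \<in> D c" using z b P Q by (intro DI[of "x \<otimes> u" "v \<otimes> y"]) (auto dest: subgp_carrier simp: sgI)
  qed
  have sym: "c \<in> D b" if bc: "b \<in> D c" "c \<in> B" for b c
  proof -
    obtain u v where b: "b = u \<otimes> c \<otimes> v" "u \<in> Q" "v \<in> P" using bc by (auto simp: D_def)
    have cs: "u \<in> carrier G" "v \<in> carrier G" "c \<in> carrier G"
      using b that P Q by (auto dest: cB subgp_carrier simp: sgI)
    have "c = inv u \<otimes> b \<otimes> inv v" using cs b by (simp add: m_assoc)
    then show ?thesis using b P Q by (intro DI[of "inv u" "inv v"]) (auto dest: subgp_carrier simp: sgI)
  qed
  have disj: "D b = D c" if bc: "b \<in> B" "c \<in> B" "D b \<inter> D c \<noteq> {}" for b c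
  proof -
    obtain z where z: "z \<in> D b" "z \<in> D c" using bc by auto
    have zB: "z \<in> B" using z DB that by auto
    have "D z = D b" using sub[OF z(1)] sub[OF sym[OF z(1)] zB] that by auto
    moreover have "D z = D c" using sub[OF z(2)] sub[OF sym[OF z(2)] zB] that by auto
    ultimately show ?thesis by simp
  qed
  have un: "\<Union> (D ` B) = B" using DB self by blast
  have dv: "p * card P dvd card (D b)" if b: "b \<in> B" for b
  proof -
    have bc: "b \<in> carrier G" using b cB by simp
    have sgc: "subgp (conj_by b ` P)" using P bc by (intro subgp_conj_by)
    \<comment> \<open>A translation by \<open>b\<close> turns the double coset into a product of two
      subgroups, whose size is given by \<open>card_mult\<close>.\<close>
    have "D b = (\<lambda>z. z \<otimes> b) ` (Q <#> conj_by b ` P)"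
    proof -
      have "x \<otimes> b \<otimes> y = x \<otimes> conj_by b y \<otimes> b" if "x \<in> Q" "y \<in> P" for x y
        using that P Q bc by (simp add: conj_by_def m_assoc sgD)
      then have "D b = {x \<otimes> conj_by b y \<otimes> b | x y. x \<in> Q \<and> y \<in> P}" unfolding D_def by metis
      also have "\<dots> = (\<lambda>z. z \<otimes> b) ` (Q <#> conj_by b ` P)" unfolding set_mult_def by blast
      finally show ?thesis .
    qed
    moreover have "inj_on (\<lambda>z. z \<otimes> b) (Q <#> conj_by b ` P)"
      by (rule inj_on_g[OF set_mult_closed bc]) (simp_all add: subgroup.subset sgc Q(1))
    ultimately have cd: "card (D b) = card (Q <#> conj_by b ` P)" by (simp add: card_image)
    have I: "subgp (Q \<inter> conj_by b ` P)" using Q sgc by (simp add: subgp_Int)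
    have "card (Q \<inter> conj_by b ` P) dvd p ^ k" using subgp_dvd[OF I Q(1)] Q(3) by simp
    then obtain j where j: "j \<le> k" "card (Q \<inter> conj_by b ` P) = p ^ j"
      using p divides_primepow_nat by blast
    have "Q \<inter> conj_by b ` P \<noteq> Q" using neg b by blast
    then have "card (Q \<inter> conj_by b ` P) \<noteq> card Q"
      using card_subset_eq[OF subgp_finite[OF Q(1)]] by blast
    then have jk: "j < k" using j Q(3) by (cases "j = k") auto
    have "card (D b) * p ^ j = p ^ k * card P"
      using card_mult[OF Q(1) sgc] cd j Q(3) P bc by (simp add: card_conj_by subgroup.subset)
    also have "p ^ k = p ^ (k - j) * p ^ j" using jk by (simp flip: power_add)
    finally have "card (D b) = p ^ (k - j) * card P" using p
      by (simp add: mult_ac prime_gt_0_nat)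
    moreover have "p dvd p ^ (k - j)" using jk by (intro dvd_power) auto
    ultimately show ?thesis by (simp add: mult_dvd_mono)
  qed
  have "p * card P dvd card (\<Union> (D ` B))"
  proof (rule dvd_partition)
    show "finite (\<Union> (D ` B))" using un subgp_finite[OF B] by simp
    show "\<forall>c\<in>D ` B. p * card P dvd card c" using dv by blast
    show "\<forall>c1\<in>D ` B. \<forall>c2\<in>D ` B. c1 \<noteq> c2 \<longrightarrow> c1 \<inter> c2 = {}" using disj by blast
  qed
  then have "p * card P dvd (card B div card P) * card P" using un subgp_dvd[OF P(1) B P(2)] by simp
  then have "p dvd card B div card P"
    using subgp_card_pos[OF P(1)] dvd_times_right_cancel_iff[of "card P" p] by blast
  then show False using nd by simp
qed

text \<open>By \<open>p_subgroup_conj\<close> the cyclic group of \<open>x\<close> lies in a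
  conjugate of \<open>A\<close>, and \<open>A\<close> is its own only conjugate in \<open>B\<close>.
  Nothing forces \<open>A\<close> to be a \<open>p\<close>-group, so the lemma serves for normal
  subgroups of \<open>s\<close>-index as well as for normal Sylow subgroups.\<close>

lemma p_element_in_normal:
  assumes N: "normal_in A B" and x: "x \<in> B" "p_element p x" "prime p" "\<not> p dvd card B div card A"
  shows "x \<in> A"
proof -
  note AB = normal_inD[OF N]
  have xc: "x \<in> carrier G" using x by (simp add: p_element_def)
  obtain k where "ord x = p ^ k" using x by (auto simp: p_element_def)
  then obtain b where b: "b \<in> B" "generate G {x} \<subseteq> conj_by b ` A"
    using p_subgroup_conj[OF AB(2) AB(1,3) subgp_gen[OF xc] gen_sub[OF AB(2) x(1)] _ x(3,4), of k] card_gen[OF xc]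
    by auto
  then have "x \<in> conj_by b ` A" using gen_mem by blast
  then show ?thesis using normal_in_conj_by[OF N b(1)] by simp
qed

lemma sylow_index: assumes "subgp B" "prime p" "subgp P" "P \<subseteq> B" "card P = p ^ multiplicity p (card B)"
  shows "\<not> p dvd card B div card P"
  using assms(5) subgp_card_pos[OF assms(1)] multiplicity_decompose[of "card B" p] prime_gt_1_nat[OF assms(2)]
  by simp

text \<open>For every prime, \<open>U\<close> contains a Sylow subgroup of \<open>B\<close>, since
  these consist of elements of prime power order. Hence \<open>card B\<close> divides
  \<open>card U\<close>.\<close>

lemma all_p_elements_imp_eq:
  assumes B: "subgp B" and U: "subgp U" "U \<subseteq> B" and el: "\<And>p x. prime p \<Longrightarrow> x \<in> B \<Longrightarrow> p_element p x \<Longrightarrow> x \<in> U"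
  shows "U = B"
proof -
  have "card B dvd card U"
  proof (rule multiplicity_le_imp_dvd)
    show "card B \<noteq> 0" using subgp_card_pos[OF B] by simp
  next
    fix p :: nat assume p: "prime p"
    obtain P where P: "subgp P" "P \<subseteq> B" "card P = p ^ multiplicity p (card B)" using sylow_ex[OF B p] by blast
    have "P \<subseteq> U" using el[OF p] p_element_of_p_subgroup[OF P(1,3) p] P(2) by blast
    then have "p ^ multiplicity p (card B) dvd card U" using subgp_dvd[OF P(1) U(1)] P(3) by simp
    then show "multiplicity p (card B) \<le> multiplicity p (card U)"
      using subgp_card_pos[OF U(1)] p by (intro multiplicity_geI) (auto simp: prime_gt_1_nat)
  qed
  then have "card B \<le> card U" using subgp_card_pos[OF U(1)] by (simp add: dvd_imp_le)
  then show ?thesis using U(2) subgp_finite[OF B] by (simp add: card_seteq)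
qed

section \<open>Normalizers and the Frattini argument\<close>

definition normalizer_of :: "'a set \<Rightarrow> 'a set" where "normalizer_of P = {g \<in> carrier G. conj_by g ` P = P}"

lemma subgp_normalizer_of: assumes "subgp P" shows "subgp (normalizer_of P)"
proof (rule subgroupI)
  have sub: "P \<subseteq> carrier G" using assms by (rule subgroup.subset)
  show "normalizer_of P \<subseteq> carrier G" by (auto simp: normalizer_of_def)
  have "\<one> \<in> normalizer_of P" using sub by (simp add: normalizer_of_def conj_by_image_1)
  then show "normalizer_of P \<noteq> {}" by blast
  fix a assume a: "a \<in> normalizer_of P"
  then have "conj_by (inv a) ` P = conj_by (inv a) ` conj_by a ` P" by (simp add: normalizer_of_def)
  also have "\<dots> = P" using a sub by (subst conj_by_image_conj_by) (auto simp: normalizer_of_def conj_by_image_1)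
  finally show "inv a \<in> normalizer_of P" using a by (simp add: normalizer_of_def)
  fix b assume b: "b \<in> normalizer_of P"
  show "a \<otimes> b \<in> normalizer_of P" using a b sub by (simp add: normalizer_of_def flip: conj_by_image_conj_by)
qed

lemma normalizer_of_self: "subgp P \<Longrightarrow> P \<subseteq> normalizer_of P"
  by (rule subsetI) (simp add: normalizer_of_def subgp_conj_by_self subgp_carrier[of P])

lemma normalizer_of_normal_in: "subgp P \<Longrightarrow> subgp B \<Longrightarrow> P \<subseteq> B \<Longrightarrow> B \<subseteq> normalizer_of P \<Longrightarrow> normal_in P B"
  unfolding normal_in_def normalizer_of_def by blast

lemma nzrI: "subgp P \<Longrightarrow> g \<in> carrier G \<Longrightarrow> (\<And>x. x \<in> P \<Longrightarrow> conj_by g x \<in> P) \<Longrightarrow> g \<in> normalizer_of P"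
  unfolding normalizer_of_def using card_subset_eq[OF subgp_finite[of P], of "conj_by g ` P"] card_conj_by[of g P] subgroup.subset[of P G]
  by auto

text \<open>The conjugate of \<open>P\<close> by \<open>b\<close> lies in \<open>K\<close>, so it
  equals the conjugate by some \<open>u\<close> in \<open>K\<close>; then
  \<open>inv u \<otimes> b\<close> normalizes \<open>P\<close>.\<close>

lemma frattini:
  assumes K: "normal_in K B" and P: "subgp P" "P \<subseteq> K" "card P = p ^ k" and p: "prime p" "\<not> p dvd card K div card P"
    and b: "b \<in> B"
  shows "\<exists>u\<in>K. \<exists>v\<in>normalizer_of P \<inter> B. b = u \<otimes> v"
proof -
  note KB = normal_inD[OF K]
  have bc: "b \<in> carrier G" using b KB by (auto dest: subgp_carrier simp: sgI)
  have Pc: "P \<subseteq> carrier G" using P(1) by (rule subgroup.subset)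
  have "conj_by b ` P \<subseteq> K" using KB(4)[OF b] P(2) by blast
  then obtain u where u: "u \<in> K" "conj_by b ` P \<subseteq> conj_by u ` P"
    using p_subgroup_conj[OF KB(1) P(1,2) subgp_conj_by[OF P(1) bc] _ _ p, of k] card_conj_by[OF bc Pc] P(3) by auto
  have uc: "u \<in> carrier G" "u \<in> B" using u KB by (auto dest: subgp_carrier simp: sgI)
  have eq: "conj_by b ` P = conj_by u ` P"
    using u(2) card_conj_by[OF bc Pc] card_conj_by[OF uc(1) Pc] subgp_finite[OF subgp_conj_by[OF P(1) uc(1)]] by (simp add: card_subset_eq)
  have "conj_by (inv u \<otimes> b) ` P = conj_by (inv u) ` conj_by b ` P" using uc bc Pc by (simp add: conj_by_image_conj_by)
  also have "\<dots> = P" using eq uc Pc by (simp add: conj_by_image_conj_by conj_by_image_1)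
  finally have "inv u \<otimes> b \<in> normalizer_of P \<inter> B" using uc bc b KB by (simp add: normalizer_of_def sgD)
  moreover have "b = u \<otimes> (inv u \<otimes> b)" using uc bc by (simp flip: m_assoc)
  ultimately show ?thesis using u(1) by blast
qed

section \<open>Centralizers, abelian subgroups and the center\<close>

definition centralizer :: "'a \<Rightarrow> 'a set" where "centralizer x = {g \<in> carrier G. g \<otimes> x = x \<otimes> g}"

lemma subgp_centralizer: assumes x: "x \<in> carrier G" shows "subgp (centralizer x)"
proof (rule subgroupI)
  show "centralizer x \<subseteq> carrier G" by (auto simp: centralizer_def)
  show "centralizer x \<noteq> {}" using x by (auto simp: centralizer_def)
  fix a assume a: "a \<in> centralizer x"
  then have ac: "a \<in> carrier G" and eq: "a \<otimes> x = x \<otimes> a" by (auto simp: centralizer_def)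
  have "x \<otimes> inv a = inv a \<otimes> (a \<otimes> x) \<otimes> inv a" using ac x by (simp add: m_assoc)
  also have "\<dots> = inv a \<otimes> x" unfolding eq using ac x by (simp add: m_assoc)
  finally show "inv a \<in> centralizer x" using ac by (simp add: centralizer_def)
  fix b assume b: "b \<in> centralizer x"
  then have bc: "b \<in> carrier G" and eqb: "b \<otimes> x = x \<otimes> b" by (auto simp: centralizer_def)
  have "a \<otimes> b \<otimes> x = a \<otimes> (b \<otimes> x)" using ac bc x by (simp add: m_assoc)
  also have "\<dots> = (a \<otimes> x) \<otimes> b" unfolding eqb using ac bc x by (simp add: m_assoc)
  also have "\<dots> = x \<otimes> (a \<otimes> b)" unfolding eq using ac bc x by (simp add: m_assoc)
  finally show "a \<otimes> b \<in> centralizer x" using ac bc by (simp add: centralizer_def)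
qed

definition abelian :: "'a set \<Rightarrow> bool" where "abelian A \<longleftrightarrow> subgp A \<and> (\<forall>x\<in>A. \<forall>y\<in>A. x \<otimes> y = y \<otimes> x)"

definition center :: "'a set" where "center = {z \<in> carrier G. \<forall>g\<in>carrier G. g \<otimes> z = z \<otimes> g}"

lemma normal_center_sub: assumes "subgp A" "A \<subseteq> center" shows "normal_in A (carrier G)"
  unfolding normal_in_def
proof (intro conjI ballI subgroup_self)
  fix g a assume g: "g \<in> carrier G" and a: "a \<in> A"
  have "a \<in> carrier G" "g \<otimes> a = a \<otimes> g" using a assms g by (auto simp: center_def)
  then have "conj_by g a = a" using g by (simp add: conj_by_eq_iff)
  then show "conj_by g a \<in> A" using a by simp
qed (use assms subgroup.subset in auto)

lemma subgp_center: "subgp center"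
proof -
  have "center = (\<Inter>x\<in>carrier G. centralizer x)" by (auto simp: center_def centralizer_def)
  then show ?thesis using subgp_centralizer by (auto intro!: subgroups_Inter)
qed

section \<open>Maximal subgroups and their conjugates\<close>

definition maximal_in :: "'a set \<Rightarrow> 'a set \<Rightarrow> bool"
  where "maximal_in M B \<longleftrightarrow> subgp M \<and> subgp B \<and> M \<subset> B \<and> (\<forall>K. subgp K \<longrightarrow> M \<subseteq> K \<longrightarrow> K \<subseteq> B \<longrightarrow> K = M \<or> K = B)"

lemma maxlD:
  assumes "maximal_in M B"
  shows "subgp M" "subgp B" "M \<subseteq> B" "M \<noteq> B" "subgp K \<Longrightarrow> M \<subseteq> K \<Longrightarrow> K \<subseteq> B \<Longrightarrow> K \<noteq> M \<Longrightarrow> K = B"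
  using assms by (auto simp: maximal_in_def)

lemma maximal_in_ex: assumes "subgp A" "subgp B" "A \<subset> B" shows "\<exists>M. maximal_in M B \<and> A \<subseteq> M"
proof -
  let ?S = "{M. subgp M \<and> A \<subseteq> M \<and> M \<subset> B}"
  have fS: "finite ?S" by (rule finite_subset[of _ "Pow B"]) (use subgp_finite[OF assms(2)] in auto)
  have "A \<in> ?S" using assms by auto
  from finite_has_maximal2[OF fS this] obtain M where M0: "M \<in> ?S" "\<forall>K\<in>?S. M \<subseteq> K \<longrightarrow> M = K"
    by blast
  then have M: "subgp M" "A \<subseteq> M" "M \<subset> B" by simp_all
  have mx: "K = M" if "subgp K" "A \<subseteq> K" "K \<subset> B" "M \<subseteq> K" for K
    using M0(2) that by blast
  have "maximal_in M B" unfolding maximal_in_def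
  proof (intro conjI allI impI M(1,3) assms(2))
    fix K assume "subgp K" "M \<subseteq> K" "K \<subseteq> B"
    then show "K = M \<or> K = B" using mx[of K] M(2) by (cases "K = B") auto
  qed
  then show ?thesis using M(2) by blast
qed

lemma maximal_in_iff: "subgp B \<Longrightarrow> maximal_in M B \<longleftrightarrow> maximal_subgroup M (G\<lparr>carrier := B\<rparr>)"
proof -
  assume B: "subgp B"
  show ?thesis unfolding maximal_in_def maximal_subgroup_def subgroup_restrict_iff[OF B] using B by auto
qed

lemma maximal_in_conj_by: assumes M: "maximal_in M (carrier G)" and g: "g \<in> carrier G" shows "maximal_in (conj_by g ` M) (carrier G)"
  unfolding maximal_in_def
proof (intro conjI allI impI)
  note m = maxlD[OF M]
  have Mc: "M \<subseteq> carrier G" by (rule m(3))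
  show "subgp (conj_by g ` M)" using m(1) g by (rule subgp_conj_by)
  show "subgp (carrier G)" by (rule subgroup_self)
  have "card (conj_by g ` M) = card M" using g Mc by (rule card_conj_by)
  moreover have "card M < card (carrier G)" using m finite_carrier by (simp add: psubset_card_mono psubset_eq)
  ultimately show "conj_by g ` M \<subset> carrier G" using g Mc by (auto simp: psubset_eq)
  fix K assume K: "subgp K" "conj_by g ` M \<subseteq> K" "K \<subseteq> carrier G"
  have K': "subgp (conj_by (inv g) ` K)" using K g by (simp add: subgp_conj_by)
  have "M = conj_by (inv g) ` conj_by g ` M" using g Mc by (simp add: conj_by_image_conj_by conj_by_image_1)
  then have "M \<subseteq> conj_by (inv g) ` K" using K(2) by blast
  then have "conj_by (inv g) ` K = M \<or> conj_by (inv g) ` K = carrier G" using m(5)[OF K'] subgroup.subset[OF K'] by blast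
  moreover have "conj_by g ` conj_by (inv g) ` K = K" using g K(3) by (simp add: conj_by_image_conj_by conj_by_image_1)
  ultimately show "K = conj_by g ` M \<or> K = carrier G"
    using subgp_conj_by_self[OF subgroup_self g] by metis
qed

lemma maximal_in_normalizer_of: assumes "maximal_in M (carrier G)" "\<not> normal_in M (carrier G)" shows "normalizer_of M = M"
proof -
  note m = maxlD[OF assms(1)]
  have "normalizer_of M = M \<or> normalizer_of M = carrier G" using m(5)[OF subgp_normalizer_of[OF m(1)] normalizer_of_self[OF m(1)]] by (auto simp: normalizer_of_def)
  moreover have "normalizer_of M \<noteq> carrier G" using assms(2) normalizer_of_normal_in[OF m(1,2,3)] by auto
  ultimately show ?thesis by simp
qed


text \<open>Orbit-stabilizer counting freed from the action: the fibers of \<open>f\<close> are left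
  cosets of \<open>S\<close>. It is applied to conjugates of a subgroup, to conjugacy classes of
  elements and to the kernel of a commutator map.\<close>

lemma card_fibers:
  assumes A: "subgp A" and S: "subgp S" "S \<subseteq> A"
    and f: "\<And>g h. g \<in> A \<Longrightarrow> h \<in> A \<Longrightarrow> f g = f h \<longleftrightarrow> inv h \<otimes> g \<in> S"
  shows "card (f ` A) * card S = card A"
proof -
  define c where "c = (\<lambda>y. SOME g. g \<in> A \<and> f g = y)"
  have c: "c y \<in> A \<and> f (c y) = y" if "y \<in> f ` A" for y
    unfolding c_def using that by - (rule someI_ex, auto)
  have cA: "g \<in> carrier G" if "g \<in> A" for g using A that by (rule subgp_carrier)
  define h where "h = (\<lambda>(y, s). c y \<otimes> s)"
  have fh: "h (y, s) \<in> A \<and> f (h (y, s)) = y" if "y \<in> f ` A" "s \<in> S" for y s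
  proof -
    have cy: "c y \<in> A" "f (c y) = y" using c that by auto
    have "c y \<otimes> s \<in> A" using cy that A S by (auto simp: sgI subset_iff)
    moreover have "inv (c y) \<otimes> (c y \<otimes> s) \<in> S" using cy that S cA by auto
    ultimately show ?thesis using f[of "c y \<otimes> s" "c y"] cy by (simp add: h_def)
  qed
  have "bij_betw h (f ` A \<times> S) A"
  proof (rule bij_betwI')
    fix u v assume "u \<in> f ` A \<times> S" "v \<in> f ` A \<times> S"
    then obtain y s z t where uv: "u = (y, s)" "v = (z, t)" "y \<in> f ` A" "z \<in> f ` A" "s \<in> S" "t \<in> S"
      by auto
    show "h u = h v \<longleftrightarrow> u = v"
    proof
      assume eq: "h u = h v"
      then have yz: "y = z" using fh uv by metis
      then have "c y \<otimes> s = c y \<otimes> t" using eq uv by (simp add: h_def)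
      moreover have "c y \<in> carrier G" "s \<in> carrier G" "t \<in> carrier G" using uv c cA S by auto
      ultimately show "u = v" using uv yz by simp
    qed simp
  next
    fix u assume "u \<in> f ` A \<times> S" then show "h u \<in> A" using fh by auto
  next
    fix g assume g: "g \<in> A"
    have cg: "c (f g) \<in> A" "f (c (f g)) = f g" using c g by auto
    then have "inv (c (f g)) \<otimes> g \<in> S" using f[OF g cg(1)] by simp
    moreover have "g = h (f g, inv (c (f g)) \<otimes> g)" using cg g cA by (simp add: h_def)
    ultimately show "\<exists>u\<in>f ` A \<times> S. g = h u" using g by blast
  qed
  then show ?thesis by (metis bij_betw_same_card card_cartesian_product)
qed

lemma card_conj_class:
  assumes "subgp L"
  shows "card ((\<lambda>g. conj_by g ` L) ` carrier G) * card (normalizer_of L) = card (carrier G)"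
proof (rule card_fibers)
  fix g h assume gh: "g \<in> carrier G" "h \<in> carrier G"
  have Lc: "L \<subseteq> carrier G" using assms by (rule subgroup.subset)
  have "conj_by (inv h \<otimes> g) ` L = conj_by (inv h) ` conj_by g ` L" using gh Lc by (simp add: conj_by_image_conj_by)
  moreover have "conj_by h ` conj_by (inv h) ` conj_by g ` L = conj_by g ` L" using gh Lc by (simp add: conj_by_image_conj_by)
  moreover have "conj_by (inv h) ` conj_by h ` L = L" using gh Lc by (simp add: conj_by_image_conj_by conj_by_image_1)
  ultimately have "conj_by g ` L = conj_by h ` L \<longleftrightarrow> conj_by (inv h \<otimes> g) ` L = L" by metis
  then show "conj_by g ` L = conj_by h ` L \<longleftrightarrow> inv h \<otimes> g \<in> normalizer_of L" using gh by (simp add: normalizer_of_def)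
qed (use subgp_normalizer_of assms subgroup_self in \<open>auto simp: normalizer_of_def\<close>)

text \<open>If all maximal subgroups were non-normal, the conjugates of one of them would cover at least
  half of \<open>G\<close> outside \<open>N\<close>. They cannot cover everything, and the conjugates of a second
  maximal subgroup would cover another half.\<close>

lemma exists_normal_maximal_in:
  assumes M: "maximal_in M (carrier G)"
    and sub: "\<And>L. maximal_in L (carrier G) \<Longrightarrow> N \<subseteq> L"
    and int: "\<And>L K. maximal_in L (carrier G) \<Longrightarrow> maximal_in K (carrier G) \<Longrightarrow> L \<noteq> K \<Longrightarrow> L \<inter> K \<subseteq> N"
    and N: "subgp N"
  shows "\<exists>L. maximal_in L (carrier G) \<and> normal_in L (carrier G)"
proof (rule ccontr)
  assume neg: "\<not> ?thesis"
  define \<C> where "\<C> = (\<lambda>L. (\<lambda>g. conj_by g ` L) ` carrier G)"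
  define U where "U = (\<lambda>L. \<Union>X\<in>\<C> L. X - N)"
  have mC: "maximal_in X (carrier G)" if "X \<in> \<C> L" "maximal_in L (carrier G)" for X L
    using that maximal_in_conj_by by (auto simp: \<C>_def)
  \<comment> \<open>\<open>L\<close> is its own normalizer, so it has \<open>|G : L|\<close>
    conjugates, and they are disjoint outside \<open>N\<close>. Thus
    \<open>|U L| = |G : L| (|L| - |N|)\<close>, here multiplied by \<open>|L|\<close> and freed of
    the subtraction. \<open>N\<close> is proper in \<open>L\<close> because it also lies in a second
    conjugate of \<open>L\<close>; hence its index is at least 2.\<close>
  have count: "card (U L) * card L + card (carrier G) * card N = card (carrier G) * card L"
    and NL: "2 * card N \<le> card L" if L: "maximal_in L (carrier G)" for L
  proof -
    note l = maxlD[OF L]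
    have nz: "normalizer_of L = L" using neg L maximal_in_normalizer_of by blast
    then have "normalizer_of L \<noteq> carrier G" using l(4) by simp
    then obtain g where g: "g \<in> carrier G" "conj_by g ` L \<noteq> L"
      by (auto simp: normalizer_of_def)
    have mg: "maximal_in (conj_by g ` L) (carrier G)" using maximal_in_conj_by[OF L g(1)] .
    have "N \<noteq> L"
    proof
      assume "N = L"
      then have "L \<subseteq> conj_by g ` L" using sub[OF mg] by simp
      then show False using maxlD(5)[OF L maxlD(1)[OF mg]] maxlD(3,4)[OF mg] g by blast
    qed
    then have "card N \<noteq> card L" using sub[OF L] subgp_finite[OF l(1)] card_subset_eq by blast
    moreover obtain k where k: "card L = card N * k" using subgp_dvd[OF N l(1) sub[OF L]] by (elim dvdE)
    ultimately have "k \<noteq> 1" by auto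
    moreover have "k \<noteq> 0" using k subgp_card_pos[OF l(1)] by auto
    ultimately have "2 \<le> k" by simp
    then show "2 * card N \<le> card L" using k by simp
    have cX: "card (X - N) = card L - card N" if "X \<in> \<C> L" for X
    proof -
      have "card X = card L" using that card_conj_by l(3) by (auto simp: \<C>_def)
      then show ?thesis using sub[OF mC[OF that L]] subgp_finite[OF N] by (simp add: card_Diff_subset)
    qed
    have "card (U L) = card (\<C> L) * (card L - card N)"
    proof -
      have "card (U L) = (\<Sum>X\<in>\<C> L. card (X - N))" unfolding U_def
      proof (rule card_UN_disjoint)
        show "finite (\<C> L)" using finite_carrier by (simp add: \<C>_def)
        show "\<forall>X\<in>\<C> L. finite (X - N)"
          using mC[OF _ L] maxlD(1) subgp_finite by blast
        show "\<forall>X\<in>\<C> L. \<forall>Y\<in>\<C> L. X \<noteq> Y \<longrightarrow> (X - N) \<inter> (Y - N) = {}"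
          using mC[OF _ L] int by blast
      qed
      then show ?thesis using cX by simp
    qed
    moreover have "card (\<C> L) * card L = card (carrier G)"
      using card_conj_class[OF l(1)] nz by (simp add: \<C>_def)
    ultimately have "card (U L) * card L = card (carrier G) * (card L - card N)"
      by (metis mult.assoc mult.commute)
    moreover have "card N \<le> card L" using \<open>2 * card N \<le> card L\<close> by simp
    ultimately show "card (U L) * card L + card (carrier G) * card N = card (carrier G) * card L"
      by (metis add_mult_distrib2 le_add_diff_inverse2)
  qed
  have half: "card (carrier G) \<le> 2 * card (U L)" if L: "maximal_in L (carrier G)" for L
  proof -
    have "card (carrier G) * (2 * card N) \<le> card (carrier G) * card L" using NL[OF L] by (rule mult_left_mono) simp
    then have "card (carrier G) * card L \<le> 2 * card (U L) * card L" using count[OF L] by linarith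
    then show ?thesis using subgp_card_pos[OF maxlD(1)[OF L]] by simp
  qed
  have UG: "U L \<subseteq> carrier G - N" if L: "maximal_in L (carrier G)" for L
    unfolding U_def using mC[OF _ L] maxlD(3) by blast
  \<comment> \<open>By \<open>count\<close>, \<open>|U M| = |G| - |G : M| |N|\<close>, and
    \<open>|G : M| > 1\<close>.\<close>
  have "card (U M) + card N < card (carrier G)"
  proof (rule ccontr)
    assume "\<not> ?thesis"
    then have "card (carrier G) * card M \<le> (card (U M) + card N) * card M"
      by (intro mult_right_mono) simp_all
    then have "card (carrier G) * card N \<le> card M * card N"
      using count[OF M] by (simp only: add_mult_distrib mult.commute[of "card M"])
    then have "card (carrier G) \<le> card M" using subgp_card_pos[OF N] by (simp only: mult_le_cancel2)
    then show False using maxlD[OF M] finite_carrier card_seteq by blast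
  qed
  then have "U M \<union> N \<noteq> carrier G" using card_Un_le[of "U M" N] by auto
  moreover have "U M \<union> N \<subseteq> carrier G" using UG[OF M] subgroup.subset[OF N] by blast
  ultimately obtain y where y: "y \<in> carrier G" "y \<notin> U M" "y \<notin> N" by blast
  \<comment> \<open>Otherwise \<open>G\<close> would be cyclic, hence abelian, and \<open>M\<close>
    would be normal.\<close>
  have "generate G {y} \<noteq> carrier G"
  proof
    assume gy: "generate G {y} = carrier G"
    have "generate G {y} \<subseteq> centralizer y" using y by (intro gen_sub subgp_centralizer) (auto simp: centralizer_def)
    then have com: "g \<otimes> y = y \<otimes> g" if "g \<in> carrier G" for g using gy that by (auto simp: centralizer_def)
    have "centralizer g = carrier G" if "g \<in> carrier G" for g
      using gen_sub[OF subgp_centralizer[OF that], of y] gy y com[OF that] by (auto simp: centralizer_def)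
    then have "g \<in> centralizer x" if "g \<in> carrier G" "x \<in> carrier G" for g x using that by simp
    then have "conj_by g x = x" if "g \<in> carrier G" "x \<in> carrier G" for g x
      using that by (simp add: conj_by_eq_iff centralizer_def)
    then have "normal_in M (carrier G)" using maxlD[OF M] by (auto simp: normal_in_def)
    then show False using neg M by blast
  qed
  then obtain L where L: "maximal_in L (carrier G)" "generate G {y} \<subseteq> L"
    using maximal_in_ex[OF subgp_gen[OF y(1)] subgroup_self] generate_incl[of "{y}"] y(1) by auto
  have yL: "y \<in> L" using L gen_mem by auto
  \<comment> \<open>A common point outside \<open>N\<close> makes a conjugate of \<open>L\<close>
    equal to a conjugate of \<open>M\<close>. Then \<open>L\<close> is itself a conjugate of
    \<open>M\<close>, so that \<open>y\<close> would belong to \<open>U M\<close>.\<close>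
  have disj: "U L \<inter> U M = {}"
  proof (rule ccontr)
    assume "U L \<inter> U M \<noteq> {}"
    then obtain X Y z where XY: "X \<in> \<C> L" "Y \<in> \<C> M" "z \<in> X" "z \<in> Y" "z \<notin> N" by (auto simp: U_def)
    then have "X = Y" using int[OF mC[OF XY(1) L(1)] mC[OF XY(2) M]] by blast
    then obtain g h where gh: "g \<in> carrier G" "h \<in> carrier G" "conj_by g ` L = conj_by h ` M"
      using XY by (auto simp: \<C>_def)
    have "L = conj_by (inv g) ` conj_by g ` L" using gh(1) maxlD(3)[OF L(1)] by (simp add: conj_by_image_conj_by conj_by_image_1)
    also have "\<dots> = conj_by (inv g \<otimes> h) ` M" using gh maxlD(3)[OF M] by (simp add: conj_by_image_conj_by)
    finally have "L \<in> \<C> M" using gh by (auto simp: \<C>_def)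
    then show False using y yL by (auto simp: U_def)
  qed
  have "U L \<union> U M \<subseteq> carrier G - N" using UG L M by blast
  then have "card (U L \<union> U M) \<le> card (carrier G - N)" using finite_carrier by (intro card_mono) auto
  moreover have "card (U L \<union> U M) = card (U L) + card (U M)"
    using disj UG L(1) M finite_carrier by (intro card_Un_disjoint) (auto intro: finite_subset)
  \<comment> \<open>The two disjoint halves would fill \<open>G\<close>, yet both avoid
    \<open>\<one>\<close>, which lies in \<open>N\<close>.\<close>
  moreover have "card (carrier G - N) < card (carrier G)"
    using finite_carrier subgroup.subset[OF N] subgroup.one_closed[OF N] by (intro psubset_card_mono) auto
  ultimately show False using half[OF L(1)] half[OF M] by simp
qed

text \<open>Class equation: outside \<open>Z\<close> every class has a size that is a power of
  \<open>p\<close> other than 1. So \<open>p\<close> divides \<open>card Z\<close>, and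
  \<open>Z\<close> contains more than \<open>\<one>\<close>.\<close>

lemma p_group_center:
  assumes R: "subgp R" "card R = p ^ k" "prime p" and ne: "R \<noteq> {\<one>}"
  shows "\<exists>z\<in>R. z \<noteq> \<one> \<and> (\<forall>g\<in>R. g \<otimes> z = z \<otimes> g)"
proof -
  define Z where "Z = {z\<in>R. \<forall>g\<in>R. g \<otimes> z = z \<otimes> g}"
  define C where "C = (\<lambda>x. (\<lambda>g. conj_by g x) ` R)"
  have Rc: "g \<in> carrier G" if "g \<in> R" for g using R(1) that by (rule subgp_carrier)
  have one: "\<one> \<in> R" using R(1) by (rule subgroup.one_closed)
  have cC: "p dvd card (C x)" if x: "x \<in> R" "x \<notin> Z" for x
  proof -
    have I: "subgp (centralizer x \<inter> R)" using R x Rc by (intro subgp_Int subgp_centralizer) auto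
    have "card (C x) * card (centralizer x \<inter> R) = card R" unfolding C_def
    proof (rule card_fibers[OF R(1) I])
      fix g h assume gh: "g \<in> R" "h \<in> R"
      have cs: "g \<in> carrier G" "h \<in> carrier G" "x \<in> carrier G" using gh x Rc by auto
      have "conj_by g x = conj_by h x \<longleftrightarrow> conj_by (inv h) (conj_by g x) = conj_by (inv h) (conj_by h x)"
        using inj_on_conj_by[of "inv h" "carrier G"] cs by (auto simp: inj_on_eq_iff simp del: conj_by_inv_conj_by)
      also have "\<dots> \<longleftrightarrow> conj_by (inv h \<otimes> g) x = x" using cs by (simp add: conj_by_conj_by)
      also have "\<dots> \<longleftrightarrow> inv h \<otimes> g \<in> centralizer x" using cs by (simp add: conj_by_eq_iff centralizer_def)
      finally show "conj_by g x = conj_by h x \<longleftrightarrow> inv h \<otimes> g \<in> centralizer x \<inter> R" using gh R(1) by (simp add: sgI)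
    qed simp
    then have e: "card (C x) * card (centralizer x \<inter> R) = p ^ k" using R by simp
    then have "card (C x) dvd p ^ k" by (metis dvd_triv_left)
    then obtain j where j: "card (C x) = p ^ j" using divides_primepow_nat[OF R(3)] by blast
    have "j \<noteq> 0"
    proof
      assume "j = 0"
      then have "card (centralizer x \<inter> R) = card R" using e j R by simp
      then have "centralizer x \<inter> R = R" using card_subset_eq[OF subgp_finite[OF R(1)], of "centralizer x \<inter> R"] by blast
      then have "x \<in> Z" using x by (auto simp: Z_def centralizer_def)
      then show False using x by simp
    qed
    then show ?thesis using j by simp
  qed
  have self: "x \<in> C x" if "x \<in> R" for x
    unfolding C_def using that Rc one by (intro image_eqI[of _ _ \<one>]) auto
  have CR: "C x \<subseteq> R - Z" if x: "x \<in> R - Z" for x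
  proof
    fix y assume "y \<in> C x"
    then obtain g where g: "g \<in> R" "y = conj_by g x" by (auto simp: C_def)
    have cs: "g \<in> carrier G" "x \<in> carrier G" using g x Rc by auto
    have yR: "y \<in> R" using subgp_conj_by_self[OF R(1) g(1)] g x by auto
    moreover have "y \<notin> Z"
    proof
      assume yZ: "y \<in> Z"
      have "inv g \<in> R" using R(1) g by (simp add: sgI)
      then have "conj_by (inv g) y = y" using yZ cs yR Rc by (simp add: conj_by_eq_iff Z_def)
      moreover have "conj_by (inv g) y = x" using g cs by simp
      ultimately show False using yZ x by simp
    qed
    ultimately show "y \<in> R - Z" by simp
  qed
  have Ceq: "C y = C x" if xy: "x \<in> R" "y \<in> C x" for x y
  proof -
    obtain g where g: "g \<in> R" "y = conj_by g x" using xy by (auto simp: C_def)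
    have cs: "g \<in> carrier G" "x \<in> carrier G" using g xy Rc by auto
    have "C y = (\<lambda>h. conj_by h x) ` (\<lambda>h. h \<otimes> g) ` R" unfolding C_def g(2) image_image
      using Rc cs by (intro image_cong) (auto simp: conj_by_conj_by)
    also have "(\<lambda>h. h \<otimes> g) ` R = R"
    proof (rule card_subset_eq[OF subgp_finite[OF R(1)]])
      show "(\<lambda>h. h \<otimes> g) ` R \<subseteq> R" using R(1) g by (auto simp: sgI)
      show "card ((\<lambda>h. h \<otimes> g) ` R) = card R"
        using cs subgroup.subset[OF R(1)] by (intro card_image inj_on_g) auto
    qed
    finally show ?thesis by (simp add: C_def)
  qed
  have un: "\<Union> (C ` (R - Z)) = R - Z" using CR self by blast
  have "p dvd card (\<Union> (C ` (R - Z)))"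
  proof (rule dvd_partition)
    show "finite (\<Union> (C ` (R - Z)))" using un subgp_finite[OF R(1)] by simp
    show "\<forall>c\<in>C ` (R - Z). p dvd card c" using cC by blast
    show "\<forall>c1\<in>C ` (R - Z). \<forall>c2\<in>C ` (R - Z). c1 \<noteq> c2 \<longrightarrow> c1 \<inter> c2 = {}"
    proof (intro ballI impI)
      fix c1 c2 assume "c1 \<in> C ` (R - Z)" "c2 \<in> C ` (R - Z)" and ne: "c1 \<noteq> c2"
      then obtain x y where "x \<in> R" "y \<in> R" "c1 = C x" "c2 = C y" by blast
      then show "c1 \<inter> c2 = {}" using Ceq ne by blast
    qed
  qed
  moreover have "card (R - Z) + card Z = card R"
    using subgp_finite[OF R(1)] card_Diff_subset[of Z R] card_mono[of R Z] finite_subset[of Z R] by (auto simp: Z_def)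
  moreover have "p dvd card R"
  proof -
    have "k \<noteq> 0" using ne one R card_1_singletonE[of R] by (cases "k = 0") auto
    then show ?thesis using R by simp
  qed
  ultimately have "p dvd card Z" using un by (metis dvd_add_right_iff)
  moreover have oneZ: "\<one> \<in> Z" using one Rc by (simp add: Z_def)
  ultimately have "Z \<noteq> {\<one>}" using R(3) by (auto simp: prime_nat_iff)
  then obtain z where "z \<in> Z" "z \<noteq> \<one>" using oneZ by blast
  then show ?thesis by (auto simp: Z_def)
qed

end

section \<open>Numbers with all prime divisors in a given set, and arithmetic of indices\<close>

definition pi_number :: "nat set \<Rightarrow> nat \<Rightarrow> bool"
  where "pi_number s n \<longleftrightarrow> (\<forall>p. prime p \<longrightarrow> p dvd n \<longrightarrow> p \<in> s)"

lemma pi_number_dvd: "pi_number s n \<Longrightarrow> m dvd n \<Longrightarrow> pi_number s m"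
  unfolding pi_number_def using dvd_trans by blast

context finite_group
begin

lemma subgp_normal_mult: "normal_in N (carrier G) \<Longrightarrow> subgp B \<Longrightarrow> subgp (N <#> B)"
  by (rule normal_in_mult_subgp) (auto dest: subgroup.subset)

lemma index_dvd_trans:
  assumes "subgp A" "subgp B" "subgp C" "A \<subseteq> B" "B \<subseteq> C"
  shows "card B div card A dvd card C div card A" "card C div card B dvd card C div card A"
proof -
  obtain k where k: "card B = card A * k" using subgp_dvd[OF assms(1,2,4)] by (elim dvdE)
  obtain l where l: "card C = card B * l" using subgp_dvd[OF assms(2,3,5)] by (elim dvdE)
  have "card A \<noteq> 0" "card B \<noteq> 0" using assms subgp_card_pos by auto
  then have "card B div card A = k" "card C div card B = l" "card C div card A = k * l"
    using k l by (auto simp: mult.assoc)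
  then show "card B div card A dvd card C div card A" "card C div card B dvd card C div card A" by auto
qed

text \<open>Second isomorphism theorem on the level of orders: with
  \<open>Y = C (B \<inter> X)\<close> the index of \<open>C\<close> in \<open>Y\<close> equals that
  of \<open>C \<inter> X\<close> in \<open>B \<inter> X\<close>, and \<open>Y\<close> is a subgroup
  of \<open>B\<close>.\<close>

lemma index_Int_dvd:
  assumes "normal_in C B" "subgp X"
  shows "card (B \<inter> X) div card (C \<inter> X) dvd card B div card C"
proof -
  note CB = normal_inD[OF assms(1)]
  define Y where "Y = C <#> (B \<inter> X)"
  have BX: "subgp (B \<inter> X)" and CX: "subgp (C \<inter> X)" using CB assms by (auto intro: subgp_Int)
  have Y: "subgp Y" "Y \<subseteq> B" unfolding Y_def
    using normal_in_mult_subgp[OF assms(1) BX] set_mult_subset[OF CB(2,3)] by auto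
  have "C \<inter> (B \<inter> X) = C \<inter> X" using CB by auto
  then have e: "card Y * card (C \<inter> X) = card C * card (B \<inter> X)"
    using card_mult[OF CB(1) BX] by (simp add: Y_def)
  have "C \<inter> X \<subseteq> B \<inter> X" using CB by auto
  then obtain m where m: "card (B \<inter> X) = card (C \<inter> X) * m" using subgp_dvd[OF CX BX] by (auto elim: dvdE)
  have nz: "card (C \<inter> X) \<noteq> 0" "card C \<noteq> 0" using subgp_card_pos CX CB by auto
  have "card Y = card C * m" using e m nz by simp
  then have "card C * m dvd card C * (card B div card C)"
    using subgp_dvd[OF Y(1) CB(2) Y(2)] subgp_dvd[OF CB(1,2,3)] by simp
  then show ?thesis using m nz by simp
qed

text \<open>Passing to the images modulo \<open>N\<close> loses exactly the factor
  \<open>|N \<inter> B : N \<inter> C|\<close>: this number times \<open>|N B : N C|\<close> is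
  \<open>|B : C|\<close>.\<close>

lemma index_mult_dvd:
  assumes "subgp C" "subgp B" "C \<subseteq> B" "normal_in N (carrier G)"
  shows "card (N <#> B) div card (N <#> C) dvd card B div card C"
proof -
  note N = normal_inD[OF assms(4)]
  have s: "subgp (N <#> B)" "subgp (N <#> C)"
    using subgp_normal_mult[OF assms(4)] assms by auto
  have I: "subgp (N \<inter> B)" "subgp (N \<inter> C)" using N assms by (auto intro: subgp_Int)
  obtain k where k: "card (N \<inter> B) = card (N \<inter> C) * k" using subgp_dvd[OF I(2,1)] assms(3) by (auto elim: dvdE)
  obtain m where m: "card B = card C * m" using subgp_dvd[OF assms(1-3)] by (auto elim: dvdE)
  obtain l where l: "card (N <#> B) = card (N <#> C) * l"
    using subgp_dvd[OF s(2,1) mono_set_mult[OF subset_refl assms(3)]] by (auto elim: dvdE)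
  have nz: "card (N <#> C) \<noteq> 0" "card (N \<inter> C) \<noteq> 0" "card C \<noteq> 0" using subgp_card_pos s I assms by auto
  have "card (N <#> C) * card (N \<inter> C) * (l * k) = card (N <#> B) * card (N \<inter> B)" using k l by simp
  also have "\<dots> = card N * card C * m" using card_mult[OF N(1) assms(2)] m by simp
  also have "\<dots> = card (N <#> C) * card (N \<inter> C) * m" using card_mult[OF N(1) assms(1)] by simp
  finally have "l * k = m" using nz by simp
  then show ?thesis using l m nz by auto
qed

lemma normal_in_mult:
  assumes "normal_in A B" "normal_in N (carrier G)"
  shows "normal_in (N <#> A) (N <#> B)"
proof -
  note N = normal_inD[OF assms(2)] and AB = normal_inD[OF assms(1)]
  have s: "subgp (N <#> B)" "subgp (N <#> A)"
    using subgp_normal_mult[OF assms(2)] AB by auto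
  have Nc: "n \<in> carrier G" if "n \<in> N" for n using N(1) that by (rule subgp_carrier)
  have Bc: "b \<in> carrier G" if "b \<in> B" for b using AB(2) that by (rule subgp_carrier)
  have "N \<subseteq> N <#> A" using set_mult_left[OF AB(1) subgroup.subset[OF N(1)]] .
  have "conj_by y x \<in> N <#> A" if y: "y \<in> N <#> B" and x: "x \<in> N <#> A" for x y
  proof -
    obtain n b where nb: "y = n \<otimes> b" "n \<in> N" "b \<in> B" using y by (auto simp: set_mult_def)
    obtain m a where ma: "x = m \<otimes> a" "m \<in> N" "a \<in> A" using x by (auto simp: set_mult_def)
    have cs: "n \<in> carrier G" "b \<in> carrier G" "m \<in> carrier G" "a \<in> carrier G"
      using nb ma Nc Bc AB(3) by auto
    have "conj_by b x = conj_by b m \<otimes> conj_by b a" using ma cs by (simp add: conj_by_mult)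
    also have "\<dots> \<in> N <#> A" using N(4) AB(4) nb ma cs by (intro set_multI) auto
    finally have bx: "conj_by b x \<in> N <#> A" .
    have "n \<in> N <#> A" using nb \<open>N \<subseteq> N <#> A\<close> by auto
    then have "conj_by n (conj_by b x) \<in> N <#> A" using bx subgp_conj_by_self[OF s(2)] by blast
    then show ?thesis using nb ma cs by (simp add: conj_by_conj_by)
  qed
  then show ?thesis unfolding normal_in_def using s mono_set_mult[OF subset_refl AB(3), where G = G] by blast
qed

text \<open>Some \<open>p\<close>-element \<open>x\<close> of \<open>X\<close> lies outside
  \<open>V\<close>. By maximality \<open>V\<close> and \<open>x\<close> generate \<open>X\<close>,
  so the index divides the order of \<open>x\<close>.\<close>

lemma normal_maximal_in_index:
  assumes V: "maximal_in V X" and n: "normal_in V X"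
  shows "\<exists>p k. prime p \<and> card X div card V dvd p ^ k"
proof -
  note v = maxlD[OF V]
  obtain p x where x: "prime p" "x \<in> X" "p_element p x" "x \<notin> V"
    using all_p_elements_imp_eq[OF v(2,1,3)] v(4) by blast
  have xc: "x \<in> carrier G" using x by (simp add: p_element_def)
  obtain k where k: "ord x = p ^ k" using x by (auto simp: p_element_def)
  have gX: "generate G {x} \<subseteq> X" using gen_sub v x by blast
  have s: "subgp (V <#> generate G {x})" using normal_in_mult_subgp[OF n subgp_gen[OF xc] gX] .
  have "V <#> generate G {x} = X"
  proof (rule v(5)[OF s])
    show "V \<subseteq> V <#> generate G {x}" using set_mult_left[OF subgp_gen[OF xc] subgroup.subset[OF v(1)]] .
    show "V <#> generate G {x} \<subseteq> X" using set_mult_subset[OF v(2,3) gX] .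
    have "x \<in> V <#> generate G {x}" using set_mult_right[OF v(1), of "generate G {x}"] gen_mem subgp_gen[OF xc] subgroup.subset by blast
    then show "V <#> generate G {x} \<noteq> V" using x by auto
  qed
  then have "card X * card (V \<inter> generate G {x}) = card V * p ^ k"
    using card_mult[OF v(1) subgp_gen[OF xc]] card_gen[OF xc] k by simp
  moreover have "card X = card V * (card X div card V)" using subgp_dvd[OF v(1,2,3)] by simp
  ultimately have "card V * (card X div card V * card (V \<inter> generate G {x})) = card V * p ^ k"
    by (metis mult.assoc)
  then have "card X div card V * card (V \<inter> generate G {x}) = p ^ k" using subgp_card_pos[OF v(1)] by simp
  then show ?thesis using x(1) by (metis dvd_triv_left)
qed

text \<open>\<open>K\<close> lies in the Frattini subgroup of \<open>L\<close>. If \<open>P\<close>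
  were not normal, its normalizer in \<open>L\<close> would be inside some maximal \<open>V\<close>,
  which contains \<open>K\<close> too; but \<open>K\<close> and that normalizer together make up
  \<open>L\<close>.\<close>

lemma sylow_of_frattini_normal:
  assumes K: "normal_in K L" and sub: "\<And>V. maximal_in V L \<Longrightarrow> K \<subseteq> V"
    and P: "subgp P" "P \<subseteq> K" "card P = p ^ k" and p: "prime p" "\<not> p dvd card K div card P"
  shows "normal_in P L"
proof -
  note KL = normal_inD[OF K]
  have PL: "P \<subseteq> L" using P KL by auto
  have I: "subgp (normalizer_of P \<inter> L)" using subgp_Int[OF subgp_normalizer_of[OF P(1)] KL(2)] .
  have "normalizer_of P \<inter> L = L"
  proof (rule ccontr)
    assume "normalizer_of P \<inter> L \<noteq> L"
    then have "normalizer_of P \<inter> L \<subset> L" by blast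
    then obtain V where V: "maximal_in V L" "normalizer_of P \<inter> L \<subseteq> V" using maximal_in_ex[OF I KL(2)] by blast
    note v = maxlD[OF V(1)]
    have "b \<in> V" if "b \<in> L" for b
      using frattini[OF K P p that] sub[OF V(1)] V(2) v(1) by (auto intro: subgroup.m_closed)
    then show False using v(3,4) by blast
  qed
  then have "L \<subseteq> normalizer_of P" by blast
  then show ?thesis using normalizer_of_normal_in[OF P(1) KL(2) PL] by simp
qed

end

subsection \<open>Subnormality relative to a partition of the primes\<close>

locale sigma_group = finite_group +
  fixes \<sigma> :: "nat set set"
  assumes part: "partition_on primes \<sigma>"
begin

lemma class_ex: "prime p \<Longrightarrow> \<exists>s\<in>\<sigma>. p \<in> s"
  using part by (auto simp: partition_on_def)

lemma class_unique: "s \<in> \<sigma> \<Longrightarrow> t \<in> \<sigma> \<Longrightarrow> p \<in> s \<Longrightarrow> p \<in> t \<Longrightarrow> s = t"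
  using part by (auto simp: partition_on_def disjoint_def)

lemma finite_primes: "n > 0 \<Longrightarrow> finite {p. prime p \<and> p dvd (n::nat)}"
  by (rule finite_subset[of _ "{..n}"]) (auto dest: dvd_imp_le)

text \<open>As a map on primes it turns the equality of the numbers of classes and of primes into
  injectivity on \<open>prime_set G\<close>; see \<open>card_sigma_set_eq\<close>.\<close>

definition sigma_class :: "nat \<Rightarrow> nat set" where "sigma_class p = (THE s. s \<in> \<sigma> \<and> p \<in> s)"

lemma sigma_class: assumes "prime p" shows "sigma_class p \<in> \<sigma>" "p \<in> sigma_class p"
proof -
  have "\<exists>!s. s \<in> \<sigma> \<and> p \<in> s" using class_ex[OF assms] class_unique by blast
  then have "sigma_class p \<in> \<sigma> \<and> p \<in> sigma_class p" unfolding sigma_class_def by (rule theI')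
  then show "sigma_class p \<in> \<sigma>" "p \<in> sigma_class p" by auto
qed

lemma sigma_class_eq: "prime p \<Longrightarrow> s \<in> \<sigma> \<Longrightarrow> p \<in> s \<Longrightarrow> sigma_class p = s"
  using sigma_class class_unique by blast

lemma sigma_set_eq: "sigma_set \<sigma> K = sigma_class ` prime_set K"
proof
  show "sigma_set \<sigma> K \<subseteq> sigma_class ` prime_set K"
  proof
    fix s assume "s \<in> sigma_set \<sigma> K"
    then obtain p where "s \<in> \<sigma>" "p \<in> s" "p \<in> prime_set K" by (auto simp: sigma_set_def)
    then have "s = sigma_class p" using sigma_class_eq[of p s] by (auto simp: prime_set_def)
    then show "s \<in> sigma_class ` prime_set K" using \<open>p \<in> prime_set K\<close> by blast
  qed
  show "sigma_class ` prime_set K \<subseteq> sigma_set \<sigma> K"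
    using sigma_class by (auto simp: sigma_set_def prime_set_def)
qed

lemma sigma_primary_iff:
  assumes "order K > 0" shows "sigma_primary \<sigma> K \<longleftrightarrow> (\<exists>s\<in>\<sigma>. pi_number s (order K))"
proof -
  have f: "finite (sigma_set \<sigma> K)" using finite_primes[OF assms] by (simp add: sigma_set_eq prime_set_def)
  show ?thesis
  proof
    assume "sigma_primary \<sigma> K"
    then have eq: "\<And>s t. s \<in> sigma_set \<sigma> K \<Longrightarrow> t \<in> sigma_set \<sigma> K \<Longrightarrow> s = t"
      using card_le_Suc0_iff_eq[OF f] by (simp add: sigma_primary_def)
    show "\<exists>s\<in>\<sigma>. pi_number s (order K)"
    proof (cases "prime_set K = {}")
      case True
      \<comment> \<open>A group of order 1 has no prime divisor, so any class is a witness; the one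
        of 2 is taken.\<close>
      then show ?thesis using class_ex[OF two_is_prime_nat] by (auto simp: pi_number_def prime_set_def)
    next
      case False
      then obtain p where p: "p \<in> prime_set K" by auto
      then have "sigma_class q = sigma_class p" if "q \<in> prime_set K" for q using eq that by (simp add: sigma_set_eq)
      then have "pi_number (sigma_class p) (order K)" using sigma_class(2) unfolding pi_number_def prime_set_def by blast
      then show ?thesis using sigma_class p by (auto simp: prime_set_def)
    qed
  next
    assume "\<exists>s\<in>\<sigma>. pi_number s (order K)"
    then obtain s where s: "s \<in> \<sigma>" "pi_number s (order K)" by auto
    have "sigma_class p = s" if "p \<in> prime_set K" for p
      using that s by (intro sigma_class_eq) (auto simp: prime_set_def pi_number_def)
    then show "sigma_primary \<sigma> K" unfolding sigma_primary_def One_nat_def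
      by (subst card_le_Suc0_iff_eq[OF f]) (auto simp: sigma_set_eq)
  qed
qed

lemma sigma_primary_Mod:
  assumes "normal_in C B"
  shows "sigma_primary \<sigma> (G\<lparr>carrier := B\<rparr> Mod C) \<longleftrightarrow> (\<exists>s\<in>\<sigma>. pi_number s (card B div card C))"
proof -
  note CB = normal_inD[OF assms]
  interpret B: group "G\<lparr>carrier := B\<rparr>" using CB(2) by (rule subgroup_imp_group)
  have "card (rcosets\<^bsub>G\<lparr>carrier := B\<rparr>\<^esub> C) * card C = card B"
    using B.lagrange[OF subgroup_incl[OF CB(1,2,3)]] by (simp add: order_def)
  moreover have "card C > 0" using subgp_card_pos[OF CB(1)] .
  ultimately have "order (G\<lparr>carrier := B\<rparr> Mod C) = card B div card C"
    by (metis FactGroup_def div_mult_self_is_m order_def partial_object.select_convs(1))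
  moreover have "card B div card C > 0"
    using subgp_dvd[OF CB(1,2,3)] \<open>card C > 0\<close> subgp_card_pos[OF CB(2)] by (simp add: div_greater_zero_iff dvd_imp_le)
  ultimately show ?thesis using sigma_primary_iff by metis
qed

text \<open>Any normal subgroup \<open>C\<close> of \<open>B\<close> inside \<open>A\<close> may
  serve in place of the normal core. As the core is the largest one, its index divides that of
  \<open>C\<close>, so the notion is unchanged (\<open>sigma_step_iff\<close>). The gain is that a
  witness \<open>C\<close> can be intersected with \<open>X\<close> or multiplied by
  \<open>N\<close>, whereas cores do not commute with these operations.\<close>

definition sigma_step :: "'a set \<Rightarrow> 'a set \<Rightarrow> bool"
  where "sigma_step A B \<longleftrightarrow> subgp A \<and> subgp B \<and> A \<subseteq> B \<and>
    (normal_in A B \<or> (\<exists>C. \<exists>s\<in>\<sigma>. C \<subseteq> A \<and> normal_in C B \<and> pi_number s (card B div card C)))"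

lemma sstepD: assumes "sigma_step A B" shows "subgp A" "subgp B" "A \<subseteq> B"
  using assms by (auto simp: sigma_step_def)

lemma sigma_step_iff:
  assumes "subgp A" "subgp B"
  shows "sigma_step A B \<longleftrightarrow> A \<subseteq> B \<and> (A \<lhd> G\<lparr>carrier := B\<rparr> \<or>
    sigma_primary \<sigma> (G\<lparr>carrier := B\<rparr> Mod normal_core (G\<lparr>carrier := B\<rparr>) A))"
proof (cases "A \<subseteq> B")
  case True
  define D where "D = normal_core (G\<lparr>carrier := B\<rparr>) A"
  note nc = normal_core[OF subgroup_imp_group[OF assms(2)] subgroup_incl[OF assms True], folded D_def]
  have D: "normal_in D B" "D \<subseteq> A" using nc(1,2) assms by (auto simp: normal_in_iff)
  have "(\<exists>C. \<exists>s\<in>\<sigma>. C \<subseteq> A \<and> normal_in C B \<and> pi_number s (card B div card C)) \<longleftrightarrow>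
    (\<exists>s\<in>\<sigma>. pi_number s (card B div card D))"
  proof
    assume "\<exists>C. \<exists>s\<in>\<sigma>. C \<subseteq> A \<and> normal_in C B \<and> pi_number s (card B div card C)"
    then obtain C s where C: "s \<in> \<sigma>" "C \<subseteq> A" "normal_in C B" "pi_number s (card B div card C)" by blast
    have "C \<subseteq> D" using nc(3) C by (simp add: normal_in_iff)
    then have "card B div card D dvd card B div card C"
      using index_dvd_trans(2) normal_inD[OF C(3)] normal_inD[OF D(1)] by blast
    then show "\<exists>s\<in>\<sigma>. pi_number s (card B div card D)" using C pi_number_dvd by blast
  qed (use D in blast)
  then show ?thesis unfolding sigma_step_def using assms True sigma_primary_Mod[OF D(1)]
    by (simp add: normal_in_iff D_def)
qed (simp add: sigma_step_def)

text \<open>The conjunct \<open>subgp H\<close> covers the empty chain, about which the closure says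
  nothing.\<close>

definition sigma_sub :: "'a set \<Rightarrow> 'a set \<Rightarrow> bool"
  where "sigma_sub H X \<longleftrightarrow> subgp H \<and> sigma_step\<^sup>*\<^sup>* H X"

lemma sigma_subnormal_iff: "sigma_subnormal \<sigma> G H \<longleftrightarrow> sigma_sub H (carrier G)"
proof
  assume "sigma_subnormal \<sigma> G H"
  then obtain t :: nat and A where A: "A 0 = H" "A t = carrier G" "\<forall>i\<le>t. subgroup (A i) G"
    and st: "\<forall>i\<in>{1..t}. A (i - 1) \<subseteq> A i \<and> (A (i - 1) \<lhd> G\<lparr>carrier := A i\<rparr> \<or>
         sigma_primary \<sigma> (G\<lparr>carrier := A i\<rparr> Mod normal_core (G\<lparr>carrier := A i\<rparr>) (A (i - 1))))"
    unfolding sigma_subnormal_def by blast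
  have "sigma_step (A i) (A (Suc i))" if "i < t" for i
    using st[rule_format, of "Suc i"] A(3) that by (simp add: sigma_step_iff)
  then have "(sigma_step ^^ t) H (carrier G)" unfolding relpowp_fun_conv using A by blast
  then have "sigma_step\<^sup>*\<^sup>* H (carrier G)" by (rule relpowp_imp_rtranclp)
  then show "sigma_sub H (carrier G)" using A by (auto simp: sigma_sub_def)
next
  assume "sigma_sub H (carrier G)"
  then obtain t A where A: "A 0 = H" "A t = carrier G" "\<And>i. i < t \<Longrightarrow> sigma_step (A i) (A (Suc i))"
    and H: "subgp H"
    unfolding sigma_sub_def rtranclp_power relpowp_fun_conv by blast
  have s: "subgp (A i)" if "i \<le> t" for i
    using A(3)[of "i"] A(2) that subgroup_self sstepD(1) by (cases "i = t") auto
  have "A (i - 1) \<subseteq> A i \<and> (A (i - 1) \<lhd> G\<lparr>carrier := A i\<rparr> \<or>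
         sigma_primary \<sigma> (G\<lparr>carrier := A i\<rparr> Mod normal_core (G\<lparr>carrier := A i\<rparr>) (A (i - 1))))"
    if i: "i \<in> {1..t}" for i
  proof -
    have st: "sigma_step (A (i - 1)) (A i)" using A(3)[of "i - 1"] i by (cases i) auto
    show ?thesis using sigma_step_iff[OF sstepD(1,2)[OF st]] st by blast
  qed
  then show "sigma_subnormal \<sigma> G H" unfolding sigma_subnormal_def using A s by blast
qed

lemma sigma_sub_sub: "sigma_sub H X \<Longrightarrow> H \<subseteq> X"
proof -
  assume "sigma_sub H X"
  then have "sigma_step\<^sup>*\<^sup>* H X" by (simp add: sigma_sub_def)
  then show "H \<subseteq> X" by (induction rule: rtranclp_induct) (use sstepD(3) in blast)+
qed

lemma sigma_step_Int: assumes "sigma_step A B" "subgp X" shows "sigma_step (A \<inter> X) (B \<inter> X)"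
proof -
  note AB = sstepD[OF assms(1)]
  have n: "subgp (A \<inter> X)" "subgp (B \<inter> X)" "A \<inter> X \<subseteq> B \<inter> X" using AB assms(2) by (auto intro: subgp_Int)
  consider "normal_in A B" | C s where "s \<in> \<sigma>" "C \<subseteq> A" "normal_in C B" "pi_number s (card B div card C)"
    using assms(1) by (auto simp: sigma_step_def)
  then show ?thesis
  proof cases
    case 1 then show ?thesis using n normal_in_Int[OF _ assms(2)] by (auto simp: sigma_step_def)
  next
    case 2
    have "pi_number s (card (B \<inter> X) div card (C \<inter> X))"
      using pi_number_dvd[OF 2(4) index_Int_dvd[OF 2(3) assms(2)]] .
    moreover have "C \<inter> X \<subseteq> A \<inter> X" using 2 by auto
    ultimately show ?thesis using n normal_in_Int[OF 2(3) assms(2)] 2(1) by (auto simp: sigma_step_def)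
  qed
qed

lemma sigma_sub_Int: assumes "sigma_sub H B" "subgp X" shows "sigma_sub (H \<inter> X) (B \<inter> X)"
proof -
  have "sigma_step\<^sup>*\<^sup>* H B" using assms by (simp add: sigma_sub_def)
  then have "sigma_step\<^sup>*\<^sup>* (H \<inter> X) (B \<inter> X)"
    by (induction rule: rtranclp_induct) (auto intro: rtranclp.rtrancl_into_rtrancl sigma_step_Int[OF _ assms(2)])
  then show ?thesis using assms subgp_Int by (auto simp: sigma_sub_def)
qed

lemma sigma_sub_in: "sigma_sub H B \<Longrightarrow> subgp X \<Longrightarrow> H \<subseteq> X \<Longrightarrow> X \<subseteq> B \<Longrightarrow> sigma_sub H X"
  using sigma_sub_Int[of H B X] by (simp add: Int_absorb1 Int_absorb2)

lemma sigma_step_mult: assumes "sigma_step A B" "normal_in N (carrier G)" shows "sigma_step (N <#> A) (N <#> B)"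
proof -
  note AB = sstepD[OF assms(1)]
  have n: "subgp (N <#> A)" "subgp (N <#> B)" "N <#> A \<subseteq> N <#> B"
    using subgp_normal_mult[OF assms(2)] AB(1,2) mono_set_mult[OF subset_refl AB(3), where G = G] by blast+
  consider "normal_in A B" | C s where "s \<in> \<sigma>" "C \<subseteq> A" "normal_in C B" "pi_number s (card B div card C)"
    using assms(1) by (auto simp: sigma_step_def)
  then show ?thesis
  proof cases
    case 1 then show ?thesis using n normal_in_mult[OF _ assms(2)] by (auto simp: sigma_step_def)
  next
    case 2
    have "pi_number s (card (N <#> B) div card (N <#> C))"
      using pi_number_dvd[OF 2(4) index_mult_dvd[OF _ _ _ assms(2)]] normal_inD[OF 2(3)] by blast
    moreover have "N <#> C \<subseteq> N <#> A" using mono_set_mult[OF subset_refl 2(2)] .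
    ultimately show ?thesis using n normal_in_mult[OF 2(3) assms(2)] 2(1) by (auto simp: sigma_step_def)
  qed
qed

lemma sigma_sub_mult: assumes "sigma_sub H (carrier G)" "normal_in N (carrier G)" shows "sigma_sub (N <#> H) (carrier G)"
proof -
  have H: "subgp H" "sigma_step\<^sup>*\<^sup>* H (carrier G)" using assms by (simp_all add: sigma_sub_def)
  from H(2) have "sigma_step\<^sup>*\<^sup>* (N <#> H) (N <#> carrier G)"
    by (induction rule: rtranclp_induct) (auto intro: rtranclp.rtrancl_into_rtrancl sigma_step_mult[OF _ assms(2)])
  moreover have "N <#> carrier G = carrier G"
  proof
    show "N <#> carrier G \<subseteq> carrier G"
      using normal_inD[OF assms(2)] by (intro set_mult_closed) auto
    show "carrier G \<subseteq> N <#> carrier G"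
      using set_mult_right[OF normal_inD(1)[OF assms(2)]] by blast
  qed
  moreover have "subgp (N <#> H)" using subgp_normal_mult[OF assms(2) H(1)] .
  ultimately show ?thesis by (simp add: sigma_sub_def)
qed

lemma sigma_sub_top: assumes "sigma_sub H X" "H \<noteq> X" shows "\<exists>A. sigma_sub H A \<and> A \<noteq> X \<and> sigma_step A X"
proof -
  have "sigma_step\<^sup>*\<^sup>* H X" "subgp H" using assms by (auto simp: sigma_sub_def)
  then have "H \<noteq> X \<longrightarrow> (\<exists>A. sigma_sub H A \<and> A \<noteq> X \<and> sigma_step A X)"
  proof (induction rule: rtranclp_induct)
    case (step y z)
    then show ?case by (cases "y = z") (auto simp: sigma_sub_def)
  qed simp
  then show ?thesis using assms by simp
qed

text \<open>Descend along the chain, each step of which has an \<open>s\<close>-number as index. A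
  normal step keeps \<open>x\<close> by \<open>p_element_in_normal\<close>, and a step with witness
  \<open>C\<close> for the class \<open>s\<close> has \<open>x\<close> already in \<open>C\<close>.
  A step for another class \<open>t\<close> is trivial, since its index is both an
  \<open>s\<close>-number and a \<open>t\<close>-number.\<close>

lemma sigma_sub_p_elements:
  assumes "sigma_sub H X" "s \<in> \<sigma>" "pi_number s (card X div card H)" "prime q" "q \<notin> s" "x \<in> X" "p_element q x"
  shows "x \<in> H"
proof -
  have H: "subgp H" and r: "sigma_step\<^sup>*\<^sup>* H X" using assms by (auto simp: sigma_sub_def)
  from r assms(3,6) show ?thesis
  proof (induction rule: rtranclp_induct)
    case (step Y Z)
    note YZ = sstepD[OF step(2)]
    have HY: "H \<subseteq> Y" using step(1) H by (intro sigma_sub_sub) (simp add: sigma_sub_def)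
    note ix = index_dvd_trans[OF H YZ(1,2) HY YZ(3)]
    have pY: "pi_number s (card Y div card H)" using pi_number_dvd[OF step(4) ix(1)] .
    have pZ: "pi_number s (card Z div card Y)" using pi_number_dvd[OF step(4) ix(2)] .
    have "x \<in> Y"
    proof -
      consider "normal_in Y Z" | C t where "t \<in> \<sigma>" "C \<subseteq> Y" "normal_in C Z" "pi_number t (card Z div card C)"
        using step(2) by (auto simp: sigma_step_def)
      then show ?thesis
      proof cases
        case 1
        have "\<not> q dvd card Z div card Y" using pZ assms(4,5) by (auto simp: pi_number_def)
        then show ?thesis using p_element_in_normal[OF 1 step(5) assms(7,4)] by simp
      next
        case 2
        show ?thesis
        proof (cases "t = s")
          case True
          have "\<not> q dvd card Z div card C" using 2(4) True assms(4,5) by (auto simp: pi_number_def)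
          then show ?thesis using p_element_in_normal[OF 2(3) step(5) assms(7,4)] 2(2) by blast
        next
          case False
          have "pi_number t (card Z div card Y)"
            using pi_number_dvd[OF 2(4) index_dvd_trans(2)[OF _ YZ(1,2) 2(2) YZ(3)]] normal_inD[OF 2(3)] by blast
          then have "card Z div card Y = 1"
            using pZ False class_unique[OF 2(1) assms(2)] prime_factor_nat[of "card Z div card Y"]
            by (auto simp: pi_number_def)
          then have "card Z = card Y" using subgp_dvd[OF YZ] by (metis dvd_mult_div_cancel mult.right_neutral)
          then have "Y = Z" using card_subset_eq[OF subgp_finite[OF YZ(2)] YZ(3)] by simp
          then show ?thesis using step(5) by simp
        qed
      qed
    qed
    then show ?case using step(3) pY by blast
  qed simp
qed

text \<open>By maximality the last proper step of the chain starts at \<open>V\<close> itself. If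
  that step is a normal one, its index is a prime power by \<open>normal_maximal_in_index\<close>,
  so \<open>C = V\<close> works with the class of that prime.\<close>

lemma sigma_sub_maximal_in:
  assumes "maximal_in V X" "sigma_sub V X"
  shows "\<exists>C. \<exists>s\<in>\<sigma>. normal_in C X \<and> C \<subseteq> V \<and> pi_number s (card X div card C)"
proof -
  note v = maxlD[OF assms(1)]
  obtain A where A: "sigma_sub V A" "A \<noteq> X" "sigma_step A X" using sigma_sub_top[OF assms(2) v(4)] by blast
  have "A = V" using v(5)[OF sstepD(1)[OF A(3)] sigma_sub_sub[OF A(1)] sstepD(3)[OF A(3)]] A(2) by blast
  then consider "normal_in V X" | "\<exists>C. \<exists>s\<in>\<sigma>. C \<subseteq> V \<and> normal_in C X \<and> pi_number s (card X div card C)"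
    using A(3) by (auto simp: sigma_step_def)
  then show ?thesis
  proof cases
    case 1
    obtain p k where pk: "prime p" "card X div card V dvd p ^ k" using normal_maximal_in_index[OF assms(1) 1] by blast
    obtain s where s: "s \<in> \<sigma>" "p \<in> s" using class_ex[OF pk(1)] by blast
    have "pi_number s (p ^ k)" unfolding pi_number_def
      using s pk(1) by (metis prime_dvd_power primes_dvd_imp_eq)
    then show ?thesis using 1 s(1) pi_number_dvd[OF _ pk(2)] by blast
  next
    case 2 then show ?thesis by blast
  qed
qed

end

section \<open>Generated normal subgroups and criteria for indices\<close>

context finite_group
begin

lemma normal_in_carrier: "normal_in A (carrier G) \<longleftrightarrow> A \<lhd> G"
  by (simp add: normal_in_iff subgroup_self)

lemma normal_inI:
  assumes "subgp A" "\<And>g a. g \<in> carrier G \<Longrightarrow> a \<in> A \<Longrightarrow> conj_by g a \<in> A"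
  shows "normal_in A (carrier G)"
  unfolding normal_in_def using assms subgroup_self subgroup.subset by blast

lemma normal_generate:
  assumes "S \<subseteq> carrier G" "\<And>g x. g \<in> carrier G \<Longrightarrow> x \<in> S \<Longrightarrow> conj_by g x \<in> S"
  shows "normal_in (generate G S) (carrier G)"
  unfolding normal_in_carrier using assms by (intro normal_generateI) (auto simp: conj_by_def)

text \<open>For \<open>q\<close> outside \<open>s\<close> a Sylow \<open>q\<close>-subgroup of
  \<open>K\<close> consists of \<open>q\<close>-elements and so lies in \<open>Y\<close>; hence
  \<open>q\<close> does not divide the index.\<close>

lemma index_pi:
  assumes "subgp Y" "subgp K" "Y \<subseteq> K"
    and "\<And>q x. prime q \<Longrightarrow> q \<notin> s \<Longrightarrow> x \<in> K \<Longrightarrow> p_element q x \<Longrightarrow> x \<in> Y"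
  shows "pi_number s (card K div card Y)"
  unfolding pi_number_def
proof (intro allI impI, rule ccontr)
  fix q :: nat assume q: "prime q" "q dvd card K div card Y" "q \<notin> s"
  obtain Q where Q: "subgp Q" "Q \<subseteq> K" "card Q = q ^ multiplicity q (card K)" using sylow_ex[OF assms(2) q(1)] by blast
  have QY: "Q \<subseteq> Y" using assms(4)[OF q(1,3)] p_element_of_p_subgroup[OF Q(1,3) q(1)] Q(2) by blast
  have "q dvd card K div card Q"
    using q(2) index_dvd_trans(2)[OF Q(1) assms(1,2) QY assms(3)] dvd_trans by blast
  then show False using sylow_index[OF assms(2) q(1) Q] by simp
qed

lemma pi_number_index_trans:
  assumes "subgp A" "subgp B" "subgp C" "A \<subseteq> B" "B \<subseteq> C" "pi_number s (card B div card A)" "pi_number s (card C div card B)"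
  shows "pi_number s (card C div card A)"
proof -
  have "card A dvd card B" "card B dvd card C" using assms subgp_dvd by auto
  then have "card C div card A = (card C div card B) * (card B div card A)"
    using subgp_card_pos[OF assms(2)] by (simp add: div_mult_div_if_dvd mult.commute)
  then show ?thesis using assms(6,7) by (auto simp: pi_number_def prime_dvd_mult_iff)
qed

lemma index_product:
  assumes "subgp A" "subgp B" "subgp (A <#> B)"
  shows "card (A <#> B) div card B = card A div card (A \<inter> B)"
proof -
  have I: "subgp (A \<inter> B)" using assms by (intro subgp_Int)
  obtain k where k: "card A = card (A \<inter> B) * k" using subgp_dvd[OF I assms(1)] by (auto elim: dvdE)
  have nz: "card (A \<inter> B) \<noteq> 0" "card B \<noteq> 0" using subgp_card_pos I assms by auto
  have "card (A <#> B) * card (A \<inter> B) = card (A \<inter> B) * k * card B"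
    using card_mult[OF assms(1,2)] k by simp
  then have "card (A <#> B) = k * card B" using nz by (simp add: mult.commute)
  then show ?thesis using k nz by simp
qed

lemma p_element_coprime_one:
  assumes "subgp P" "card P = p ^ j" "prime p" "prime q" "p \<noteq> q" "x \<in> P" "p_element q x"
  shows "x = \<one>"
proof -
  obtain k where k: "ord x = q ^ k" and xc: "x \<in> carrier G" using assms(7) by (auto simp: p_element_def)
  obtain i where i: "ord x = p ^ i" using p_element_of_p_subgroup[OF assms(1,2,3,6)] by (auto simp: p_element_def)
  have "ord x = 1"
  proof (rule ccontr)
    assume "ord x \<noteq> 1"
    then have "q dvd ord x" using k by (cases k) auto
    then have "q dvd p" using i assms(4) prime_dvd_power by metis
    then show False using assms primes_dvd_imp_eq by blast
  qed
  then show ?thesis using ord_eq_1[OF xc] by simp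
qed

lemma generate_comm:
  assumes x: "x \<in> carrier G" and yz: "y \<in> generate G {x}" "z \<in> generate G {x}"
  shows "y \<otimes> z = z \<otimes> y"
proof -
  have yc: "y \<in> carrier G" using yz subgp_gen[OF x] subgp_carrier by blast
  have "x \<in> centralizer x" using x by (simp add: centralizer_def)
  then have "y \<in> centralizer x" using gen_sub[OF subgp_centralizer[OF x]] yz by blast
  then have "x \<in> centralizer y" using x by (simp add: centralizer_def)
  then have "z \<in> centralizer y" using gen_sub[OF subgp_centralizer[OF yc]] yz by blast
  then show ?thesis by (simp add: centralizer_def)
qed

end

subsection \<open>Groups whose 2-maximal subgroups are subnormal relative to the partition\<close>

locale sigma_m2 = sigma_group +
  assumes sub2: "maximal_in M (carrier G) \<Longrightarrow> maximal_in H M \<Longrightarrow> sigma_sub H (carrier G)"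
begin

definition critical :: "'a set \<Rightarrow> bool" where "critical M \<longleftrightarrow> maximal_in M (carrier G) \<and> \<not> sigma_sub M (carrier G)"

lemma critical_sigma_step: "critical M \<Longrightarrow> \<not> sigma_step M (carrier G)"
  by (auto simp: critical_def sigma_sub_def dest: maxlD)

lemma critical_not_normal: "critical M \<Longrightarrow> \<not> normal_in M (carrier G)"
  using critical_sigma_step[of M] by (auto simp: sigma_step_def dest: normal_inD)

lemma critical_core:
  assumes "critical M" "normal_in C (carrier G)" "C \<subseteq> M" "s \<in> \<sigma>"
  shows "\<not> pi_number s (card (carrier G) div card C)"
  using critical_sigma_step[OF assms(1)] assms maxlD[of M "carrier G"] by (auto simp: sigma_step_def critical_def)

text \<open>The product \<open>N H\<close> lies between \<open>H\<close> and \<open>M\<close> and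
  inherits \<open>\<sigma>\<close>-subnormality from \<open>H\<close>. Since \<open>M\<close> is not
  \<open>\<sigma>\<close>-subnormal, \<open>N H\<close> must be \<open>H\<close>.\<close>

lemma critical_normal_sub:
  assumes M: "critical M" and H: "maximal_in H M" and N: "normal_in N (carrier G)" "N \<subseteq> M"
  shows "N \<subseteq> H"
proof -
  have mM: "maximal_in M (carrier G)" using M by (simp add: critical_def)
  note m = maxlD[OF mM] and h = maxlD[OF H]
  have s: "subgp (N <#> H)" by (rule subgp_normal_mult[OF N(1) h(1)])
  have "H \<subseteq> N <#> H" by (rule set_mult_right[OF normal_inD(1)[OF N(1)] subgroup.subset[OF h(1)]])
  moreover have "N <#> H \<subseteq> M" by (rule set_mult_subset[OF m(1) N(2) h(3)])
  moreover have "N <#> H \<noteq> M" using sigma_sub_mult[OF sub2[OF mM H] N(1)] M by (auto simp: critical_def)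
  ultimately have "N <#> H = H" using h(5)[OF s] by blast
  then show ?thesis using set_mult_left[OF h(1) subgroup.subset[OF normal_inD(1)[OF N(1)]]] by simp
qed

lemma critical_maximal_in_ex: assumes "critical M" shows "\<exists>H. maximal_in H M"
proof -
  have m: "subgp M" using assms by (auto simp: critical_def dest: maxlD)
  have "normal_in {\<one>} (carrier G)" by (rule normal_inI) (auto simp: triv_subgroup)
  then have "{\<one>} \<noteq> M" using critical_not_normal[OF assms] by blast
  then have "{\<one>} \<subset> M" using subgroup.one_closed[OF m] by blast
  then show ?thesis using maximal_in_ex[OF triv_subgroup m] by blast
qed

text \<open>Otherwise every maximal subgroup is critical and all of them have the same core \<open>N\<close>, which is
  their only maximal subgroup; this contradicts the count above.\<close>

lemma critical_supplement_ex:
  assumes "\<exists>M. critical M"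
  shows "\<exists>M K. critical M \<and> normal_in K (carrier G) \<and> K \<noteq> carrier G \<and> \<not> K \<subseteq> M"
proof (rule ccontr)
  assume neg: "\<not> ?thesis"
  \<comment> \<open>The negation says that every proper normal subgroup of \<open>G\<close> lies in
    every critical subgroup. With \<open>critical_core\<close> this excludes all steps up to
    \<open>G\<close> that come from a proper normal subgroup of primary index.\<close>
  have sub: "K \<subseteq> M" if "critical M" "normal_in K (carrier G)" "K \<noteq> carrier G" for M K
    using neg that by blast
  obtain M where M: "critical M" using assms by blast
  have critical: "critical L" if L: "maximal_in L (carrier G)" for L
  proof (rule ccontr)
    assume "\<not> critical L"
    then have "sigma_sub L (carrier G)" using L by (simp add: critical_def)
    then obtain C s where C: "s \<in> \<sigma>" "normal_in C (carrier G)" "C \<subseteq> L" "pi_number s (card (carrier G) div card C)"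
      using sigma_sub_maximal_in[OF L] by blast
    have "C \<noteq> carrier G" using C(3) maxlD(3,4)[OF L] by blast
    then show False using critical_core[OF M C(2) sub[OF M C(2)] C(1)] C(4) by simp
  qed
  \<comment> \<open>The last proper step from \<open>H\<close> to \<open>G\<close> starts at some
    \<open>A\<close>, and it must be normal. So \<open>A\<close> lies in \<open>L\<close>, differs
    from \<open>L\<close>, and contains the maximal subgroup \<open>H\<close> of \<open>L\<close>:
    it is \<open>H\<close>.\<close>
  have nrm: "normal_in H (carrier G)" if L: "critical L" and H: "maximal_in H L" for L H
  proof -
    have mL: "maximal_in L (carrier G)" using L by (simp add: critical_def)
    note l = maxlD[OF mL] and h = maxlD[OF H]
    have "H \<noteq> carrier G" using h(3,4) l(3) by blast
    then obtain A where A: "sigma_sub H A" "A \<noteq> carrier G" "sigma_step A (carrier G)"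
      using sigma_sub_top[OF sub2[OF mL H]] by blast
    consider "normal_in A (carrier G)"
      | C s where "s \<in> \<sigma>" "C \<subseteq> A" "normal_in C (carrier G)" "pi_number s (card (carrier G) div card C)"
      using A(3) by (auto simp: sigma_step_def)
    then show ?thesis
    proof cases
      case 1
      have "A \<subseteq> L" using sub[OF L 1 A(2)] .
      moreover have "A \<noteq> L" using 1 critical_not_normal[OF L] by blast
      ultimately have "A = H" using h(5)[OF sstepD(1)[OF A(3)] sigma_sub_sub[OF A(1)]] by blast
      then show ?thesis using 1 by simp
    next
      case 2
      have "C \<noteq> carrier G" using 2(2) A(2) sstepD(3)[OF A(3)] by blast
      then show ?thesis using critical_core[OF L 2(3) sub[OF L 2(3)] 2(1)] 2(4) by simp
    qed
  qed
  obtain N where N: "maximal_in N M" using critical_maximal_in_ex[OF M] by blast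
  have nN: "normal_in N (carrier G)" using nrm[OF M N] .
  have neq: "H \<noteq> carrier G" if "maximal_in L (carrier G)" "maximal_in H L" for L H
    using maxlD(3,4)[OF that(1)] maxlD(3)[OF that(2)] by blast
  \<comment> \<open>Both \<open>H\<close> and \<open>N\<close> are normal in \<open>G\<close>, so
    each lies in every critical subgroup, and then \<open>critical_normal_sub\<close> places each
    one inside the other.\<close>
  have NH: "H = N" if L: "maximal_in L (carrier G)" "maximal_in H L" for L H
  proof
    have "H \<subseteq> M" using sub[OF M nrm[OF critical[OF L(1)] L(2)] neq[OF L]] .
    then show "H \<subseteq> N" using critical_normal_sub[OF M N nrm[OF critical[OF L(1)] L(2)]] by simp
    have "N \<subseteq> L" using sub[OF critical[OF L(1)] nN] neq[OF _ N] M by (simp add: critical_def)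
    then show "N \<subseteq> H" using critical_normal_sub[OF critical[OF L(1)] L(2) nN] by simp
  qed
  have NL: "maximal_in N L" if L: "maximal_in L (carrier G)" for L
    using critical_maximal_in_ex[OF critical[OF L]] NH[OF L] by blast
  have "\<exists>L. maximal_in L (carrier G) \<and> normal_in L (carrier G)"
  proof (rule exists_normal_maximal_in)
    show "maximal_in M (carrier G)" using M by (simp add: critical_def)
    show "subgp N" using maxlD(1)[OF N] .
    show "N \<subseteq> L" if "maximal_in L (carrier G)" for L using maxlD(3)[OF NL[OF that]] .
    show "L \<inter> K \<subseteq> N" if L: "maximal_in L (carrier G)" "maximal_in K (carrier G)" "L \<noteq> K" for L K
    proof -
      note l = maxlD[OF L(1)] and k = maxlD[OF L(2)]
      have "L \<inter> K \<noteq> L" using l(5)[OF k(1)] k(3,4) L(3) by blast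
      then show ?thesis
        using maxlD(5)[OF NL[OF L(1)] subgp_Int[OF l(1) k(1)]] maxlD(3)[OF NL[OF L(1)]] maxlD(3)[OF NL[OF L(2)]] by blast
    qed
  qed
  then show False using critical critical_not_normal by blast
qed

lemma critical_minimal_supplement:
  assumes "\<exists>M. critical M"
  obtains M K where "critical M" "normal_in K (carrier G)" "K \<noteq> carrier G" "\<not> K \<subseteq> M"
    "\<And>A. normal_in A (carrier G) \<Longrightarrow> A \<subset> K \<Longrightarrow> A \<subseteq> M"
proof -
  obtain M K0 where M: "critical M" "normal_in K0 (carrier G)" "K0 \<noteq> carrier G" "\<not> K0 \<subseteq> M"
    using critical_supplement_ex[OF assms] by blast
  let ?P = "\<lambda>K. normal_in K (carrier G) \<and> K \<noteq> carrier G \<and> \<not> K \<subseteq> M"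
  have "\<exists>K. ?P K \<and> (\<forall>A. ?P A \<longrightarrow> card K \<le> card A)"
    by (rule ex_has_least_nat[of ?P K0]) (use M in blast)
  then obtain K where K: "?P K" "\<And>A. ?P A \<Longrightarrow> card K \<le> card A" by blast
  have "A \<subseteq> M" if A: "normal_in A (carrier G)" "A \<subset> K" for A
  proof (rule ccontr)
    assume "\<not> A \<subseteq> M"
    moreover have "A \<noteq> carrier G" using A(2) normal_inD(3) K(1) by blast
    ultimately have "card K \<le> card A" using K(2) A(1) by blast
    moreover have "card A < card K" using A(2) subgp_finite normal_inD(1) K(1) by (intro psubset_card_mono) blast+
    ultimately show False by simp
  qed
  then show thesis using that M(1) K(1) by blast
qed

text \<open>Take \<open>L\<close> maximal containing \<open>K\<close>. If some maximal
  \<open>V\<close> of \<open>L\<close> misses part of \<open>K\<close>, then \<open>V\<close>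
  contains a normal \<open>C\<close> of \<open>L\<close> with an \<open>s\<close>-number as index.
  For \<open>q\<close> outside \<open>s\<close> the \<open>q\<close>-elements of \<open>K\<close>
  lie in \<open>C\<close>, so they generate a normal subgroup of \<open>G\<close> that is proper in
  \<open>K\<close>, hence inside \<open>M\<close>. Otherwise \<open>K\<close> lies in the Frattini
  subgroup of \<open>L\<close>, its Sylow subgroups are normal, and minimality makes
  \<open>K\<close> a \<open>p\<close>-group.\<close>

lemma supplement_class:
  assumes M: "critical M" and K: "normal_in K (carrier G)" "K \<noteq> carrier G" "\<not> K \<subseteq> M"
    and min: "\<And>A. normal_in A (carrier G) \<Longrightarrow> A \<subset> K \<Longrightarrow> A \<subseteq> M"
  shows "\<exists>s\<in>\<sigma>. \<forall>q x. prime q \<longrightarrow> q \<notin> s \<longrightarrow> x \<in> K \<longrightarrow> p_element q x \<longrightarrow> x \<in> M"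
proof -
  note k = normal_inD[OF K(1)]
  have "K \<subset> carrier G" using k K by blast
  then obtain L where L: "maximal_in L (carrier G)" "K \<subseteq> L" using maximal_in_ex[OF k(1) subgroup_self] by blast
  note l = maxlD[OF L(1)]
  show ?thesis
  proof (cases "\<exists>V. maximal_in V L \<and> \<not> K \<subseteq> V")
    case True
    then obtain V where V: "maximal_in V L" "\<not> K \<subseteq> V" by blast
    have "sigma_sub V L" using sigma_sub_in[OF sub2[OF L(1) V(1)] l(1) maxlD(3)[OF V(1)] l(3)] .
    then obtain C s where C: "s \<in> \<sigma>" "normal_in C L" "C \<subseteq> V" "pi_number s (card L div card C)"
      using sigma_sub_maximal_in[OF V(1)] by blast
    define S where "S = {x\<in>K. \<exists>q. prime q \<and> q \<notin> s \<and> p_element q x}"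
    have SC: "S \<subseteq> C"
    proof
      fix x assume "x \<in> S"
      then obtain q where x: "x \<in> L" "prime q" "q \<notin> s" "p_element q x" using L by (auto simp: S_def)
      have "\<not> q dvd card L div card C" using C(4) x by (auto simp: pi_number_def)
      then show "x \<in> C" using p_element_in_normal[OF C(2) x(1,4,2)] by simp
    qed
    have "normal_in (generate G S) (carrier G)"
    proof (rule normal_generate)
      show "S \<subseteq> carrier G" by (auto simp: S_def p_element_def)
      show "conj_by g x \<in> S" if "g \<in> carrier G" "x \<in> S" for g x
        using that k(4) p_element_conj_by by (auto simp: S_def)
    qed
    moreover have "generate G S \<subset> K"
    proof -
      have "generate G S \<subseteq> K" by (rule generate_subgroup_incl[OF _ k(1)]) (auto simp: S_def)
      moreover have "generate G S \<subseteq> C" by (rule generate_subgroup_incl[OF SC normal_inD(1)[OF C(2)]])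
      ultimately show ?thesis using V C by blast
    qed
    ultimately have "generate G S \<subseteq> M" by (rule min)
    then have "S \<subseteq> M" using generate.incl by fastforce
    then show ?thesis using C(1) by (auto simp: S_def)
  next
    case False
    then have sub: "\<And>V. maximal_in V L \<Longrightarrow> K \<subseteq> V" by blast
    have KL: "normal_in K L" using normal_in_mono[OF K(1) l(1) L(2) l(3)] .
    have Kp: "normal_in P K" if P: "subgp P" "P \<subseteq> K" "card P = p ^ multiplicity p (card K)" "prime p" for P p
      using sylow_of_frattini_normal[OF KL sub P(1,2,3,4) sylow_index[OF k(1) P(4,1,2,3)]]
        normal_in_mono[OF _ k(1) P(2) L(2)] by blast
    have mem: "x \<in> P" if P: "subgp P" "P \<subseteq> K" "card P = p ^ multiplicity p (card K)" "prime p"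
      and x: "x \<in> K" "p_element p x" for P p x
      using p_element_in_normal[OF Kp[OF P] x P(4) sylow_index[OF k(1) P(4,1,2,3)]] .
    have "\<exists>p P. prime p \<and> subgp P \<and> P \<subseteq> K \<and> card P = p ^ multiplicity p (card K) \<and> \<not> P \<subseteq> M"
    proof (rule ccontr)
      assume neg: "\<not> ?thesis"
      have "K \<inter> M = K"
      proof (rule all_p_elements_imp_eq[OF k(1)])
        show "subgp (K \<inter> M)" using k M by (intro subgp_Int) (auto simp: critical_def dest: maxlD)
        fix p x assume x: "prime (p::nat)" "x \<in> K" "p_element p x"
        obtain P where P: "subgp P" "P \<subseteq> K" "card P = p ^ multiplicity p (card K)" using sylow_ex[OF k(1) x(1)] by blast
        show "x \<in> K \<inter> M" using mem[OF P x] neg P x by blast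
      qed simp
      then show False using K by blast
    qed
    then obtain p P where p: "prime p" and P: "subgp P" "P \<subseteq> K" "card P = p ^ multiplicity p (card K)" and PM: "\<not> P \<subseteq> M"
      by blast
    \<comment> \<open>\<open>P\<close> is the set of all \<open>p\<close>-elements of
      \<open>K\<close>, which is invariant under conjugation in \<open>G\<close>.\<close>
    have "normal_in P (carrier G)"
    proof (rule normal_inI[OF P(1)])
      fix g a assume g: "g \<in> carrier G" "a \<in> P"
      then have "conj_by g a \<in> K" "p_element p (conj_by g a)" using k(4) P(2) p_element_conj_by p_element_of_p_subgroup[OF P(1,3) p] by auto
      then show "conj_by g a \<in> P" using mem[OF P p] by blast
    qed
    then have "P = K" using min P(2) PM by blast
    obtain s where s: "s \<in> \<sigma>" "p \<in> s" using class_ex[OF p] by blast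
    have "x \<in> M" if "prime q" "q \<notin> s" "x \<in> K" "p_element q x" for q x
    proof -
      have "x = \<one>" using p_element_coprime_one[OF P(1,3) p that(1)] that s \<open>P = K\<close> by blast
      then show ?thesis using M by (auto simp: critical_def dest!: maxlD(1) subgroup.one_closed)
    qed
    then show ?thesis using s by blast
  qed
qed

end

lemma primes_dvd_power_eq: "prime p \<Longrightarrow> prime q \<Longrightarrow> p dvd q ^ n \<Longrightarrow> p = (q::nat)"
  using prime_dvd_power primes_dvd_imp_eq by blast

context sigma_m2
begin

text \<open>For \<open>H\<close> maximal in \<open>M\<close>, the index of \<open>H\<close> in \<open>K H\<close> is an \<open>s\<close>-number, so \<open>H\<close>
  contains all \<open>q\<close>-elements of \<open>K H\<close> for \<open>q\<close> outside \<open>s\<close>. If no such \<open>q\<close>-element generates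
  \<open>M\<close>, the subgroup generated by those of \<open>M\<close> is therefore normalized by \<open>K\<close> and \<open>M\<close>, and its
  index in \<open>G\<close> is an \<open>s\<close>-number.\<close>

lemma critical_cyclic:
  assumes M: "critical M" and K: "normal_in K (carrier G)" "\<not> K \<subseteq> M" and s: "s \<in> \<sigma>"
    and elM: "\<forall>q x. prime q \<longrightarrow> q \<notin> s \<longrightarrow> x \<in> K \<longrightarrow> p_element q x \<longrightarrow> x \<in> M"
  obtains q x N where "prime q" "q \<notin> s" "p_element q x" "generate G {x} = M"
    "maximal_in N M" "normal_in N (carrier G)"
    "\<forall>p y. prime p \<longrightarrow> p \<notin> s \<longrightarrow> y \<in> K \<longrightarrow> p_element p y \<longrightarrow> y \<in> N"
    "carrier G = K <#> M" "pi_number s (card (carrier G) div card M)"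
proof -
  have el: "x \<in> M" if "prime q" "q \<notin> s" "x \<in> K" "p_element q x" for q x using elM that by blast
  have mM: "maximal_in M (carrier G)" using M by (simp add: critical_def)
  note m = maxlD[OF mM] and k = normal_inD[OF K(1)]
  have Mc: "x \<in> carrier G" if "x \<in> M" for x using m(1) that by (rule subgp_carrier)
  have Kc: "x \<in> carrier G" if "x \<in> K" for x using k(1) that by (rule subgp_carrier)
  have KM: "K <#> M = carrier G"
  proof (rule m(5)[OF subgp_normal_mult[OF K(1) m(1)]])
    show "M \<subseteq> K <#> M" using set_mult_right[OF k(1) m(3)] .
    show "K <#> M \<subseteq> carrier G" using k(3) m(3) by (rule set_mult_closed)
    show "K <#> M \<noteq> M" using set_mult_left[OF m(1) k(3)] K(2) by blast
  qed
  define S where "S = {x\<in>K. \<exists>q. prime q \<and> q \<notin> s \<and> p_element q x}"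
  have SG: "S \<subseteq> carrier G" by (auto simp: S_def p_element_def)
  have nS: "normal_in (generate G S) (carrier G)"
    using SG by (rule normal_generate) (use k(4) p_element_conj_by in \<open>auto simp: S_def\<close>)
  have "generate G S \<subseteq> M" using el by (intro generate_subgroup_incl[OF _ m(1)]) (auto simp: S_def)
  then have SH: "generate G S \<subseteq> H" if "maximal_in H M" for H using critical_normal_sub[OF M that nS] by blast
  have KH: "y \<in> H" if H: "maximal_in H M" and y: "prime p" "p \<notin> s" "y \<in> K <#> H" "p_element p y" for H p y
  proof -
    note h = maxlD[OF H]
    have X: "subgp (K <#> H)" by (rule subgp_normal_mult[OF K(1) h(1)])
    have HX: "H \<subseteq> K <#> H" using set_mult_right[OF k(1) subgroup.subset[OF h(1)]] .
    have sX: "sigma_sub H (K <#> H)" using sigma_sub_in[OF sub2[OF mM H] X HX subgroup.subset[OF X]] .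
    \<comment> \<open>The \<open>q\<close>-elements of \<open>K\<close> with \<open>q\<close>
      outside \<open>s\<close> generate a normal subgroup of \<open>G\<close> inside
      \<open>M\<close>, which lies in \<open>H\<close> by
      \<open>critical_normal_sub\<close>.\<close>
    have "pi_number s (card K div card (K \<inter> H))"
    proof (rule index_pi[OF subgp_Int[OF k(1) h(1)] k(1)])
      fix q x assume "prime q" "q \<notin> s" "x \<in> K" "p_element q x"
      then have "x \<in> S" by (auto simp: S_def)
      then show "x \<in> K \<inter> H" using SH[OF H] generate.incl \<open>x \<in> K\<close> by fastforce
    qed simp
    then have "pi_number s (card (K <#> H) div card H)" using index_product[OF k(1) h(1) X] by simp
    then show ?thesis using sigma_sub_p_elements[OF sX s _ y] by simp
  qed
  have iM: "pi_number s (card (carrier G) div card M)"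
  proof -
    have "pi_number s (card K div card (K \<inter> M))"
      by (rule index_pi[OF subgp_Int[OF k(1) m(1)] k(1)]) (use el in auto)
    then show ?thesis using index_product[OF k(1) m(1)] KM m(2) by simp
  qed
  obtain q x where x: "prime q" "q \<notin> s" "x \<in> M" "p_element q x" "generate G {x} = M"
  proof (rule ccontr)
    note found = that
    assume neg: "\<not> thesis"
    define U where "U = {x\<in>M. \<exists>q. prime q \<and> q \<notin> s \<and> p_element q x}"
    have cU: "conj_by g y \<in> U" if g: "g \<in> carrier G" and y: "y \<in> U" for g y
    proof -
      obtain q where q: "prime q" "q \<notin> s" "p_element q y" "y \<in> M" using y by (auto simp: U_def)
      \<comment> \<open>Conjugation by the part \<open>u\<close> of \<open>g\<close> stays in
        \<open>M\<close>. The result does not generate \<open>M\<close>, so some maximal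
        \<open>H\<close> contains it. Conjugation by \<open>w\<close> then stays in
        \<open>K H\<close>, whose \<open>q\<close>-elements lie in \<open>H\<close>.\<close>
      have "g \<in> K <#> M" using g KM by simp
      then obtain w u where w: "g = w \<otimes> u" "w \<in> K" "u \<in> M" by (auto simp: set_mult_def)
      have uy: "conj_by u y \<in> M" "p_element q (conj_by u y)" using subgp_conj_by_self[OF m(1) w(3)] q p_element_conj_by Mc[OF w(3)] by auto
      have "generate G {conj_by u y} \<noteq> M" using neg found q(1,2) uy by blast
      then have "generate G {conj_by u y} \<subset> M" using gen_sub[OF m(1) uy(1)] by blast
      then obtain H where H: "maximal_in H M" "generate G {conj_by u y} \<subseteq> H"
        using maximal_in_ex[OF subgp_gen[OF Mc[OF uy(1)]] m(1)] by blast
      have uH: "conj_by u y \<in> H" using H gen_mem by blast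
      have "w \<in> K <#> H" using w set_mult_left[OF maxlD(1)[OF H(1)] k(3)] by blast
      moreover have "conj_by u y \<in> K <#> H" using uH set_mult_right[OF k(1) subgroup.subset[OF maxlD(1)[OF H(1)]]] by blast
      ultimately have "conj_by w (conj_by u y) \<in> K <#> H"
        using subgp_conj_by_self[OF subgp_normal_mult[OF K(1) maxlD(1)[OF H(1)]]] by blast
      then have "conj_by w (conj_by u y) \<in> H" using KH[OF H(1) q(1,2)] p_element_conj_by[OF Kc[OF w(2)] uy(2)] by blast
      then have "conj_by w (conj_by u y) \<in> M" using maxlD(3)[OF H(1)] by blast
      moreover have "conj_by w (conj_by u y) = conj_by g y" using w Kc Mc q by (simp add: conj_by_conj_by)
      ultimately show ?thesis using p_element_conj_by[OF g q(3)] q by (auto simp: U_def)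
    qed
    have UG: "U \<subseteq> carrier G" by (auto simp: U_def p_element_def)
    have nU: "normal_in (generate G U) (carrier G)" using UG cU by (rule normal_generate)
    have UM: "generate G U \<subseteq> M" by (rule generate_subgroup_incl[OF _ m(1)]) (auto simp: U_def)
    have "pi_number s (card M div card (generate G U))"
    proof (rule index_pi[OF normal_inD(1)[OF nU] m(1) UM])
      fix q x assume "prime q" "q \<notin> s" "x \<in> M" "p_element q x"
      then have "x \<in> U" by (auto simp: U_def)
      then show "x \<in> generate G U" by (rule generate.incl)
    qed
    then have "pi_number s (card (carrier G) div card (generate G U))"
      using pi_number_index_trans[OF normal_inD(1)[OF nU] m(1,2) UM m(3)] iM by blast
    then show False using critical_core[OF M nU UM s] by simp
  qed
  have xc: "x \<in> carrier G" using x(3) by (rule Mc)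
  obtain n where n: "card M = q ^ n" using x(4,5) card_gen[OF xc] by (auto simp: p_element_def)
  obtain N where N: "maximal_in N M" using critical_maximal_in_ex[OF M] by blast
  note N' = maxlD[OF N]
  \<comment> \<open>The part of \<open>g\<close> in the cyclic group \<open>M\<close> fixes
    \<open>a\<close>, so only conjugation by \<open>w\<close> in \<open>K\<close> matters; it stays
    in \<open>K N\<close>, where \<open>KH\<close> applies with \<open>H = N\<close>.\<close>
  have nN: "normal_in N (carrier G)"
  proof (rule normal_inI[OF N'(1)])
    fix g a assume g: "g \<in> carrier G" and a: "a \<in> N"
    have "g \<in> K <#> M" using g KM by simp
    then obtain w u where w: "g = w \<otimes> u" "w \<in> K" "u \<in> M" by (auto simp: set_mult_def)
    have aM: "a \<in> M" using a N'(3) by blast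
    have "u \<otimes> a = a \<otimes> u" using generate_comm[OF xc] x(5) w(3) aM by simp
    then have "conj_by u a = a" using Mc w(3) aM by (simp add: conj_by_eq_iff)
    then have e: "conj_by g a = conj_by w a" using w Kc Mc aM conj_by_conj_by[of w u a] by simp
    have "w \<in> K <#> N" using w set_mult_left[OF N'(1) k(3)] by blast
    moreover have "a \<in> K <#> N" using a set_mult_right[OF k(1) subgroup.subset[OF N'(1)]] by blast
    ultimately have "conj_by w a \<in> K <#> N" using subgp_conj_by_self[OF subgp_normal_mult[OF K(1) N'(1)]] by blast
    moreover have "p_element q (conj_by w a)" using p_element_of_p_subgroup[OF m(1) n x(1) aM] p_element_conj_by Kc[OF w(2)] by blast
    ultimately show "conj_by g a \<in> N" using KH[OF N x(1,2)] e by simp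
  qed
  have elN: "y \<in> N" if "prime p" "p \<notin> s" "y \<in> K" "p_element p y" for p y
    using KH[OF N that(1,2) _ that(4)] that(3) set_mult_left[OF N'(1) k(3)] by blast
  show thesis by (rule that[OF x(1,2,4,5) N nN _ KM[symmetric] iM]) (use elN in blast)
qed

lemma critical_structure:
  assumes "\<exists>M. critical M"
  obtains q r n a M N R where "prime q" "prime r" "sigma_class q \<noteq> sigma_class r"
    "maximal_in M (carrier G)" "\<not> normal_in M (carrier G)" "card M = q ^ n" "abelian M"
    "maximal_in N M" "N \<subseteq> center" "\<And>H. maximal_in H M \<Longrightarrow> H = N"
    "normal_in R (carrier G)" "card R = r ^ a" "abelian R" "R \<noteq> {\<one>}"
    "card (carrier G) = card R * card M"
proof -
  obtain M K where M: "critical M" and K: "normal_in K (carrier G)" "K \<noteq> carrier G" "\<not> K \<subseteq> M"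
    and min: "\<And>A. normal_in A (carrier G) \<Longrightarrow> A \<subset> K \<Longrightarrow> A \<subseteq> M"
    using critical_minimal_supplement[OF assms] by metis
  obtain s where s: "s \<in> \<sigma>" and el: "\<forall>q x. prime q \<longrightarrow> q \<notin> s \<longrightarrow> x \<in> K \<longrightarrow> p_element q x \<longrightarrow> x \<in> M"
    using supplement_class[OF M K min] by metis
  obtain q x N where x: "prime q" "q \<notin> s" "p_element q x" "generate G {x} = M"
    and N: "maximal_in N M" "normal_in N (carrier G)"
    and elN: "\<forall>p y. prime p \<longrightarrow> p \<notin> s \<longrightarrow> y \<in> K \<longrightarrow> p_element p y \<longrightarrow> y \<in> N"
    and KM: "carrier G = K <#> M" and iM: "pi_number s (card (carrier G) div card M)"
    using critical_cyclic[OF M K(1,3) s el] by metis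
  have mM: "maximal_in M (carrier G)" using M by (simp add: critical_def)
  note m = maxlD[OF mM] and k = normal_inD[OF K(1)]
  have xc: "x \<in> carrier G" using x by (simp add: p_element_def)
  have Mc: "x \<in> carrier G" if "x \<in> M" for x using m(1) that by (rule subgp_carrier)
  obtain n where n: "card M = q ^ n" using x(3,4) card_gen[OF xc] by (auto simp: p_element_def)
  have com: "y \<otimes> z = z \<otimes> y" if "y \<in> M" "z \<in> M" for y z using generate_comm[OF xc] x(4) that by simp
  have aM: "abelian M" using com m(1) by (simp add: abelian_def)
  have nM: "\<not> normal_in M (carrier G)" using critical_not_normal[OF M] .
  have uniq: "H = N" if H: "maximal_in H M" for H
    using critical_normal_sub[OF M H N(2)] maxlD[OF N(1)] maxlD[OF H] by blast
  have nz: "normalizer_of M = M" using maximal_in_normalizer_of[OF mM nM] .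
  then have "normalizer_of M \<noteq> carrier G" using m(4) by simp
  then obtain g where g: "g \<in> carrier G" "conj_by g ` M \<noteq> M" by (auto simp: normalizer_of_def)
  \<comment> \<open>The centralizer of \<open>z\<close> contains the abelian group \<open>M\<close>.
    As \<open>N\<close> is normal, it also contains a different conjugate of \<open>M\<close>, so it
    is all of \<open>G\<close>.\<close>
  have Nctr: "N \<subseteq> center"
  proof
    fix z assume z: "z \<in> N"
    have zM: "z \<in> M" and zc: "z \<in> carrier G" using z maxlD(3)[OF N(1)] Mc by auto
    have 1: "M \<subseteq> centralizer z" using com zM Mc by (auto simp: centralizer_def)
    have "z \<in> conj_by g ` N" using normal_in_conj_by[OF N(2) g(1)] z by simp
    then obtain y where y: "y \<in> N" "z = conj_by g y" by auto
    have yM: "y \<in> M" using y maxlD(3)[OF N(1)] by auto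
    have 2: "conj_by g ` M \<subseteq> centralizer z"
    proof
      fix v assume "v \<in> conj_by g ` M"
      then obtain w where w: "w \<in> M" "v = conj_by g w" by auto
      have "v \<otimes> z = conj_by g (w \<otimes> y)" using w y g Mc yM by (simp add: conj_by_mult)
      also have "\<dots> = z \<otimes> v" using w y g Mc yM com[of w y] by (simp add: conj_by_mult)
      finally show "v \<in> centralizer z" using w g Mc by (simp add: centralizer_def)
    qed
    have "centralizer z \<noteq> M"
    proof
      assume "centralizer z = M"
      then have "conj_by g ` M \<subseteq> M" using 2 by simp
      then have "conj_by g ` M = M" using card_subset_eq[OF subgp_finite[OF m(1)]] card_conj_by[OF g(1) m(3)] by simp
      then show False using g by simp
    qed
    then have "centralizer z = carrier G" using m(5)[OF subgp_centralizer[OF zc] 1] by (auto simp: centralizer_def)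
    then show "z \<in> center" using zc by (auto simp: center_def centralizer_def)
  qed
  have I: "subgp (K \<inter> M)" using k(1) m(1) by (rule subgp_Int)
  have iKM: "pi_number s (card K div card (K \<inter> M))"
    by (rule index_pi[OF I k(1)]) (use el in auto)
  \<comment> \<open>This provides the prime \<open>r\<close>. The index is an
    \<open>s\<close>-number, so \<open>r\<close> is in \<open>s\<close> and differs from
    \<open>q\<close>.\<close>
  have "card K div card (K \<inter> M) \<noteq> 1"
  proof
    assume "card K div card (K \<inter> M) = 1"
    then have "card (K \<inter> M) = card K" using subgp_dvd[OF I k(1)] by (metis dvd_mult_div_cancel inf_le1 mult.right_neutral)
    then have "K \<inter> M = K" using card_subset_eq[OF subgp_finite[OF k(1)]] by blast
    then show False using K(3) by blast
  qed
  then obtain r where r: "prime r" "r dvd card K div card (K \<inter> M)" using prime_factor_nat by blast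
  have rs: "r \<in> s" using r iKM by (auto simp: pi_number_def)
  then have rq: "r \<noteq> q" using x(2) by auto
  have "r dvd card K" using r(2) subgp_dvd[OF I k(1)] by (metis dvd_mult_div_cancel dvd_mult inf_le1)
  obtain R0 where R0: "subgp R0" "R0 \<subseteq> K" "card R0 = r ^ multiplicity r (card K)" using sylow_ex[OF k(1) r(1)] by blast
  have rR0: "r dvd card R0" unfolding R0(3)
    using \<open>r dvd card K\<close> r(1) subgp_card_pos[OF k(1)] by (intro dvd_power) (simp add: prime_multiplicity_gt_zero_iff)
  define Z0 where "Z0 = normalizer_of R0"
  have Z0: "subgp Z0" "Z0 \<subseteq> carrier G" unfolding Z0_def using subgp_normalizer_of[OF R0(1)] by (auto simp: normalizer_of_def)
  have KZ: "K <#> Z0 = carrier G"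
  proof
    show "K <#> Z0 \<subseteq> carrier G" using k(3) Z0(2) by (rule set_mult_closed)
    show "carrier G \<subseteq> K <#> Z0"
      using frattini[OF K(1) R0 r(1) sylow_index[OF k(1) r(1) R0]] by (force simp: Z0_def set_mult_def)
  qed
  have center_normalizer_of: "z \<in> Z0" if "z \<in> center" for z
  proof -
    have "conj_by z y = y" if "y \<in> R0" for y
      using \<open>z \<in> center\<close> that subgp_carrier[OF R0(1)] conj_by_eq_iff[of z y] by (force simp: center_def)
    then have "conj_by z ` R0 = R0" by force
    then show ?thesis using that by (simp add: Z0_def normalizer_of_def center_def)
  qed
  \<comment> \<open>For primes outside \<open>s\<close> the elements of \<open>K\<close> lie in
    \<open>N\<close>, hence in the center, hence in \<open>Z0\<close>. So \<open>q\<close> does not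
    divide the index of \<open>Z0\<close> in \<open>G\<close>, and \<open>p_subgroup_conj\<close>,
    which requires no more than that, puts \<open>M\<close> into a conjugate of
    \<open>Z0\<close>.\<close>
  have "pi_number s (card K div card (K \<inter> Z0))"
    by (rule index_pi[OF subgp_Int[OF k(1) Z0(1)] k(1)]) (use elN Nctr center_normalizer_of in blast)+
  then have "pi_number s (card (carrier G) div card Z0)"
    using index_product[OF k(1) Z0(1)] KZ subgroup_self by simp
  then have "\<not> q dvd card (carrier G) div card Z0" using x(1,2) by (auto simp: pi_number_def)
  then obtain b where b: "b \<in> carrier G" "M \<subseteq> conj_by b ` Z0"
    using p_subgroup_conj[OF subgroup_self Z0 m(1,3) n x(1)] by blast
  \<comment> \<open>The conjugate of \<open>R0\<close> that \<open>M\<close> normalizes.\<close>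
  define R where "R = conj_by b ` R0"
  have R: "subgp R" unfolding R_def using R0(1) b(1) by (rule subgp_conj_by)
  have R0c: "R0 \<subseteq> carrier G" using R0(1) by (rule subgroup.subset)
  have cR: "card R = r ^ multiplicity r (card K)" unfolding R_def using card_conj_by[OF b(1) R0c] R0(3) by simp
  have Rc: "R \<subseteq> carrier G" using R by (rule subgroup.subset)
  have "conj_by b ` Z0 \<subseteq> normalizer_of R"
  proof
    fix y assume "y \<in> conj_by b ` Z0"
    then obtain z where z: "z \<in> Z0" "y = conj_by b z" by auto
    have zc: "z \<in> carrier G" using z Z0 by auto
    have "conj_by y ` R = conj_by (y \<otimes> b) ` R0" unfolding R_def using z zc b R0c by (simp add: conj_by_image_conj_by)
    also have "y \<otimes> b = b \<otimes> z" using z zc b by (simp add: conj_by_def m_assoc)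
    also have "conj_by (b \<otimes> z) ` R0 = conj_by b ` conj_by z ` R0" using zc b R0c by (simp add: conj_by_image_conj_by)
    also have "\<dots> = R" using z by (simp add: R_def Z0_def normalizer_of_def)
    finally show "y \<in> normalizer_of R" using z zc b by (simp add: normalizer_of_def)
  qed
  then have MnR: "M \<subseteq> normalizer_of R" using b by blast
  have triv: "y = \<one>" if "y \<in> M" "p_element r y" for y
    using p_element_coprime_one[OF m(1) n x(1) r(1) rq[symmetric] that] .
  have RM1: "y = \<one>" if "y \<in> R" "y \<in> M" for y
    using triv[OF that(2)] p_element_of_p_subgroup[OF R cR r(1) that(1)] by simp
  have R1: "R \<noteq> {\<one>}"
  proof
    assume "R = {\<one>}"
    then have "r dvd 1" using rR0 cR R0(3) by simp
    then show False using r(1) by (simp add: prime_nat_iff)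
  qed
  \<comment> \<open>A nontrivial subgroup of \<open>R\<close> normalized by \<open>M\<close>
    supplements \<open>M\<close>. Used for \<open>R\<close>, this makes \<open>R\<close> normal and
    gives the order of \<open>G\<close>; used for the center of \<open>R\<close>, it makes
    \<open>R\<close> abelian.\<close>
  have sup: "A <#> M = carrier G" if A: "subgp A" "A \<subseteq> R" "A \<noteq> {\<one>}" "M \<subseteq> normalizer_of A" for A
  proof (rule m(5))
    show s: "subgp (A <#> M)" using A(1) m(1) by (rule subgp_mult) (use A(4) in \<open>auto simp: normalizer_of_def\<close>)
    show "M \<subseteq> A <#> M" using set_mult_right[OF A(1) m(3)] .
    show "A <#> M \<subseteq> carrier G" using s by (rule subgroup.subset)
    have "\<not> A \<subseteq> M" using A RM1 subgroup.one_closed[OF A(1)] by blast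
    then show "A <#> M \<noteq> M" using set_mult_left[OF m(1) subgroup.subset[OF A(1)]] by blast
  qed
  have RM: "R <#> M = carrier G" using sup[OF R subset_refl R1 MnR] .
  have "carrier G \<subseteq> normalizer_of R"
    using set_mult_subset[OF subgp_normalizer_of[OF R] normalizer_of_self[OF R] MnR] RM by simp
  then have nR: "normal_in R (carrier G)" using normalizer_of_normal_in[OF R subgroup_self Rc] by simp
  have cG: "card (carrier G) = card R * card M"
  proof -
    have "R \<inter> M = {\<one>}" using RM1 subgroup.one_closed[OF R] subgroup.one_closed[OF m(1)] by blast
    then show ?thesis using card_mult[OF R m(1)] RM by simp
  qed
  \<comment> \<open>The center of \<open>R\<close>: both \<open>Z\<close> and \<open>R\<close>
    complement \<open>M\<close>, so they have the same order and coincide.\<close>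
  define Z where "Z = {z\<in>R. \<forall>y\<in>R. y \<otimes> z = z \<otimes> y}"
  have Z: "subgp Z"
  proof -
    have "Z = (\<Inter>y\<in>R. centralizer y) \<inter> R" using Rc by (auto simp: Z_def centralizer_def)
    moreover have "subgp (\<Inter>y\<in>R. centralizer y)" using subgp_centralizer Rc R1 subgroup.one_closed[OF R] by (intro subgroups_Inter) auto
    ultimately show ?thesis using R subgp_Int by simp
  qed
  have "M \<subseteq> normalizer_of Z"
  proof
    fix u assume u: "u \<in> M"
    show "u \<in> normalizer_of Z"
    proof (rule nzrI[OF Z Mc[OF u]])
      fix z assume z: "z \<in> Z"
      have "conj_by u z \<in> R" using normal_inD(4)[OF nR Mc[OF u]] z by (auto simp: Z_def)
      moreover have "y \<otimes> conj_by u z = conj_by u z \<otimes> y" if y: "y \<in> R" for y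
      proof -
        have "y \<in> conj_by u ` R" using normal_in_conj_by[OF nR Mc[OF u]] y by simp
        then obtain w where w: "w \<in> R" "y = conj_by u w" by auto
        have cs: "w \<in> carrier G" "z \<in> carrier G" "u \<in> carrier G" using w z Rc Mc[OF u] by (auto simp: Z_def)
        have "y \<otimes> conj_by u z = conj_by u (w \<otimes> z)" using w cs by (simp add: conj_by_mult)
        also have "w \<otimes> z = z \<otimes> w" using z w by (simp add: Z_def)
        also have "conj_by u (z \<otimes> w) = conj_by u z \<otimes> y" using w cs by (simp add: conj_by_mult)
        finally show ?thesis .
      qed
      ultimately show "conj_by u z \<in> Z" by (simp add: Z_def)
    qed
  qed
  moreover have "Z \<noteq> {\<one>}" using p_group_center[OF R cR r(1) R1] by (auto simp: Z_def)
  ultimately have ZM: "Z <#> M = carrier G" using sup[OF Z] by (auto simp: Z_def)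
  have "Z \<inter> M = {\<one>}" using RM1 subgroup.one_closed[OF Z] subgroup.one_closed[OF m(1)] by (auto simp: Z_def)
  then have "card (carrier G) = card Z * card M" using card_mult[OF Z m(1)] ZM by simp
  then have "card Z * card M = card R * card M" using cG by argo
  then have "card Z = card R" using subgp_card_pos[OF m(1)] by simp
  then have "Z = R" using card_subset_eq[OF subgp_finite[OF R], of Z] by (auto simp: Z_def)
  then have aR: "abelian R" using R by (auto simp: abelian_def Z_def)
  have "sigma_class q \<noteq> sigma_class r" using sigma_class(2)[OF x(1)] sigma_class_eq[OF r(1) s rs] x(2) by auto
  then show thesis by (rule that[OF x(1) r(1) _ mM nM n aM N(1) Nctr _ nR cR aR R1 cG]) (rule uniq)
qed

text \<open>\<open>B = R N\<close> is abelian because \<open>N\<close> is central. A subgroup not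
  inside \<open>B\<close> contains an element \<open>y\<close> of prime power order outside
  \<open>B\<close>. It is a \<open>q\<close>-element, because \<open>R\<close> contains all
  \<open>r\<close>-elements, so it is conjugate to some \<open>u\<close> in \<open>M\<close>. As
  \<open>u\<close> is not in the only maximal subgroup \<open>N\<close> of \<open>M\<close>, it
  generates \<open>M\<close>; thus the subgroup contains a conjugate of \<open>M\<close>.\<close>

lemma proper_abelian:
  assumes "\<exists>M. critical M"
  obtains q r n a where "prime q" "prime r" "sigma_class q \<noteq> sigma_class r" "n > 0" "a > 0"
    "card (carrier G) = r ^ a * q ^ n"
    "\<And>S. subgp S \<Longrightarrow> S \<noteq> carrier G \<Longrightarrow> abelian S"
proof -
  obtain q r n a M N R where q: "prime q" and r: "prime r" and qr: "sigma_class q \<noteq> sigma_class r"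
    and M: "maximal_in M (carrier G)" "\<not> normal_in M (carrier G)" "card M = q ^ n" "abelian M"
    and N: "maximal_in N M" "N \<subseteq> center" "\<And>H. maximal_in H M \<Longrightarrow> H = N"
    and R: "normal_in R (carrier G)" "card R = r ^ a" "abelian R" "R \<noteq> {\<one>}"
    and cG: "card (carrier G) = card R * card M"
    by (rule critical_structure[OF assms]) blast
  note m = maxlD[OF M(1)] and R' = normal_inD[OF R(1)] and N' = maxlD[OF N(1)]
  have rq: "r \<noteq> q" using qr by auto
  have c: "card (carrier G) = r ^ a * q ^ n" using cG M(3) R(2) by simp
  have a: "a > 0"
  proof (rule ccontr)
    assume "\<not> a > 0"
    then have "card R = 1" using R(2) by simp
    then show False using R(4) subgroup.one_closed[OF R'(1)] by (auto simp: card_1_singleton_iff)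
  qed
  have n: "n > 0"
  proof (rule ccontr)
    assume "\<not> n > 0"
    then have "card M = 1" using M(3) by simp
    moreover have "\<one> \<in> N" using subgroup.one_closed[OF N'(1)] .
    ultimately show False using N'(3,4) by (auto simp: card_1_singleton_iff)
  qed
  define B where "B = R <#> N"
  have Nc: "z \<in> carrier G" "g \<in> carrier G \<Longrightarrow> g \<otimes> z = z \<otimes> g" if "z \<in> N" for z g
    using N(2) that by (auto simp: center_def)
  have Rc: "z \<in> carrier G" if "z \<in> R" for z using R'(1) that by (rule subgp_carrier)
  have sB: "subgp B" unfolding B_def by (rule subgp_normal_mult[OF R(1) N'(1)])
  have RB: "R \<subseteq> B" and NB: "N \<subseteq> B" unfolding B_def
    using set_mult_left[OF N'(1) R'(3)] set_mult_right[OF R'(1) subgroup.subset[OF N'(1)]] by auto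
  have comB: "y \<otimes> z = z \<otimes> y" if yz: "y \<in> B" "z \<in> B" for y z
  proof -
    obtain u v where y: "y = u \<otimes> v" "u \<in> R" "v \<in> N" using yz by (auto simp: B_def set_mult_def)
    obtain w t where z: "z = w \<otimes> t" "w \<in> R" "t \<in> N" using yz by (auto simp: B_def set_mult_def)
    have cs: "u \<in> carrier G" "v \<in> carrier G" "w \<in> carrier G" "t \<in> carrier G" using y z Rc Nc by auto
    have "y \<otimes> z = u \<otimes> (v \<otimes> w) \<otimes> t" using y z cs by (simp add: m_assoc)
    also have "v \<otimes> w = w \<otimes> v" using Nc(2)[OF y(3) cs(3)] by simp
    also have "u \<otimes> (w \<otimes> v) \<otimes> t = (u \<otimes> w) \<otimes> (v \<otimes> t)" using cs by (simp add: m_assoc)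
    also have "u \<otimes> w = w \<otimes> u" using R(3) y z by (simp add: abelian_def)
    also have "v \<otimes> t = t \<otimes> v" using Nc(2)[OF z(3) cs(2)] by simp
    also have "(w \<otimes> u) \<otimes> (t \<otimes> v) = w \<otimes> (u \<otimes> t) \<otimes> v" using cs by (simp add: m_assoc)
    also have "u \<otimes> t = t \<otimes> u" using Nc(2)[OF z(3) cs(1)] by simp
    also have "w \<otimes> (t \<otimes> u) \<otimes> v = z \<otimes> y" using y z cs by (simp add: m_assoc)
    finally show ?thesis .
  qed
  have ab: "abelian S" if S: "subgp S" "S \<noteq> carrier G" for S
  proof (cases "S \<subseteq> B")
    case True
    then show ?thesis using S comB by (auto simp: abelian_def)
  next
    case False
    then have "S \<inter> B \<noteq> S" by blast
    then obtain p y where y: "prime p" "y \<in> S" "p_element p y" "y \<notin> B"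
      using all_p_elements_imp_eq[OF S(1) subgp_Int[OF S(1) sB]] by blast
    have yc: "y \<in> carrier G" using y by (simp add: p_element_def)
    have "p \<noteq> r"
    proof
      assume p: "p = r"
      have "\<not> r dvd card (carrier G) div card R"
        using cG M(3) subgp_card_pos[OF R'(1)] rq primes_dvd_power_eq[OF r q] by auto
      then have "y \<in> R" using p_element_in_normal[OF R(1) yc] y p by blast
      then show False using y RB by blast
    qed
    moreover have "p = r \<or> p = q"
    proof (rule ccontr)
      assume ne: "\<not> (p = r \<or> p = q)"
      obtain k where k: "ord y = p ^ k" using y by (auto simp: p_element_def)
      have "k = 0"
      proof (rule ccontr)
        assume "k \<noteq> 0"
        then have "p dvd r ^ a * q ^ n"
          using k ord_dvd_group_order[OF yc] c by (metis dvd_power dvd_trans gr0I order_def)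
        then have "p dvd r \<or> p dvd q" using y(1) by (meson prime_dvd_mult_iff prime_dvd_power)
        then show False using ne y(1) q r primes_dvd_imp_eq by blast
      qed
      then have "y = \<one>" using k ord_eq_1[OF yc] by simp
      then show False using y(4) subgroup.one_closed[OF sB] by simp
    qed
    ultimately have p: "p = q" by simp
    obtain k where k: "ord y = q ^ k" using y p by (auto simp: p_element_def)
    have "\<not> q dvd card (carrier G) div card M"
      using cG R(2) subgp_card_pos[OF m(1)] rq primes_dvd_power_eq[OF q r] by auto
    then obtain b where b: "b \<in> carrier G" "generate G {y} \<subseteq> conj_by b ` M"
      using p_subgroup_conj[OF subgroup_self m(1,3) subgp_gen[OF yc] _ _ q] card_gen[OF yc] k
        subgroup.subset[OF subgp_gen[OF yc]] by metis
    then obtain u where u: "u \<in> M" "y = conj_by b u" using gen_mem by blast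
    have uc: "u \<in> carrier G" using u m(3) by blast
    have "u \<notin> N"
    proof
      assume uN: "u \<in> N"
      then have "conj_by b u = u" using Nc(2)[OF uN b(1)] b(1) uc by (simp add: conj_by_eq_iff)
      then show False using u y NB uN by auto
    qed
    have gu: "generate G {u} = M"
    proof (rule ccontr)
      assume "generate G {u} \<noteq> M"
      then have "generate G {u} \<subset> M" using gen_sub[OF m(1) u(1)] by blast
      then obtain H where "maximal_in H M" "generate G {u} \<subseteq> H" using maximal_in_ex[OF subgp_gen[OF uc] m(1)] by blast
      then show False using N(3) gen_mem \<open>u \<notin> N\<close> by blast
    qed
    have Sc: "S \<subseteq> carrier G" using S(1) by (rule subgroup.subset)
    have "u \<in> conj_by (inv b) ` S" using u(2) y(2) b(1) uc by (intro image_eqI[of _ _ y]) simp_all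
    then have "M \<subseteq> conj_by (inv b) ` S" using gen_sub[OF subgp_conj_by[OF S(1)], of "inv b" u] b gu by simp
    then have "conj_by b ` M \<subseteq> conj_by b ` conj_by (inv b) ` S" by blast
    also have "\<dots> = S" using b(1) Sc by (simp add: conj_by_image_conj_by conj_by_image_1)
    finally have "S = conj_by b ` M" using maxlD(5)[OF maximal_in_conj_by[OF M(1) b(1)] S(1)] S(2) Sc by blast
    moreover have "abelian (conj_by b ` M)"
      unfolding abelian_def
    proof (intro conjI ballI)
      show "subgp (conj_by b ` M)" using m(1) b(1) by (rule subgp_conj_by)
      fix y z assume "y \<in> conj_by b ` M" "z \<in> conj_by b ` M"
      then obtain v w where vw: "y = conj_by b v" "z = conj_by b w" "v \<in> M" "w \<in> M" by auto
      have "v \<otimes> w = w \<otimes> v" using M(4) vw by (simp add: abelian_def)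
      moreover have "v \<in> carrier G" "w \<in> carrier G" using vw m(3) by auto
      ultimately show "y \<otimes> z = z \<otimes> y" using vw b(1) by (metis conj_by_mult)
    qed
    ultimately show ?thesis by simp
  qed
  show thesis by (rule that[OF q r qr n a c]) (rule ab)
qed

end

section \<open>Nilpotent subgroups and abelian Sylow subgroups\<close>

context finite_group
begin

lemma comm_group_iff: assumes "subgp P" shows "comm_group (G\<lparr>carrier := P\<rparr>) \<longleftrightarrow> abelian P"
proof
  assume "comm_group (G\<lparr>carrier := P\<rparr>)"
  then interpret P: comm_group "G\<lparr>carrier := P\<rparr>" .
  show "abelian P" using P.m_comm assms by (auto simp: abelian_def)
next
  assume "abelian P"
  then show "comm_group (G\<lparr>carrier := P\<rparr>)"
    using group.group_comm_groupI[OF subgroup_imp_group[OF assms]] by (simp add: abelian_def)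
qed

lemma abelian_imp_nilpotent: assumes "abelian S" shows "nilpotent_group (G\<lparr>carrier := S\<rparr>)"
proof -
  have S: "subgp S" using assms by (simp add: abelian_def)
  interpret S: group "G\<lparr>carrier := S\<rparr>" using S by (rule subgroup_imp_group)
  let ?X = "{x \<otimes> y \<otimes> inv\<^bsub>G\<lparr>carrier := S\<rparr>\<^esub> x \<otimes> inv\<^bsub>G\<lparr>carrier := S\<rparr>\<^esub> y | x y. x \<in> S \<and> y \<in> S}"
  have "x \<otimes> y \<otimes> inv\<^bsub>G\<lparr>carrier := S\<rparr>\<^esub> x \<otimes> inv\<^bsub>G\<lparr>carrier := S\<rparr>\<^esub> y = \<one>" if xy: "x \<in> S" "y \<in> S" for x y
  proof -
    have cs: "x \<in> carrier G" "y \<in> carrier G" using xy subgp_carrier[OF S] by auto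
    have "x \<otimes> y = y \<otimes> x" using assms xy by (simp add: abelian_def)
    then have "x \<otimes> y \<otimes> inv x \<otimes> inv y = y \<otimes> x \<otimes> inv x \<otimes> inv y" by simp
    also have "\<dots> = \<one>" using cs by (simp add: m_assoc)
    finally show ?thesis using S xy by (simp add: m_inv_consistent)
  qed
  then have "?X \<subseteq> {\<one>}" by auto
  then have "generate (G\<lparr>carrier := S\<rparr>) ?X \<subseteq> {\<one>}"
    using S.generate_subgroup_incl[OF _ S.triv_subgroup] by simp
  moreover have "\<one> \<in> generate (G\<lparr>carrier := S\<rparr>) ?X" using generate.one[of "G\<lparr>carrier := S\<rparr>"] by simp
  ultimately have "lower_central (G\<lparr>carrier := S\<rparr>) (Suc 0) = {\<one>\<^bsub>G\<lparr>carrier := S\<rparr>\<^esub>}" by auto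
  then show ?thesis unfolding nilpotent_group_def using S.is_group by blast
qed

text \<open>Take the first term of the lower central series inside \<open>A\<close>; the numbering
  starts with \<open>S\<close> itself, so it is not term 0. For \<open>x\<close> in the term before,
  the commutators with elements of \<open>A\<close> fall into \<open>A\<close>, so \<open>x\<close>
  normalizes \<open>A\<close>.\<close>

lemma nilpotent_normalizer:
  assumes nil: "nilpotent_group (G\<lparr>carrier := S\<rparr>)" and S: "subgp S" and A: "subgp A" "A \<subset> S"
  shows "\<exists>x\<in>S. x \<notin> A \<and> x \<in> normalizer_of A"
proof -
  interpret S: group "G\<lparr>carrier := S\<rparr>" using S by (rule subgroup_imp_group)
  let ?c = "lower_central (G\<lparr>carrier := S\<rparr>)"
  have cS: "?c n \<subseteq> S" for n
  proof (induction n)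
    case (Suc n)
    have "?c (Suc n) \<subseteq> carrier (G\<lparr>carrier := S\<rparr>)"
      unfolding lower_central.simps by (rule S.generate_incl) (use Suc S in \<open>auto simp: m_inv_consistent sgI subset_iff\<close>)
    then show ?case by simp
  qed simp
  obtain n where "?c n = {\<one>}" using nil by (auto simp: nilpotent_group_def)
  then have ex: "?c n \<subseteq> A" using subgroup.one_closed[OF A(1)] by simp
  define m where "m = (LEAST n. ?c n \<subseteq> A)"
  have m: "?c m \<subseteq> A" unfolding m_def using ex by (rule LeastI)
  have "m \<noteq> 0" using m A(2) by auto
  then obtain k where k: "m = Suc k" by (cases m) auto
  have "\<not> ?c k \<subseteq> A" using not_less_Least[of k "\<lambda>n. ?c n \<subseteq> A"] k by (simp add: m_def)
  then obtain x where x: "x \<in> ?c k" "x \<notin> A" by blast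
  have xS: "x \<in> S" using x cS by blast
  have xc: "x \<in> carrier G" using subgp_carrier[OF S xS] .
  have "x \<in> normalizer_of A"
  proof (rule nzrI[OF A(1) xc])
    fix a assume a: "a \<in> A"
    have aS: "a \<in> S" and ac: "a \<in> carrier G" using a A subgp_carrier[OF A(1)] by auto
    have "x \<otimes> a \<otimes> inv\<^bsub>G\<lparr>carrier := S\<rparr>\<^esub> x \<otimes> inv\<^bsub>G\<lparr>carrier := S\<rparr>\<^esub> a \<in> ?c m"
      unfolding k lower_central.simps by (rule generate.incl) (use x aS in auto)
    then have "x \<otimes> a \<otimes> inv x \<otimes> inv a \<in> A" using m xS aS S by (auto simp: m_inv_consistent)
    then have "x \<otimes> a \<otimes> inv x \<otimes> inv a \<otimes> a \<in> A" using a A(1) by (simp add: sgI)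
    then show "conj_by x a \<in> A" using xc ac by (simp add: conj_by_def m_assoc)
  qed
  then show ?thesis using x xS by blast
qed

text \<open>For distinct primes the commutator of a \<open>p\<close>-element and a
  \<open>q\<close>-element lies in two normal Sylow subgroups, hence is trivial; for equal primes
  both elements lie in one abelian Sylow subgroup.\<close>

lemma normal_abelian_sylows_imp_abelian:
  assumes S: "subgp S"
    and syl: "\<And>p P. prime p \<Longrightarrow> subgp P \<Longrightarrow> P \<subseteq> S \<Longrightarrow> card P = p ^ multiplicity p (card S) \<Longrightarrow> normal_in P S \<and> abelian P"
  shows "abelian S"
proof -
  have mem: "\<exists>P. normal_in P S \<and> abelian P \<and> card P = p ^ multiplicity p (card S) \<and> (\<forall>x\<in>S. p_element p x \<longrightarrow> x \<in> P)"
    if p: "prime p" for p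
  proof -
    obtain P where P: "subgp P" "P \<subseteq> S" "card P = p ^ multiplicity p (card S)" using sylow_ex[OF S p] by blast
    then show ?thesis using syl[OF p P] p_element_in_normal[of P S _ p] sylow_index[OF S p P] p by blast
  qed
  have com: "x \<otimes> y = y \<otimes> x"
    if x: "x \<in> S" "prime p" "p_element p x" and y: "y \<in> S" "prime q" "p_element q y" for x y p q
  proof -
    obtain P where P: "normal_in P S" "abelian P" "card P = p ^ multiplicity p (card S)" "x \<in> P" "\<forall>x\<in>S. p_element p x \<longrightarrow> x \<in> P"
      using mem[OF x(2)] x by blast
    obtain Q where Q: "normal_in Q S" "card Q = q ^ multiplicity q (card S)" "y \<in> Q"
      using mem[OF y(2)] y by blast
    show ?thesis
    proof (cases "p = q")
      case True
      then have "y \<in> P" using P(5) y by blast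
      then show ?thesis using P(2,4) by (simp add: abelian_def)
    next
      case False
      have cs: "x \<in> carrier G" "y \<in> carrier G" using x y by (auto simp: p_element_def)
      note p' = normal_inD[OF P(1)] and q' = normal_inD[OF Q(1)]
      have "x \<otimes> conj_by y (inv x) \<in> P" using p' P(4) y(1) by (simp add: sgI)
      moreover have "conj_by x y \<otimes> inv y \<in> Q" using q' Q(3) x(1) by (simp add: sgI)
      moreover have e: "x \<otimes> conj_by y (inv x) = conj_by x y \<otimes> inv y" using cs by (simp add: conj_by_def m_assoc)
      ultimately have "conj_by x y \<otimes> inv y = \<one>"
        using p_element_coprime_one[OF p'(1) P(3) x(2) y(2) False] p_element_of_p_subgroup[OF q'(1) Q(2) y(2)] by simp
      then have "conj_by x y = y" using cs inv_solve_right'[of "conj_by x y" \<one> y] by (metis conj_by_closed inv_equality inv_inv inv_closed)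
      then show ?thesis using cs by (simp add: conj_by_eq_iff)
    qed
  qed
  \<comment> \<open>Used twice to pass from elements of prime power order to all elements, first in
    one factor of the commutation relation and then in the other.\<close>
  have step: "centralizer x \<inter> S = S" if x: "x \<in> S" "\<And>q y. y \<in> S \<Longrightarrow> prime q \<Longrightarrow> p_element q y \<Longrightarrow> y \<otimes> x = x \<otimes> y" for x
    using S subgp_Int[OF subgp_centralizer[OF subgp_carrier[OF S x(1)]] S]
    by (rule all_p_elements_imp_eq) (use x(2) in \<open>auto simp: centralizer_def p_element_def\<close>)
  have "x \<otimes> y = y \<otimes> x" if "x \<in> S" "y \<in> S" for x y
  proof -
    have "centralizer x \<inter> S = S"
    proof (rule step[OF that(1)])
      fix q z assume z: "z \<in> S" "prime (q::nat)" "p_element q z"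
      have "centralizer z \<inter> S = S" by (rule step[OF z(1)]) (rule com[OF _ _ _ z])
      then have "x \<in> centralizer z" using that by blast
      then show "z \<otimes> x = x \<otimes> z" by (simp add: centralizer_def)
    qed
    then have "y \<in> centralizer x" using that by blast
    then show ?thesis by (simp add: centralizer_def)
  qed
  then show ?thesis using S by (simp add: abelian_def)
qed

text \<open>The normalizer \<open>N\<close> of a Sylow subgroup \<open>P\<close> in \<open>S\<close>
  is its own normalizer, because \<open>P\<close> is the set of all \<open>p\<close>-elements of
  \<open>N\<close>. By \<open>nilpotent_normalizer\<close> this leaves only
  \<open>N = S\<close>.\<close>

lemma nilpotent_abelian_sylows_imp_abelian:
  assumes nil: "nilpotent_group (G\<lparr>carrier := S\<rparr>)" and S: "subgp S"
    and ab: "\<And>p k P. prime p \<Longrightarrow> subgp P \<Longrightarrow> P \<subseteq> S \<Longrightarrow> card P = p ^ k \<Longrightarrow> abelian P"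
  shows "abelian S"
proof (rule normal_abelian_sylows_imp_abelian[OF S])
  fix p P assume p: "prime (p::nat)" and P: "subgp P" "P \<subseteq> S" "card P = p ^ multiplicity p (card S)"
  define N where "N = normalizer_of P \<inter> S"
  have N: "subgp N" unfolding N_def by (rule subgp_Int[OF subgp_normalizer_of[OF P(1)] S])
  have PN: "P \<subseteq> N" unfolding N_def using normalizer_of_self[OF P(1)] P(2) by blast
  have nPN: "normal_in P N" by (rule normalizer_of_normal_in[OF P(1) N PN]) (simp add: N_def)
  have NS: "N \<subseteq> S" by (simp add: N_def)
  have nd: "\<not> p dvd card N div card P"
    using sylow_index[OF S p P] index_dvd_trans(1)[OF P(1) N S PN NS] dvd_trans by blast
  have "N = S"
  proof (rule ccontr)
    assume "N \<noteq> S"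
    then obtain g where g: "g \<in> S" "g \<notin> N" "g \<in> normalizer_of N"
      using nilpotent_normalizer[OF nil S N] NS by blast
    have gc: "g \<in> carrier G" using subgp_carrier[OF S g(1)] .
    have "g \<in> normalizer_of P"
    proof (rule nzrI[OF P(1) gc])
      fix x assume x: "x \<in> P"
      have "conj_by g x \<in> N" using g(3) x PN by (auto simp: normalizer_of_def)
      then show "conj_by g x \<in> P"
        using p_element_in_normal[OF nPN _ p_element_conj_by[OF gc p_element_of_p_subgroup[OF P(1,3) p x]] p nd] by simp
    qed
    then show False using g by (simp add: N_def)
  qed
  then show "normal_in P S \<and> abelian P" using nPN ab[OF p P(1,2,3)] by simp
qed

end

subsection \<open>Minimal non-abelian groups with abelian Sylow subgroups\<close>

locale minimal_nonabelian = finite_group +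
  assumes proper: "subgp S \<Longrightarrow> S \<noteq> carrier G \<Longrightarrow> abelian S"
    and sylow: "prime p \<Longrightarrow> subgp P \<Longrightarrow> card P = p ^ k \<Longrightarrow> abelian P"
    and nonabelian: "\<not> abelian (carrier G)"
begin

lemma maximal_in_abelian: "maximal_in M (carrier G) \<Longrightarrow> abelian M"
  by (rule proper) (auto dest: maxlD)

text \<open>The centralizer of \<open>z\<close> contains the abelian group \<open>M\<close> and also
  \<open>h\<close> outside it, so by maximality it is \<open>G\<close>.\<close>

lemma maximal_in_centralizer: assumes "maximal_in M (carrier G)" "z \<in> M" "h \<in> carrier G" "h \<notin> M" "h \<otimes> z = z \<otimes> h" shows "z \<in> center"
proof -
  note m = maxlD[OF assms(1)]
  have zc: "z \<in> carrier G" using assms(2) m(3) by blast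
  have "M \<subseteq> centralizer z" using maximal_in_abelian[OF assms(1)] assms(2) m(3) by (auto simp: centralizer_def abelian_def)
  moreover have "h \<in> centralizer z" using assms by (simp add: centralizer_def)
  ultimately have "centralizer z = carrier G" using m(5)[OF subgp_centralizer[OF zc]] assms(4) by (auto simp: centralizer_def)
  then show ?thesis using zc by (auto simp: center_def centralizer_def)
qed

lemma maximal_in_Int: assumes "maximal_in L (carrier G)" "maximal_in M (carrier G)" "L \<noteq> M" shows "L \<inter> M \<subseteq> center"
proof
  fix z assume z: "z \<in> L \<inter> M"
  note l = maxlD[OF assms(1)] and m = maxlD[OF assms(2)]
  have "\<not> L \<subseteq> M" using l(5)[OF m(1) _ m(3)] m(4) assms(3) by blast
  then obtain h where h: "h \<in> L" "h \<notin> M" by blast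
  have "h \<otimes> z = z \<otimes> h" using maximal_in_abelian[OF assms(1)] h z by (simp add: abelian_def)
  then show "z \<in> center" using maximal_in_centralizer[OF assms(2) _ _ h(2)] z h l(3) by blast
qed

lemma center_maximal_in: assumes "maximal_in M (carrier G)" "\<not> normal_in M (carrier G)" shows "center \<subseteq> M"
proof
  fix z assume z: "z \<in> center"
  have "z \<in> normalizer_of M"
  proof (rule nzrI[OF maxlD(1)[OF assms(1)]])
    show zc: "z \<in> carrier G" using z by (simp add: center_def)
    fix x assume x: "x \<in> M"
    then have "x \<in> carrier G" using maxlD(3)[OF assms(1)] by blast
    then have "conj_by z x = x" using z zc by (simp add: conj_by_eq_iff center_def)
    then show "conj_by z x \<in> M" using x by simp
  qed
  then show "z \<in> M" using maximal_in_normalizer_of[OF assms] by simp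
qed

text \<open>Otherwise a Sylow subgroup \<open>P\<close> lies in a normal maximal subgroup
  \<open>L\<close>. As \<open>L\<close> is abelian, \<open>P\<close> is the set of its
  \<open>p\<close>-elements and so is normal in \<open>G\<close>. With all Sylow subgroups normal
  and abelian, \<open>G\<close> would be abelian.\<close>

lemma nonnormal_maximal_in_ex: "\<exists>M. maximal_in M (carrier G) \<and> \<not> normal_in M (carrier G)"
proof (rule ccontr)
  assume neg: "\<not> ?thesis"
  have "abelian (carrier G)"
  proof (rule normal_abelian_sylows_imp_abelian[OF subgroup_self])
    fix p P assume p: "prime (p::nat)" and P: "subgp P" "P \<subseteq> carrier G" "card P = p ^ multiplicity p (card (carrier G))"
    have aP: "abelian P" by (rule sylow[OF p P(1,3)])
    then have "P \<noteq> carrier G" using nonabelian by auto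
    then obtain L where L: "maximal_in L (carrier G)" "P \<subseteq> L" using maximal_in_ex[OF P(1) subgroup_self] P(2) by blast
    note l = maxlD[OF L(1)]
    have nL: "normal_in L (carrier G)" using neg L by blast
    have "normal_in P L" unfolding normal_in_def
    proof (intro conjI ballI P(1) l(1) L(2))
      fix b a assume ba: "b \<in> L" "a \<in> P"
      then have "b \<in> carrier G" "a \<in> carrier G" "b \<otimes> a = a \<otimes> b"
        using maximal_in_abelian[OF L(1)] l(3) L(2) by (auto simp: abelian_def)
      then have "conj_by b a = a" by (simp add: conj_by_eq_iff)
      then show "conj_by b a \<in> P" using ba by simp
    qed
    moreover have "\<not> p dvd card L div card P"
      using sylow_index[OF subgroup_self p P] index_dvd_trans(1)[OF P(1) l(1,2) L(2) l(3)] dvd_trans by blast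
    ultimately have mem: "x \<in> P" if "x \<in> L" "p_element p x" for x using p_element_in_normal that p by blast
    have "normal_in P (carrier G)"
    proof (rule normal_inI[OF P(1)])
      fix g a assume "g \<in> carrier G" "a \<in> P"
      then show "conj_by g a \<in> P"
        using mem[of "conj_by g a"] normal_inD(4)[OF nL] L(2) p_element_conj_by p_element_of_p_subgroup[OF P(1,3) p] by blast
    qed
    then show "normal_in P (carrier G) \<and> abelian P" using aP by simp
  qed
  then show False using nonabelian by simp
qed

text \<open>The count of \<open>exists_normal_maximal_in\<close> with the center as
  \<open>N\<close>: non-normal maximal subgroups contain the center, and distinct ones meet inside
  it.\<close>

lemma normal_maximal_in_ex: "\<exists>L. maximal_in L (carrier G) \<and> normal_in L (carrier G)"
proof (rule ccontr)
  assume neg: "\<not> ?thesis"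
  obtain M where M: "maximal_in M (carrier G)" using nonnormal_maximal_in_ex by blast
  have "\<exists>L. maximal_in L (carrier G) \<and> normal_in L (carrier G)"
    by (rule exists_normal_maximal_in[OF M _ maximal_in_Int subgp_center]) (use neg center_maximal_in in blast)+
  then show False using neg by blast
qed

text \<open>Take a normal maximal subgroup \<open>L\<close> and \<open>h\<close> in \<open>M\<close> outside the center. The commutators
  \<open>[l, h]\<close> form a subgroup \<open>D\<close> of order \<open>|G : M|\<close>, and \<open>D \<langle>h\<rangle>\<close> is non-abelian, hence
  all of \<open>G\<close>. So \<open>h\<close> generates \<open>M\<close>, and no proper subgroup of \<open>M\<close> contains \<open>h\<close>.\<close>

lemma maximal_in_of_nonnormal_maximal_in_central:
  assumes M: "maximal_in M (carrier G)" "\<not> normal_in M (carrier G)" and H: "maximal_in H M"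
  shows "H \<subseteq> center"
proof (rule ccontr)
  assume "\<not> H \<subseteq> center"
  then obtain h where h: "h \<in> H" "h \<notin> center" by blast
  obtain L where L: "maximal_in L (carrier G)" "normal_in L (carrier G)" using normal_maximal_in_ex by blast
  note m = maxlD[OF M(1)] and l = maxlD[OF L(1)] and h' = maxlD[OF H]
  have LM: "L \<noteq> M" using L M by auto
  have nLM: "\<not> L \<subseteq> M" using l(5)[OF m(1) _ m(3)] m(4) LM by blast
  have hM: "h \<in> M" using h h' by blast
  have hL: "h \<notin> L" using maximal_in_Int[OF L(1) M(1) LM] h hM by blast
  have hc: "h \<in> carrier G" using hM m(3) by blast
  have Lc: "x \<in> carrier G" if "x \<in> L" for x using that l(3) by blast
  have Lcom: "x \<otimes> y = y \<otimes> x" if "x \<in> L" "y \<in> L" for x y using maximal_in_abelian[OF L(1)] that by (simp add: abelian_def)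
  have hLL: "conj_by h x \<in> L" if "x \<in> L" for x using normal_inD(4)[OF L(2) hc that] .
  have Lctr: "x \<in> center" if "x \<in> L" "h \<otimes> x = x \<otimes> h" for x using maximal_in_centralizer[OF L(1) that(1) hc hL that(2)] .
  \<comment> \<open>The commutator of \<open>x\<close> and \<open>h\<close>. On the abelian normal
    subgroup \<open>L\<close> it is a homomorphism with kernel
    \<open>L \<inter> center\<close>.\<close>
  define f where "f = (\<lambda>x. x \<otimes> conj_by h (inv x))"
  have fL: "f x \<in> L" if "x \<in> L" for x using hLL that l(1) by (simp add: f_def sgI)
  have fm: "f (x \<otimes> y) = f x \<otimes> f y" if xy: "x \<in> L" "y \<in> L" for x y
  proof -
    have i: "inv x \<in> L" "inv y \<in> L" using xy l(1) by (simp_all add: sgI)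
    have cs: "x \<in> carrier G" "y \<in> carrier G" "conj_by h (inv x) \<in> carrier G" "conj_by h (inv y) \<in> carrier G"
      using xy Lc hc by auto
    have "inv (x \<otimes> y) = inv x \<otimes> inv y" using Lcom[OF i] cs by (simp add: inv_mult_group)
    then have "f (x \<otimes> y) = x \<otimes> (y \<otimes> conj_by h (inv x)) \<otimes> conj_by h (inv y)" using cs hc by (simp add: f_def conj_by_mult m_assoc)
    also have "y \<otimes> conj_by h (inv x) = conj_by h (inv x) \<otimes> y" using Lcom[OF xy(2) hLL[OF i(1)]] .
    also have "x \<otimes> (conj_by h (inv x) \<otimes> y) \<otimes> conj_by h (inv y) = f x \<otimes> f y" using cs by (simp add: f_def m_assoc)
    finally show ?thesis .
  qed
  have f1: "f x = \<one> \<longleftrightarrow> x \<in> center" if x: "x \<in> L" for x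
  proof -
    have xc: "x \<in> carrier G" using x Lc by simp
    have "f x = \<one> \<longleftrightarrow> x = conj_by h x" using xc hc inv_equality[of x "conj_by h (inv x)"]
      by (auto simp: f_def conj_by_inv)
    also have "\<dots> \<longleftrightarrow> h \<otimes> x = x \<otimes> h" using conj_by_eq_iff[OF hc xc] by metis
    also have "\<dots> \<longleftrightarrow> x \<in> center" using Lctr[OF x] hc by (auto simp: center_def)
    finally show ?thesis .
  qed
  define D where "D = f ` L"
  have DL: "D \<subseteq> L" using fL by (auto simp: D_def)
  have finv: "f (inv x) = inv (f x)" if x: "x \<in> L" for x
  proof -
    have xc: "x \<in> carrier G" using x Lc by simp
    have i: "inv x \<in> L" using x l(1) by (simp add: sgI)
    have "f (inv x) \<otimes> f x = f \<one>" using fm[OF i x] xc by simp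
    also have "\<dots> = \<one>" using hc by (simp add: f_def)
    finally show ?thesis using inv_equality[of "f (inv x)" "f x"] fL[OF x] fL[OF i] Lc by simp
  qed
  have D: "subgp D"
  proof (rule subgroupI)
    show "D \<subseteq> carrier G" using DL Lc by blast
    show "D \<noteq> {}" using subgroup.one_closed[OF l(1)] by (auto simp: D_def)
    show "inv a \<in> D" if a: "a \<in> D" for a
    proof -
      obtain x where x: "a = f x" "x \<in> L" using a by (auto simp: D_def)
      then have "inv a = f (inv x)" "inv x \<in> L" using finv l(1) by (simp_all add: sgI)
      then show ?thesis by (simp add: D_def)
    qed
    show "a \<otimes> b \<in> D" if ab: "a \<in> D" "b \<in> D" for a b
    proof -
      obtain x y where xy: "a = f x" "b = f y" "x \<in> L" "y \<in> L" using ab by (auto simp: D_def)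
      then have "a \<otimes> b = f (x \<otimes> y)" using fm by simp
      moreover have "x \<otimes> y \<in> L" using xy l(1) by (simp add: sgI)
      ultimately show ?thesis by (auto simp: D_def)
    qed
  qed
  have "card D * card (L \<inter> center) = card L" unfolding D_def
  proof (rule card_fibers[OF l(1) subgp_Int[OF l(1) subgp_center]])
    fix g k assume gk: "g \<in> L" "k \<in> L"
    have i: "inv k \<in> L" and j: "inv k \<otimes> g \<in> L" using gk l(1) by (simp_all add: sgI)
    have cs: "f g \<in> carrier G" "f k \<in> carrier G" using gk fL Lc by auto
    have "f (inv k \<otimes> g) = inv (f k) \<otimes> f g" using fm[OF i gk(1)] finv gk by simp
    moreover have "inv (f k) \<otimes> f g = \<one> \<longleftrightarrow> f g = f k"
      using cs inv_solve_left'[of \<one> "f k" "f g"] by simp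
    ultimately have "f g = f k \<longleftrightarrow> f (inv k \<otimes> g) = \<one>" by simp
    then show "f g = f k \<longleftrightarrow> inv k \<otimes> g \<in> L \<inter> center" using f1[OF j] j by simp
  qed simp
  \<comment> \<open>With this the order of \<open>D\<close> is the index of
    \<open>L \<inter> M\<close> in \<open>L\<close>, which is the index of \<open>M\<close> in
    \<open>G\<close>, as \<open>L\<close> and \<open>M\<close> together make up
    \<open>G\<close>.\<close>
  moreover have "L \<inter> center = L \<inter> M" using maximal_in_Int[OF L(1) M(1) LM] center_maximal_in[OF M] by blast
  moreover have "L <#> M = carrier G"
  proof (rule m(5)[OF subgp_normal_mult[OF L(2) m(1)]])
    show "M \<subseteq> L <#> M" using set_mult_right[OF l(1) m(3)] .
    show "L <#> M \<subseteq> carrier G" using l(3) m(3) by (rule set_mult_closed)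
    show "L <#> M \<noteq> M" using set_mult_left[OF m(1) l(3)] nLM by blast
  qed
  then have "card (carrier G) * card (L \<inter> M) = card L * card M" using card_mult[OF l(1) m(1)] by simp
  ultimately have "card (L \<inter> M) * card (carrier G) = card (L \<inter> M) * (card D * card M)"
    by (metis mult.assoc mult.commute)
  then have cG: "card (carrier G) = card D * card M" using subgp_card_pos[OF subgp_Int[OF l(1) m(1)]] by simp
  have "h \<in> normalizer_of D"
  proof (rule nzrI[OF D hc])
    fix d assume "d \<in> D"
    then obtain x where x: "x \<in> L" "d = f x" by (auto simp: D_def)
    have "conj_by h d = f (conj_by h x)" using x Lc hc by (simp add: f_def conj_by_mult conj_by_inv)
    then show "conj_by h d \<in> D" using hLL[OF x(1)] by (auto simp: D_def)
  qed
  then have "generate G {h} \<subseteq> normalizer_of D" using gen_sub subgp_normalizer_of[OF D] by blast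
  then have sX: "subgp (D <#> generate G {h})"
    using D subgp_gen[OF hc] by (intro subgp_mult) (auto simp: normalizer_of_def)
  have "D <#> generate G {h} = carrier G"
  proof (rule ccontr)
    assume "D <#> generate G {h} \<noteq> carrier G"
    then have ab: "abelian (D <#> generate G {h})" by (rule proper[OF sX])
    have Dctr: "D \<subseteq> center"
    proof
      fix d assume d: "d \<in> D"
      have "d \<in> D <#> generate G {h}" using d set_mult_left[OF subgp_gen[OF hc] subgroup.subset[OF D]] by blast
      moreover have "h \<in> D <#> generate G {h}"
        using gen_mem set_mult_right[OF D subgroup.subset[OF subgp_gen[OF hc]]] by blast
      ultimately have "h \<otimes> d = d \<otimes> h" using ab by (simp add: abelian_def)
      then show "d \<in> center" using Lctr d DL by blast
    qed
    \<comment> \<open>The conjugate of \<open>h\<close> by \<open>x\<close> is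
      \<open>f x \<otimes> h\<close>, hence it stays in \<open>M\<close> once \<open>D\<close> is
      central. So \<open>M\<close> and its conjugate by \<open>x\<close> share a non-central element
      and must be equal; \<open>x\<close> then lies in the normalizer of \<open>M\<close>, that is,
      in \<open>M\<close>.\<close>
    have "L \<subseteq> M"
    proof
      fix x assume x: "x \<in> L"
      have xc: "x \<in> carrier G" using x Lc by simp
      have "f x \<in> M" using x Dctr center_maximal_in[OF M] by (auto simp: D_def)
      then have "f x \<otimes> h \<in> M" using hM m(1) by (simp add: sgI)
      moreover have "f x \<otimes> h = conj_by x h" using xc hc by (simp add: f_def conj_by_def m_assoc)
      ultimately have "conj_by x h \<in> M \<inter> conj_by x ` M" using hM by simp
      moreover have "conj_by x h \<notin> center"
      proof
        assume "conj_by x h \<in> center"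
        then have "inv x \<otimes> conj_by x h = conj_by x h \<otimes> inv x" using xc by (simp add: center_def)
        then have "conj_by (inv x) (conj_by x h) = conj_by x h" using xc hc by (simp only: conj_by_eq_iff conj_by_closed inv_closed)
        then show False using xc hc h(2) \<open>conj_by x h \<in> center\<close> by simp
      qed
      ultimately have "conj_by x ` M = M" using maximal_in_Int[OF M(1) maximal_in_conj_by[OF M(1) xc]] by blast
      then show "x \<in> M" using maximal_in_normalizer_of[OF M] xc by (auto simp: normalizer_of_def)
    qed
    then show False using nLM by simp
  qed
  \<comment> \<open>Comparison of the two expressions for the order of \<open>G\<close> shows that
    \<open>card M\<close> is at most the order of \<open>h\<close>, hence at most
    \<open>card H\<close>.\<close>
  then have "card D * card M * card (D \<inter> generate G {h}) = card D * card (generate G {h})"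
    using card_mult[OF D subgp_gen[OF hc]] cG by simp
  then have "card M * card (D \<inter> generate G {h}) = card (generate G {h})"
    using subgp_card_pos[OF D] by simp
  moreover have "card (D \<inter> generate G {h}) > 0" by (rule subgp_card_pos[OF subgp_Int[OF D subgp_gen[OF hc]]])
  moreover have "card (generate G {h}) \<le> card H"
    using gen_sub[OF h'(1) h(1)] subgp_finite[OF h'(1)] by (rule card_mono[rotated])
  moreover have "card H < card M" using h'(3,4) subgp_finite[OF m(1)] by (intro psubset_card_mono) auto
  ultimately show False by (metis One_nat_def Suc_leI leD le_trans mult.right_neutral mult_le_mono2)
qed

end

section \<open>Translation of the original definitions, and the two implications\<close>

lemma (in sigma_group) n_maximal_1: "n_maximal_subgroup (Suc 0) M G \<longleftrightarrow> maximal_in M (carrier G)"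
proof
  assume "n_maximal_subgroup (Suc 0) M G"
  then show "maximal_in M (carrier G)" using maximal_in_iff[OF subgroup_self] by (auto simp: n_maximal_subgroup_def)
next
  assume "maximal_in M (carrier G)"
  then show "n_maximal_subgroup (Suc 0) M G" unfolding n_maximal_subgroup_def
    using maximal_in_iff[OF subgroup_self] by (auto intro!: exI[of _ "\<lambda>i. if i = 0 then carrier G else M"])
qed

lemma (in sigma_group) n_maximal_2:
  "n_maximal_subgroup 2 H G \<longleftrightarrow> (\<exists>M. maximal_in M (carrier G) \<and> maximal_in H M)"
proof
  assume "n_maximal_subgroup 2 H G"
  then obtain f where f: "f 0 = carrier G" "f 2 = H" "\<And>i. i \<in> {1..2::nat} \<Longrightarrow> maximal_subgroup (f i) (G\<lparr>carrier := f (i - 1)\<rparr>)"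
    by (auto simp: n_maximal_subgroup_def)
  have "maximal_in (f 1) (carrier G)" using f(3)[of 1] f(1) maximal_in_iff[OF subgroup_self] by simp
  moreover from maxlD(1)[OF this] have "maximal_in H (f 1)" using f(3)[of 2] f(2) maximal_in_iff by simp
  ultimately show "\<exists>M. maximal_in M (carrier G) \<and> maximal_in H M" by blast
next
  assume "\<exists>M. maximal_in M (carrier G) \<and> maximal_in H M"
  then obtain M where M: "maximal_in M (carrier G)" "maximal_in H M" by blast
  have "{1..2::nat} = {1, 2}" by auto
  then show "n_maximal_subgroup 2 H G" unfolding n_maximal_subgroup_def
    using maximal_in_iff[OF subgroup_self] maximal_in_iff[OF maxlD(1)[OF M(1)]] M
    by (auto intro!: exI[of _ "\<lambda>i::nat. if i = 0 then carrier G else if i = 1 then M else H"])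
qed

lemma (in sigma_group) m_sigma_eq_2:
  "m_sigma_eq \<sigma> G 2 \<longleftrightarrow>
    (\<forall>M H. maximal_in M (carrier G) \<longrightarrow> maximal_in H M \<longrightarrow> sigma_sub H (carrier G)) \<and>
    (\<exists>M. maximal_in M (carrier G) \<and> \<not> sigma_sub M (carrier G))"
  unfolding m_sigma_eq_def n_maximal_2 sigma_subnormal_iff by (auto simp: n_maximal_1)

lemma (in sigma_group) card_sigma_set_eq:
  "card (sigma_set \<sigma> G) = card (prime_set G) \<longleftrightarrow> inj_on sigma_class (prime_set G)"
  unfolding sigma_set_eq using finite_primes[of "order G"] finite_carrier
  by (intro inj_on_iff_eq_card[symmetric]) (simp add: prime_set_def order_gt_0_iff_finite)

text \<open>A critical subgroup is proper and its own normalizer, which excludes nilpotency. The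
  order of \<open>G\<close> has exactly two prime divisors, so every Sylow subgroup is proper, hence
  abelian, and the two primes lie in different classes.\<close>

lemma (in sigma_m2) critical_imp_schmidt:
  assumes "\<exists>M. critical M"
  shows "schmidt_group G" "sylow_subgroup p P G \<Longrightarrow> comm_group (G\<lparr>carrier := P\<rparr>)"
    "inj_on sigma_class (prime_set G)"
proof -
  obtain q r n a where q: "prime q" "prime r" "sigma_class q \<noteq> sigma_class r" "n > 0" "a > 0"
    and c: "card (carrier G) = r ^ a * q ^ n"
    and ab: "\<And>S. subgp S \<Longrightarrow> S \<noteq> carrier G \<Longrightarrow> abelian S"
    by (rule proper_abelian[OF assms]) blast
  have "\<not> nilpotent_group G"
  proof
    assume nil: "nilpotent_group G"
    obtain M where M: "critical M" using assms by blast
    then have mM: "maximal_in M (carrier G)" by (simp add: critical_def)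
    have "normalizer_of M = M" using maximal_in_normalizer_of[OF mM critical_not_normal[OF M]] .
    then show False using nilpotent_normalizer[OF _ subgroup_self maxlD(1)[OF mM]] nil maxlD(3,4)[OF mM] by auto
  qed
  then show "schmidt_group G"
    using ab abelian_imp_nilpotent is_group by (auto simp: schmidt_group_def)
  show "comm_group (G\<lparr>carrier := P\<rparr>)" if P: "sylow_subgroup p P G"
  proof -
    have p: "prime p" "subgp P" "card P = p ^ multiplicity p (order G)" using P by (auto simp: sylow_subgroup_def)
    have "P \<noteq> carrier G"
    proof
      assume "P = carrier G"
      then have "r ^ a * q ^ n = p ^ multiplicity p (order G)" using p c by simp
      moreover have "r dvd r ^ a * q ^ n" "q dvd r ^ a * q ^ n" using q by (auto intro: dvd_mult2)
      ultimately have "r = p" "q = p" using primes_dvd_power_eq q p(1) by metis+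
      then show False using q by simp
    qed
    then show ?thesis using comm_group_iff[OF p(2)] ab[OF p(2)] by simp
  qed
  have "p = r \<or> p = q" if "p \<in> prime_set G" for p
  proof -
    have "prime p" "p dvd r ^ a * q ^ n" using that c by (auto simp: prime_set_def order_def)
    then show ?thesis using primes_dvd_power_eq q prime_dvd_mult_iff by metis
  qed
  then show "inj_on sigma_class (prime_set G)" using q(3) by (auto intro!: inj_onI)
qed

lemma (in sigma_group) schmidt_imp_m_sigma_eq_2:
  assumes sch: "schmidt_group G"
    and syl: "\<forall>p P. sylow_subgroup p P G \<longrightarrow> comm_group (G\<lparr>carrier := P\<rparr>)"
    and inj: "inj_on sigma_class (prime_set G)"
  shows "m_sigma_eq \<sigma> G 2"
proof -
  \<comment> \<open>Every \<open>p\<close>-subgroup lies in a conjugate of one Sylow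
    subgroup.\<close>
  have pab: "abelian P" if p: "prime p" and P: "subgp P" "card P = p ^ k" for p k P
  proof -
    obtain Q where Q: "subgp Q" "Q \<subseteq> carrier G" "card Q = p ^ multiplicity p (card (carrier G))"
      using sylow_ex[OF subgroup_self p] by blast
    have "abelian Q" using syl comm_group_iff[OF Q(1)] Q p by (auto simp: sylow_subgroup_def order_def)
    obtain b where b: "b \<in> carrier G" "P \<subseteq> conj_by b ` Q"
      using p_subgroup_conj[OF subgroup_self Q(1,2) P(1) subgroup.subset[OF P(1)] P(2) p sylow_index[OF subgroup_self p Q]]
      by blast
    have "x \<otimes> y = y \<otimes> x" if xy: "x \<in> P" "y \<in> P" for x y
    proof -
      obtain u v where uv: "x = conj_by b u" "y = conj_by b v" "u \<in> Q" "v \<in> Q" using xy b by blast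
      have "u \<otimes> v = v \<otimes> u" using \<open>abelian Q\<close> uv by (simp add: abelian_def)
      then show ?thesis using uv Q(2) b(1) conj_by_mult by (metis subsetD)
    qed
    then show ?thesis using P(1) by (simp add: abelian_def)
  qed
  interpret minimal_nonabelian G
  proof
    show "abelian S" if "subgp S" "S \<noteq> carrier G" for S
    proof (rule nilpotent_abelian_sylows_imp_abelian[OF _ that(1)])
      show "nilpotent_group (G\<lparr>carrier := S\<rparr>)" using sch that by (simp add: schmidt_group_def)
    qed (use pab in blast)
    show "\<not> abelian (carrier G)" using sch abelian_imp_nilpotent[of "carrier G"] by (auto simp: schmidt_group_def)
  qed (use pab in blast)
  \<comment> \<open>If \<open>M\<close> is normal, two normal steps suffice because \<open>M\<close>
    is abelian. Otherwise \<open>H\<close> is central and one normal step does.\<close>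
  have "sigma_sub H (carrier G)" if M: "maximal_in M (carrier G)" and H: "maximal_in H M" for M H
  proof (cases "normal_in M (carrier G)")
    case True
    have "normal_in H M" unfolding normal_in_def
    proof (intro conjI ballI)
      fix b a assume ba: "b \<in> M" "a \<in> H"
      then have "b \<in> carrier G" "a \<in> carrier G" "b \<otimes> a = a \<otimes> b"
        using maximal_in_abelian[OF M] maxlD(3)[OF M] maxlD(3)[OF H] by (auto simp: abelian_def)
      then have "conj_by b a = a" by (simp add: conj_by_eq_iff)
      then show "conj_by b a \<in> H" using ba by simp
    qed (use maxlD[OF H] in auto)
    then have "sigma_step H M" "sigma_step M (carrier G)" using True by (auto simp: sigma_step_def dest: normal_inD)
    then show ?thesis using maxlD(1)[OF H] by (auto simp: sigma_sub_def)
  next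
    case False
    have "normal_in H (carrier G)"
      using normal_center_sub[OF maxlD(1)[OF H] maximal_in_of_nonnormal_maximal_in_central[OF M False H]] .
    then have "sigma_step H (carrier G)" by (auto simp: sigma_step_def dest: normal_inD)
    then show ?thesis using maxlD(1)[OF H] by (auto simp: sigma_sub_def)
  qed
  moreover have "\<exists>M. maximal_in M (carrier G) \<and> \<not> sigma_sub M (carrier G)"
  proof -
    obtain M where M: "maximal_in M (carrier G)" "\<not> normal_in M (carrier G)" using nonnormal_maximal_in_ex by blast
    note m = maxlD[OF M(1)]
    \<comment> \<open>A witness \<open>C\<close> would lie in \<open>M\<close> and in a different
      conjugate of \<open>M\<close>, hence in the center.\<close>
    have "\<not> sigma_sub M (carrier G)"
    proof
      assume "sigma_sub M (carrier G)"
      then obtain C s where C: "s \<in> \<sigma>" "normal_in C (carrier G)" "C \<subseteq> M" "pi_number s (card (carrier G) div card C)"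
        using sigma_sub_maximal_in[OF M(1)] by blast
      note c = normal_inD[OF C(2)]
      have "normalizer_of M \<noteq> carrier G" using maximal_in_normalizer_of[OF M] m(4) by simp
      then obtain g where g: "g \<in> carrier G" "conj_by g ` M \<noteq> M" by (auto simp: normalizer_of_def)
      have "C \<subseteq> M \<inter> conj_by g ` M" using C(3) normal_in_conj_by[OF C(2) g(1)] by blast
      then have Cctr: "C \<subseteq> center" using maximal_in_Int[OF M(1) maximal_in_conj_by[OF M(1) g(1)]] g(2) by auto
      have "card (carrier G) div card C \<noteq> 1"
      proof
        assume "card (carrier G) div card C = 1"
        then have "card C = card (carrier G)" using subgp_dvd[OF c(1,2,3)] by (metis dvd_mult_div_cancel mult.right_neutral)
        then have "C = carrier G" using card_subset_eq[OF finite_carrier c(3)] by simp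
        then show False using C(3) m(3,4) by blast
      qed
      then obtain p where p: "prime p" "p dvd card (carrier G) div card C" using prime_factor_nat by blast
      have dG: "k dvd card (carrier G)" if "k dvd card (carrier G) div card C" for k
        using that subgp_dvd[OF c(1,2,3)] by (metis dvd_mult_div_cancel dvd_mult)
      \<comment> \<open>The place where each class contributes at most one prime divisor of the
        order of \<open>G\<close>: the index of \<open>C\<close> has no prime divisor besides
        \<open>p\<close>.\<close>
      have only: "k = p" if k: "prime k" "k dvd card (carrier G) div card C" for k
      proof -
        have "sigma_class k = s" "sigma_class p = s" using C(4) k p sigma_class_eq[OF _ C(1)] unfolding pi_number_def by blast+
        moreover have "k \<in> prime_set G" "p \<in> prime_set G" using k p dG by (auto simp: prime_set_def order_def)
        ultimately show ?thesis using inj by (auto dest: inj_onD)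
      qed
      obtain P where P: "subgp P" "P \<subseteq> carrier G" "card P = p ^ multiplicity p (card (carrier G))"
        using sylow_ex[OF subgroup_self p(1)] by blast
      have aP: "abelian P" using pab[OF p(1) P(1,3)] .
      \<comment> \<open>The index of \<open>U\<close> divides that of \<open>C\<close>, a power of
        \<open>p\<close>, and that of \<open>P\<close>, which is prime to \<open>p\<close>. So
        \<open>U\<close> is \<open>G\<close>, and then the abelian group \<open>P\<close> is
        central.\<close>
      define U where "U = C <#> P"
      have U: "subgp U" unfolding U_def using subgp_normal_mult[OF C(2) P(1)] .
      have Uc: "U \<subseteq> carrier G" using U by (rule subgroup.subset)
      have CU: "C \<subseteq> U" and PU: "P \<subseteq> U" unfolding U_def
        using set_mult_left[OF P(1) c(3)] set_mult_right[OF c(1) P(2)] by auto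
      have "card (carrier G) div card U = 1"
      proof (rule ccontr)
        assume "card (carrier G) div card U \<noteq> 1"
        then obtain k where k: "prime k" "k dvd card (carrier G) div card U" using prime_factor_nat by blast
        have "k dvd card (carrier G) div card C"
          using k(2) index_dvd_trans(2)[OF c(1) U subgroup_self CU Uc] dvd_trans by blast
        then have "k = p" using only k by simp
        moreover have "k dvd card (carrier G) div card P"
          using k(2) index_dvd_trans(2)[OF P(1) U subgroup_self PU Uc] dvd_trans by blast
        ultimately show False using sylow_index[OF subgroup_self p(1) P] by simp
      qed
      then have "card U = card (carrier G)" using subgp_dvd[OF U subgroup_self Uc] by (metis dvd_mult_div_cancel mult.right_neutral)
      then have UG: "U = carrier G" using card_subset_eq[OF finite_carrier Uc] by simp
      have "P \<subseteq> center"
      proof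
        fix y assume y: "y \<in> P"
        have yc: "y \<in> carrier G" using y P(2) by blast
        have "C \<subseteq> centralizer y" using Cctr yc by (auto simp: center_def centralizer_def)
        moreover have "P \<subseteq> centralizer y" using aP y P(2) by (auto simp: abelian_def centralizer_def)
        ultimately have "U \<subseteq> centralizer y" unfolding U_def by (rule set_mult_subset[OF subgp_centralizer[OF yc]])
        then show "y \<in> center" using UG yc by (auto simp: center_def centralizer_def)
      qed
      then have "U \<subseteq> center" unfolding U_def using set_mult_subset[OF subgp_center Cctr] by blast
      then have "abelian (carrier G)" using UG subgroup_self by (auto simp: abelian_def center_def)
      then show False using nonabelian by simp
    qed
    then show ?thesis using M by blast
  qed
  ultimately show ?thesis unfolding m_sigma_eq_2 by blast
qed

theorem corollary1p7:
  fixes G :: "('a, 'b) monoid_scheme" and \<sigma> :: "nat set set"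
  assumes "partition_on primes \<sigma>"
    and "group G" and "finite (carrier G)"
  shows "m_sigma_eq \<sigma> G 2 \<longleftrightarrow>
    schmidt_group G \<and>
    (\<forall>p P. sylow_subgroup p P G \<longrightarrow> comm_group (G\<lparr>carrier := P\<rparr>)) \<and>
    card (sigma_set \<sigma> G) = card (prime_set G)"
proof -
  interpret group G by fact
  interpret sigma_group G \<sigma> by unfold_locales (fact assms)+
  show ?thesis
  proof
    assume m: "m_sigma_eq \<sigma> G 2"
    interpret sigma_m2 G \<sigma> using m by unfold_locales (auto simp: m_sigma_eq_2)
    have "\<exists>M. critical M" using m by (auto simp: m_sigma_eq_2 critical_def)
    then show "schmidt_group G \<and>
      (\<forall>p P. sylow_subgroup p P G \<longrightarrow> comm_group (G\<lparr>carrier := P\<rparr>)) \<and>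
      card (sigma_set \<sigma> G) = card (prime_set G)"
      using critical_imp_schmidt card_sigma_set_eq by blast
  qed (use schmidt_imp_m_sigma_eq_2 card_sigma_set_eq in blast)
qed

end
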